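(* Let $X=\{X(t):t\in\mathbb R\}$ be a centered Gaussian process with stationary increments, $X(0)=0$, continuous sample paths and variance function $\sigma^2(t)=\operatorname{Var}X(t)$. Suppose that $\sigma$ is regularly varying at zero with parameter $\lambda\in(0,1)$, and let $\delta(c):=\inf\{x>0: x/\sigma(x)=1/c\}$. Then $$\frac{X(\delta(c)\,\cdot)}{\sigma(\delta(c))}\xrightarrow{d} B_\lambda(\cdot)\quad\text{as } c\to\infty,$$ in $C(\mathbb R)$, where $B_\lambda$ is fractional Brownian motion with Hurst parameter $\lambda$. If, moreover, $\sigma$ is regularly varying at infinity with parameter $\alpha\in(0,1)$, then the convergence also holds in $\Omega^\gamma$, for any $\gamma>\max\{\lambda,\alpha\}$.
   Context: Regular variation: a non-negative measurable function $f$ on $[0,\infty)$ is regularly varying at infinity with parameter $\alpha$ if $f(tx)/f(x)\to t^\alpha$ as $x\to\infty$ for all $t>0$; it is regularly varying at zero with parameter $\lambda$ if $f(tx)/f(x)\to t^\lambda$ as $x\to0$ for all $t>0$. Fractional Brownian motion $B_H=\{B_H(t):t\in\mathbb R\}$ with Hurst parameter $H\in(0,1)$ is the centered Gaussian process with stationary increments, continuous sample paths, $B_H(0)=0$ and covariance $\mathrm{Cov}(B_H(t),B_H(s))=\tfrac12(|s|^{2H}+|t|^{2H}-|t-s|^{2H})$. The function $\delta$ satisfies $c\,\delta(c)/\sigma(\delta(c))=1$; it is considered for those $c>0$ for which the set $\{x>0:x/\sigma(x)=1/c\}$ is nonempty, which is the case for all sufficiently large $c$. $C(\mathbb R)$ is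 the space of continuous functions $\mathbb R\to\mathbb R$ with the topology of uniform convergence on compact intervals $[-T,T]$, $T>0$. For $\gamma\ge0$, $\Omega^\gamma$ is the space of continuous functions $f:\mathbb R\to\mathbb R$ with $\lim_{t\to\pm\infty}f(t)/(1+|t|^\gamma)=0$, equipped with the norm $\|f\|_{\Omega^\gamma}=\sup_{t\in\mathbb R}|f(t)|/(1+|t|^\gamma)$, a separable Banach space. $\xrightarrow{d}$ denotes weak convergence (convergence in distribution) of random elements of the indicated space. *)

theory Defs
  imports "HOL-Probability.Probability"
begin

section \<open>Regular variation\<close>

text \<open>Division by zero is harmless: since the limits are positive, they can only hold if
  \<open>f\<close> is eventually nonzero.\<close>

definition regularly_varying_at_infinity :: "(real \<Rightarrow> real) \<Rightarrow> real \<Rightarrow> bool" where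
  "regularly_varying_at_infinity f \<alpha> \<longleftrightarrow>
     (\<forall>x\<ge>0. f x \<ge> 0) \<and> f \<in> borel_measurable (restrict_space borel {0..}) \<and>
     (\<forall>t>0. ((\<lambda>x. f (t * x) / f x) \<longlongrightarrow> t powr \<alpha>) at_top)"

definition regularly_varying_at_zero :: "(real \<Rightarrow> real) \<Rightarrow> real \<Rightarrow> bool" where
  "regularly_varying_at_zero f l \<longleftrightarrow>
     (\<forall>x\<ge>0. f x \<ge> 0) \<and> f \<in> borel_measurable (restrict_space borel {0..}) \<and>
     (\<forall>t>0. ((\<lambda>x. f (t * x) / f x) \<longlongrightarrow> t powr l) (at_right 0))"

section \<open>Gaussian processes\<close>

text \<open>Point masses count as Gaussian; \<^const>\<open>normal_density\<close> only covers positive variance.\<close>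

definition gaussian_rv :: "'a measure \<Rightarrow> ('a \<Rightarrow> real) \<Rightarrow> bool" where
  "gaussian_rv M Y \<longleftrightarrow> Y \<in> borel_measurable M \<and>
     ((\<exists>\<mu>. AE \<omega> in M. Y \<omega> = \<mu>) \<or>
      (\<exists>\<mu> s. s > 0 \<and> distributed M lborel Y (\<lambda>x. ennreal (normal_density \<mu> s x))))"

definition gaussian_process :: "'a measure \<Rightarrow> (real \<Rightarrow> 'a \<Rightarrow> real) \<Rightarrow> bool" where
  "gaussian_process M X \<longleftrightarrow> prob_space M \<and>
     (\<forall>J a. finite J \<longrightarrow> gaussian_rv M (\<lambda>\<omega>. \<Sum>t\<in>J. a t * X t \<omega>))"

definition centered :: "'a measure \<Rightarrow> (real \<Rightarrow> 'a \<Rightarrow> real) \<Rightarrow> bool" where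
  "centered M X \<longleftrightarrow> (\<forall>t. prob_space.expectation M (X t) = 0)"

text \<open>Equality of laws on the product \<open>\<sigma>\<close>-algebra of all real functions, which amounts to equality
  of all finite-dimensional distributions.\<close>

definition stationary_increments :: "'a measure \<Rightarrow> (real \<Rightarrow> 'a \<Rightarrow> real) \<Rightarrow> bool" where
  "stationary_increments M X \<longleftrightarrow>
     (\<forall>s. distr M (Pi\<^sub>M UNIV (\<lambda>_. borel)) (\<lambda>\<omega> t. X (s + t) \<omega> - X s \<omega>) =
          distr M (Pi\<^sub>M UNIV (\<lambda>_. borel)) (\<lambda>\<omega> t. X t \<omega> - X 0 \<omega>))"

definition continuous_paths :: "'a measure \<Rightarrow> (real \<Rightarrow> 'a \<Rightarrow> real) \<Rightarrow> bool" where
  "continuous_paths M X \<longleftrightarrow> (\<forall>\<omega>\<in>space M. continuous_on UNIV (\<lambda>t. X t \<omega>))"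

definition std_dev :: "'a measure \<Rightarrow> (real \<Rightarrow> 'a \<Rightarrow> real) \<Rightarrow> real \<Rightarrow> real" where
  "std_dev M X t = sqrt (prob_space.variance M (X t))"

definition covariance :: "'a measure \<Rightarrow> ('a \<Rightarrow> real) \<Rightarrow> ('a \<Rightarrow> real) \<Rightarrow> real" where
  "covariance M Y Z = prob_space.expectation M
     (\<lambda>\<omega>. (Y \<omega> - prob_space.expectation M Y) * (Z \<omega> - prob_space.expectation M Z))"

definition fractional_brownian_motion ::
    "real \<Rightarrow> 'a measure \<Rightarrow> (real \<Rightarrow> 'a \<Rightarrow> real) \<Rightarrow> bool" where
  "fractional_brownian_motion H M B \<longleftrightarrow>
     0 < H \<and> H < 1 \<and>
     gaussian_process M B \<and> centered M B \<and> stationary_increments M B \<and> continuous_paths M B \<and>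
     (AE \<omega> in M. B 0 \<omega> = 0) \<and>
     (\<forall>s t. covariance M (B t) (B s) =
        (\<bar>s\<bar> powr (2 * H) + \<bar>t\<bar> powr (2 * H) - \<bar>t - s\<bar> powr (2 * H)) / 2)"

section \<open>The path spaces\<close>

definition uniform_on_compacts_topology :: "(real \<Rightarrow> real) topology" where
  "uniform_on_compacts_topology = topology (\<lambda>U.
     U \<subseteq> {f. continuous_on UNIV f} \<and>
     (\<forall>f\<in>U. \<exists>T>0. \<exists>e>0. \<forall>g. continuous_on UNIV g \<and> (\<forall>t\<in>{-T..T}. \<bar>g t - f t\<bar> < e) \<longrightarrow> g \<in> U))"

lemma openin_uniform_on_compacts:
  "openin uniform_on_compacts_topology U \<longleftrightarrow>
     U \<subseteq> {f. continuous_on UNIV f} \<and>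
     (\<forall>f\<in>U. \<exists>T>0. \<exists>e>0. \<forall>g. continuous_on UNIV g \<and> (\<forall>t\<in>{-T..T}. \<bar>g t - f t\<bar> < e) \<longrightarrow> g \<in> U)"
proof -
  let ?near = "\<lambda>U f T e. \<forall>g. continuous_on UNIV g \<and> (\<forall>t\<in>{-T..T}. \<bar>g t - f t\<bar> < e) \<longrightarrow> g \<in> U"
  let ?L = "\<lambda>U :: (real \<Rightarrow> real) set. U \<subseteq> {f. continuous_on UNIV f} \<and>
     (\<forall>f\<in>U. \<exists>T>0. \<exists>e>0. ?near U f T (e::real))"
  have "?L (U \<inter> V)" if U: "?L U" and V: "?L V" for U V
  proof (intro conjI ballI)
    show "U \<inter> V \<subseteq> {f. continuous_on UNIV f}" using U by blast
    fix f assume f: "f \<in> U \<inter> V"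
    obtain T e where 1: "T > 0" "e > 0" "?near U f T e" using U f by blast
    obtain T' e' where 2: "T' > 0" "e' > 0" "?near V f T' e'" using V f by blast
    have "?near (U \<inter> V) f (max T T') (min e e')"
    proof (intro allI impI)
      fix g assume g: "continuous_on UNIV g \<and> (\<forall>t\<in>{-max T T'..max T T'}. \<bar>g t - f t\<bar> < min e e')"
      then have "\<forall>t\<in>{-T..T}. \<bar>g t - f t\<bar> < e" "\<forall>t\<in>{-T'..T'}. \<bar>g t - f t\<bar> < e'"
        by (force simp: min_less_iff_conj)+
      with g 1(3) 2(3) show "g \<in> U \<inter> V" by blast
    qed
    moreover have "max T T' > 0" "min e e' > 0" using 1 2 by auto
    ultimately show "\<exists>T>0. \<exists>e>0. ?near (U \<inter> V) f T e" by blast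
  qed
  moreover have "?L (\<Union>K)" if K: "\<forall>U\<in>K. ?L U" for K
  proof (intro conjI ballI)
    show "\<Union>K \<subseteq> {f. continuous_on UNIV f}" using K by blast
    fix f assume "f \<in> \<Union>K"
    then obtain U where U: "U \<in> K" "f \<in> U" by blast
    then obtain T e where "T > 0" "e > 0" "?near U f T e" using K by blast
    with U(1) show "\<exists>T>0. \<exists>e>0. ?near (\<Union>K) f T e" by blast
  qed
  ultimately have "istopology ?L" unfolding istopology_def by blast
  then show ?thesis unfolding uniform_on_compacts_topology_def by (simp add: topology_inverse')
qed

lemma topspace_uniform_on_compacts [simp]:
  "topspace uniform_on_compacts_topology = {f. continuous_on UNIV f}"
proof
  show "topspace uniform_on_compacts_topology \<subseteq> {f. continuous_on UNIV f}"
    using openin_uniform_on_compacts openin_topspace by blast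
  have "openin uniform_on_compacts_topology {f. continuous_on UNIV f}"
    unfolding openin_uniform_on_compacts using zero_less_one[where ?'a = real] by blast
  then show "{f. continuous_on UNIV f} \<subseteq> topspace uniform_on_compacts_topology"
    by (rule openin_subset)
qed

text \<open>Since \<^term>\<open>0 powr 0 = (0::real)\<close>, for \<open>\<gamma> = 0\<close> the weight below differs from \<open>1 + \<bar>t\<bar>\<^sup>\<gamma>\<close> at
  the single point \<open>t = 0\<close>; for \<open>\<gamma> > 0\<close> it is exactly \<open>1 + \<bar>t\<bar>\<^sup>\<gamma>\<close>.\<close>

definition Omega_space :: "real \<Rightarrow> (real \<Rightarrow> real) set" where
  "Omega_space \<gamma> = {f. continuous_on UNIV f \<and>
     ((\<lambda>t. f t / (1 + \<bar>t\<bar> powr \<gamma>)) \<longlongrightarrow> 0) at_top \<and>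
     ((\<lambda>t. f t / (1 + \<bar>t\<bar> powr \<gamma>)) \<longlongrightarrow> 0) at_bot}"

definition Omega_norm :: "real \<Rightarrow> (real \<Rightarrow> real) \<Rightarrow> real" where
  "Omega_norm \<gamma> f = (SUP t. \<bar>f t\<bar> / (1 + \<bar>t\<bar> powr \<gamma>))"

text \<open>The value 0 off the carrier is only there because \<^locale>\<open>Metric_space\<close> demands a nonnegative
  distance on the whole type.\<close>

definition Omega_dist :: "real \<Rightarrow> (real \<Rightarrow> real) \<Rightarrow> (real \<Rightarrow> real) \<Rightarrow> real" where
  "Omega_dist \<gamma> f g =
     (if f \<in> Omega_space \<gamma> \<and> g \<in> Omega_space \<gamma> then Omega_norm \<gamma> (\<lambda>t. f t - g t) else 0)"

definition Omega_topology :: "real \<Rightarrow> (real \<Rightarrow> real) topology" where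
  "Omega_topology \<gamma> = Metric_space.mtopology (Omega_space \<gamma>) (Omega_dist \<gamma>)"

lemma Omega_space_diff:
  assumes "f \<in> Omega_space \<gamma>" "g \<in> Omega_space \<gamma>"
  shows "(\<lambda>t. f t - g t) \<in> Omega_space \<gamma>"
  using assms tendsto_diff[where a = 0 and b = "0::real"] unfolding Omega_space_def
  by (auto simp: diff_divide_distrib intro: continuous_on_diff)

lemma Omega_space_bdd_above:
  assumes f: "f \<in> Omega_space \<gamma>" and \<gamma>: "\<gamma> \<ge> 0"
  shows "bdd_above (range (\<lambda>t. \<bar>f t\<bar> / (1 + \<bar>t\<bar> powr \<gamma>)))"
proof -
  let ?h = "\<lambda>t. f t / (1 + \<bar>t\<bar> powr \<gamma>)"
  have w: "1 + \<bar>t\<bar> powr \<gamma> \<ge> 1" for t :: real by simp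
  have lim: "(?h \<longlongrightarrow> 0) at_top" "(?h \<longlongrightarrow> 0) at_bot" and cont: "continuous_on UNIV f"
    using f by (auto simp: Omega_space_def)
  obtain a where a: "\<And>t. t \<ge> a \<Longrightarrow> \<bar>?h t\<bar> < 1"
    using tendstoD[OF lim(1), of 1] by (auto simp: eventually_at_top_linorder)
  obtain b where b: "\<And>t. t \<le> b \<Longrightarrow> \<bar>?h t\<bar> < 1"
    using tendstoD[OF lim(2), of 1] by (auto simp: eventually_at_bot_linorder)
  have "bounded (f ` {b..a})"
    by (intro compact_imp_bounded compact_continuous_image continuous_on_subset[OF cont]) auto
  then obtain K where K: "\<And>t. t \<in> {b..a} \<Longrightarrow> \<bar>f t\<bar> \<le> K"
    unfolding bounded_iff by (metis imageI real_norm_def)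
  have "\<bar>f t\<bar> / (1 + \<bar>t\<bar> powr \<gamma>) \<le> max 1 K" for t
  proof -
    have eq: "\<bar>f t\<bar> / (1 + \<bar>t\<bar> powr \<gamma>) = \<bar>?h t\<bar>" by (simp add: abs_divide)
    consider "t \<ge> a" | "t \<le> b" | "t \<in> {b..a}" by fastforce
    then show ?thesis
    proof cases
      case 1 then show ?thesis unfolding eq using a[of t] by linarith
    next
      case 2 then show ?thesis unfolding eq using b[of t] by linarith
    next
      case 3
      have "\<bar>f t\<bar> / (1 + \<bar>t\<bar> powr \<gamma>) \<le> \<bar>f t\<bar> / 1"
        by (rule frac_le) (use w[of t] in auto)
      then show ?thesis using K[OF 3] by simp
    qed
  qed
  then show ?thesis by (intro bdd_aboveI2)
qed

lemma Metric_space_Omega: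
  assumes \<gamma>: "\<gamma> \<ge> 0"
  shows "Metric_space (Omega_space \<gamma>) (Omega_dist \<gamma>)"
proof -
  let ?w = "\<lambda>t::real. 1 + \<bar>t\<bar> powr \<gamma>"
  have w: "?w t > 0" for t using powr_ge_zero[of "\<bar>t\<bar>" \<gamma>] by linarith
  have upper: "\<bar>f t - g t\<bar> / ?w t \<le> Omega_dist \<gamma> f g"
    if "f \<in> Omega_space \<gamma>" "g \<in> Omega_space \<gamma>" for f g t
    using that Omega_space_bdd_above[OF Omega_space_diff[OF that] \<gamma>]
    by (auto simp: Omega_dist_def Omega_norm_def intro!: cSUP_upper)
  have least: "Omega_dist \<gamma> f g \<le> K"
    if "f \<in> Omega_space \<gamma>" "g \<in> Omega_space \<gamma>" "\<And>t. \<bar>f t - g t\<bar> / ?w t \<le> K" for f g K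
    using that by (auto simp: Omega_dist_def Omega_norm_def intro!: cSUP_least)
  show ?thesis
  proof
    show "0 \<le> Omega_dist \<gamma> f g" for f g
    proof (cases "f \<in> Omega_space \<gamma> \<and> g \<in> Omega_space \<gamma>")
      case True
      have "0 \<le> \<bar>f 0 - g 0\<bar> / ?w 0" by simp
      also have "\<dots> \<le> Omega_dist \<gamma> f g" using True upper by blast
      finally show ?thesis .
    qed (auto simp: Omega_dist_def)
    show "Omega_dist \<gamma> f g = Omega_dist \<gamma> g f" for f g
      by (auto simp: Omega_dist_def Omega_norm_def abs_minus_commute)
    fix f g assume fg: "f \<in> Omega_space \<gamma>" "g \<in> Omega_space \<gamma>"
    show "Omega_dist \<gamma> f g = 0 \<longleftrightarrow> f = g"
    proof
      assume 0: "Omega_dist \<gamma> f g = 0"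
      have "f t = g t" for t
      proof -
        have "\<bar>f t - g t\<bar> / ?w t \<le> 0" using upper[OF fg, of t] 0 by simp
        then have "\<bar>f t - g t\<bar> \<le> 0" using w[of t] by (simp add: divide_le_0_iff)
        then show ?thesis by simp
      qed
      then show "f = g" by (rule ext)
    qed (use fg in \<open>auto simp: Omega_dist_def Omega_norm_def\<close>)
    fix h assume h: "h \<in> Omega_space \<gamma>"
    show "Omega_dist \<gamma> f h \<le> Omega_dist \<gamma> f g + Omega_dist \<gamma> g h"
    proof (rule least[OF fg(1) h])
      fix t
      have "\<bar>f t - h t\<bar> / ?w t \<le> (\<bar>f t - g t\<bar> + \<bar>g t - h t\<bar>) / ?w t"
        using w[of t] by (intro divide_right_mono) auto
      also have "\<dots> = \<bar>f t - g t\<bar> / ?w t + \<bar>g t - h t\<bar> / ?w t"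
        by (rule add_divide_distrib)
      also have "\<dots> \<le> Omega_dist \<gamma> f g + Omega_dist \<gamma> g h"
        by (intro add_mono upper fg h)
      finally show "\<bar>f t - h t\<bar> / ?w t \<le> Omega_dist \<gamma> f g + Omega_dist \<gamma> g h" .
    qed
  qed
qed

lemma topspace_Omega [simp]: "\<gamma> \<ge> 0 \<Longrightarrow> topspace (Omega_topology \<gamma>) = Omega_space \<gamma>"
  unfolding Omega_topology_def
  by (rule Metric_space.topspace_mtopology[OF Metric_space_Omega])

section \<open>Weak convergence\<close>

text \<open>A random element of \<open>T\<close> only has to take values in \<open>T\<close> almost surely: the paths
  of a process with continuous paths satisfy the growth condition of \<^const>\<open>Omega_space\<close> only almost
  surely. Hence the restriction of the domains of integration in the definition of weak
  convergence.\<close>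

definition random_element :: "'a measure \<Rightarrow> 'e topology \<Rightarrow> ('a \<Rightarrow> 'e) \<Rightarrow> bool" where
  "random_element M T Y \<longleftrightarrow>
     (AE \<omega> in M. Y \<omega> \<in> topspace T) \<and> (\<forall>U. openin T U \<longrightarrow> {\<omega> \<in> space M. Y \<omega> \<in> U} \<in> sets M)"

definition converges_in_distribution ::
    "'i filter \<Rightarrow> 'e topology \<Rightarrow> 'a measure \<Rightarrow> ('i \<Rightarrow> 'a \<Rightarrow> 'e) \<Rightarrow> 'b measure \<Rightarrow> ('b \<Rightarrow> 'e) \<Rightarrow> bool" where
  "converges_in_distribution F T M Y N Z \<longleftrightarrow>
     (\<forall>\<^sub>F c in F. random_element M T (Y c)) \<and> random_element N T Z \<and>
     (\<forall>f. continuous_map T euclideanreal f \<and> bounded (f ` topspace T) \<longrightarrow>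
        ((\<lambda>c. LINT \<omega>:{\<omega> \<in> space M. Y c \<omega> \<in> topspace T}|M. f (Y c \<omega>)) \<longlongrightarrow>
          (LINT \<omega>:{\<omega> \<in> space N. Z \<omega> \<in> topspace T}|N. f (Z \<omega>))) F)"

section \<open>The scaling function\<close>

text \<open>The infimum is unspecified if the set is empty, so \<open>delta \<sigma> c\<close> is only meaningful for those \<open>c\<close>
  for which it is not; for \<open>\<sigma>\<close> continuous and regularly varying at zero with index in \<open>(0,1)\<close>
  these include all large \<open>c\<close>.\<close>

definition delta :: "(real \<Rightarrow> real) \<Rightarrow> real \<Rightarrow> real" where
  "delta \<sigma> c = Inf {x. x > 0 \<and> x / \<sigma> x = 1 / c}"

definition rescaled :: "(real \<Rightarrow> real) \<Rightarrow> (real \<Rightarrow> 'a \<Rightarrow> real) \<Rightarrow> real \<Rightarrow> 'a \<Rightarrow> real \<Rightarrow> real" where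
  "rescaled \<sigma> X c = (\<lambda>\<omega> t. X (delta \<sigma> c * t) \<omega> / \<sigma> (delta \<sigma> c))"

end

theory Submission
  imports Defs
begin

text \<open>
Two reductions make the problem finite-dimensional. On a metric space, a bounded continuous functional is an
increasing limit of bounded Lipschitz functionals, so weak convergence only has to be tested against
the latter (\<open>converges_in_distribution_lipschitzI\<close>). And a Lipschitz functional hardly notices if a path is
replaced by its piecewise linear interpolation on a fine dyadic grid, provided that the error is small
in probability uniformly in \<open>c\<close>. The interpolated path is a function of a Gaussian vector, and Gaussian laws
depend continuously on their covariances (\<open>gaussian_vector_expectation_tendsto\<close>). By stationarity of the increments the
covariances of the rescaled process are combinations of \<open>(\<sigma> (\<delta> t) / \<sigma> \<delta>)\<^sup>2\<close>, where \<open>\<delta> = delta \<sigma> c\<close> tends to 0;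
regular variation at zero gives the limit \<open>\<bar>t\<bar> powr (2 * l)\<close>, as for fractional Brownian motion.

The uniform error bound is chaining (\<open>interpolation_event\<close>). An increment of the rescaled process of length
\<open>2 ^ k / 2 ^ n\<close> has standard deviation at most \<open>C * (b ^ k * \<theta> ^ n)\<close> with \<open>\<theta> < 1\<close>, uniformly in \<open>c\<close>
(\<open>dyadic_growth\<close>). As the variables are Gaussian, moments of arbitrarily high order obey the corresponding bound, and
their Markov inequalities can be summed over the dyadic grids. The rate \<open>\<theta>\<close>, which comes from regular
variation at zero, yields a uniform modulus of continuity. The rate \<open>b\<close> limits the growth of the paths, which is
compatible with the weight of exponent \<open>\<gamma>\<close> if \<open>b < 2 powr \<gamma>\<close>.

Under regular variation at infinity with index \<open>\<alpha>\<close>, every \<open>b\<close> above \<open>2 powr (max l \<alpha>)\<close> is admissible, whence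
the convergence for all \<open>\<gamma> > max l \<alpha>\<close>. Without any assumption at infinity, \<open>\<sigma> (2 * x) \<le> 2 * \<sigma> x\<close> still
allows \<open>b = 2\<close>, hence convergence for \<open>\<gamma> = 2\<close>; since that weighted space embeds continuously into the space of
continuous functions, locally uniform convergence follows (\<open>converges_uniformly_on_compacts_of_Omega\<close>).
\<close>

section \<open>Lipschitz test functions suffice for weak convergence\<close>

text \<open>The largest minorant of \<open>f\<close> on \<open>S\<close> that is \<open>k\<close>-Lipschitz for \<open>d\<close>, provided that \<open>f\<close> is bounded
below.\<close>

definition inf_convolution :: "'a set \<Rightarrow> ('a \<Rightarrow> 'a \<Rightarrow> real) \<Rightarrow> real \<Rightarrow> ('a \<Rightarrow> real) \<Rightarrow> 'a \<Rightarrow> real" where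
  "inf_convolution S d k f x = (INF y\<in>S. f y + k * d x y)"

definition lipschitz_wrt :: "'a set \<Rightarrow> ('a \<Rightarrow> 'a \<Rightarrow> real) \<Rightarrow> real \<Rightarrow> ('a \<Rightarrow> real) \<Rightarrow> bool" where
  "lipschitz_wrt S d L f \<longleftrightarrow> (\<forall>x\<in>S. \<forall>y\<in>S. \<bar>f x - f y\<bar> \<le> L * d x y)"

context Metric_space
begin

context
  fixes f :: "'a \<Rightarrow> real" and a k :: real
  assumes lower: "\<And>y. y \<in> M \<Longrightarrow> a \<le> f y" and k: "0 \<le> k"
begin

lemma bdd_below_inf_convolution: "bdd_below ((\<lambda>y. f y + k * d x y) ` M)"
proof (rule bdd_belowI2)
  fix y assume "y \<in> M"
  then show "a \<le> f y + k * d x y" using lower[of y] mult_nonneg_nonneg[OF k nonneg[of x y]] by linarith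
qed

lemma inf_convolution_le:
  assumes "x \<in> M" shows "inf_convolution M d k f x \<le> f x"
proof -
  have "inf_convolution M d k f x \<le> f x + k * d x x"
    unfolding inf_convolution_def by (rule cINF_lower[OF bdd_below_inf_convolution assms])
  then show ?thesis using assms by simp
qed

lemma le_inf_convolution:
  assumes "x \<in> M" shows "a \<le> inf_convolution M d k f x"
  unfolding inf_convolution_def
proof (rule cINF_greatest)
  fix y assume "y \<in> M"
  then show "a \<le> f y + k * d x y" using lower[of y] mult_nonneg_nonneg[OF k nonneg[of x y]] by linarith
qed (use assms in auto)

lemma lipschitz_inf_convolution: "lipschitz_wrt M d k (inf_convolution M d k f)"
proof -
  have "inf_convolution M d k f x \<le> inf_convolution M d k f z + k * d x z" if "x \<in> M" "z \<in> M" for x z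
  proof -
    have "inf_convolution M d k f x - k * d x z \<le> inf_convolution M d k f z"
      unfolding inf_convolution_def[of M d k f z]
    proof (rule cINF_greatest)
      fix y assume y: "y \<in> M"
      have "inf_convolution M d k f x \<le> f y + k * d x y"
        unfolding inf_convolution_def by (rule cINF_lower[OF bdd_below_inf_convolution y])
      also have "\<dots> \<le> f y + k * (d x z + d z y)"
        using triangle[OF that y] k by (intro add_left_mono mult_left_mono)
      finally show "inf_convolution M d k f x - k * d x z \<le> f y + k * d z y"
        by (simp add: algebra_simps)
    qed (use that in auto)
    then show ?thesis by simp
  qed
  then show ?thesis
    unfolding lipschitz_wrt_def by (metis abs_le_iff add.commute commute diff_le_eq minus_diff_eq)
qed

text \<open>Outside the ball the penalty is at least \<open>k * r\<close>, so for large \<open>k\<close> only the values on the ball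
  count. Applied to an indicator function, the same estimate turns membership in an open set
  into positivity of a Lipschitz function.\<close>

lemma inf_convolution_ge_min:
  assumes x: "x \<in> M" and ball: "\<And>y. y \<in> mball x r \<Longrightarrow> v \<le> f y"
  shows "min v (a + k * r) \<le> inf_convolution M d k f x"
  unfolding inf_convolution_def
proof (rule cINF_greatest)
  fix y assume y: "y \<in> M"
  show "min v (a + k * r) \<le> f y + k * d x y"
  proof (cases "d x y < r")
    case True
    then have "v \<le> f y" using ball x y by (simp add: in_mball)
    then show ?thesis using mult_nonneg_nonneg[OF k nonneg[of x y]] by linarith
  next
    case False
    then have "k * r \<le> k * d x y" using k by (intro mult_left_mono) auto
    then show ?thesis using lower[OF y] by linarith
  qed
qed (use x in auto)

end

lemma inf_convolution_tendsto:
  assumes cont: "continuous_map mtopology euclideanreal f"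
    and lower: "\<And>y. y \<in> M \<Longrightarrow> a \<le> f y" and x: "x \<in> M"
  shows "(\<lambda>n. inf_convolution M d (real n) f x) \<longlonglongrightarrow> f x"
proof (rule order_tendstoI)
  fix v assume v: "v < f x"
  obtain w where w: "v < w" "w < f x" using dense v by blast
  have "openin mtopology {y \<in> topspace mtopology. f y \<in> {w<..}}"
    using cont by (rule openin_continuous_map_preimage) auto
  then have "openin mtopology {y \<in> M. w < f y}" by simp
  then obtain r where r: "r > 0" "mball x r \<subseteq> {y \<in> M. w < f y}"
    using x w unfolding openin_mtopology by blast
  obtain n0 :: nat where n0: "(w - a) / r < n0" using reals_Archimedean2 by blast
  have "v < inf_convolution M d (real n) f x" if "n \<ge> n0" for n
  proof -
    have "(w - a) / r < n" using n0 that by linarith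
    then have "w < a + real n * r" using r(1) by (simp add: field_simps)
    moreover have "min w (a + real n * r) \<le> inf_convolution M d (real n) f x"
      by (rule inf_convolution_ge_min[OF lower]) (use r x in force)+
    ultimately show ?thesis using w by simp
  qed
  then show "eventually (\<lambda>n. v < inf_convolution M d (real n) f x) sequentially"
    by (rule eventually_sequentiallyI)
next
  fix v assume "f x < v"
  moreover have "inf_convolution M d (real n) f x \<le> f x" for n
    by (rule inf_convolution_le[OF lower]) (use x in auto)
  ultimately show "eventually (\<lambda>n. inf_convolution M d (real n) f x < v) sequentially"
    by (intro always_eventually allI) (meson le_less_trans)
qed

lemma continuous_map_of_lipschitz:
  assumes lip: "lipschitz_wrt M d L f"
  shows "continuous_map mtopology euclideanreal f"
  unfolding continuous_map_def
proof (intro conjI allI impI)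
  show "f \<in> topspace mtopology \<rightarrow> topspace euclideanreal" by simp
  fix U :: "real set" assume "openin euclideanreal U"
  then have U: "open U" by simp
  show "openin mtopology {x \<in> topspace mtopology. f x \<in> U}"
    unfolding openin_mtopology
  proof (intro conjI allI impI)
    fix x assume "x \<in> {x \<in> topspace mtopology. f x \<in> U}"
    then have x: "x \<in> M" "f x \<in> U" by auto
    then obtain e where e: "e > 0" "\<And>v. \<bar>v - f x\<bar> < e \<Longrightarrow> v \<in> U"
      using U unfolding open_dist dist_real_def by blast
    have "f y \<in> U" if "y \<in> mball x (e / (\<bar>L\<bar> + 1))" for y
    proof -
      have y: "y \<in> M" "d x y < e / (\<bar>L\<bar> + 1)" using that by auto
      have "\<bar>f y - f x\<bar> \<le> L * d x y"
        using lip x y by (auto simp: lipschitz_wrt_def abs_minus_commute)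
      also have "\<dots> \<le> (\<bar>L\<bar> + 1) * d x y" by (intro mult_right_mono) auto
      also have "\<dots> < e" using y(2) by (simp add: field_simps)
      finally show ?thesis by (rule e(2))
    qed
    then show "\<exists>r>0. mball x r \<subseteq> {x \<in> topspace mtopology. f x \<in> U}"
      using e(1) by (intro exI[of _ "e / (\<bar>L\<bar> + 1)"]) auto
  qed auto
qed

end

lemma borel_measurable_random_element:
  assumes Y: "random_element M T Y" and f: "continuous_map T euclideanreal f"
  shows "(\<lambda>\<omega>. indicator {\<omega>\<in>space M. Y \<omega> \<in> topspace T} \<omega> *\<^sub>R f (Y \<omega>)) \<in> borel_measurable M"
proof -
  let ?A = "{\<omega>\<in>space M. Y \<omega> \<in> topspace T}"
  have A: "?A \<in> sets M" using Y by (simp add: random_element_def)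
  have "(\<lambda>\<omega>. f (Y \<omega>)) \<in> borel_measurable (restrict_space M ?A)"
  proof (rule borel_measurableI)
    fix V :: "real set" assume "open V"
    then have "openin T {x \<in> topspace T. f x \<in> V}"
      using f by (simp add: openin_continuous_map_preimage)
    then have "{\<omega>\<in>space M. Y \<omega> \<in> {x \<in> topspace T. f x \<in> V}} \<in> sets M"
      using Y unfolding random_element_def by blast
    moreover have "(\<lambda>\<omega>. f (Y \<omega>)) -` V \<inter> space (restrict_space M ?A) =
        {\<omega>\<in>space M. Y \<omega> \<in> {x \<in> topspace T. f x \<in> V}}"
      by (auto simp: space_restrict_space)
    ultimately show "(\<lambda>\<omega>. f (Y \<omega>)) -` V \<inter> space (restrict_space M ?A) \<in> sets (restrict_space M ?A)"
      using A by (auto simp: sets_restrict_space_iff)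
  qed
  then show ?thesis using A by (subst (asm) borel_measurable_restrict_space_iff) auto
qed

lemma integrable_random_element:
  assumes M: "prob_space M" and Y: "random_element M T Y" and f: "continuous_map T euclideanreal f"
    and K: "\<And>x. x \<in> topspace T \<Longrightarrow> \<bar>f x\<bar> \<le> K"
  shows "set_integrable M {\<omega>\<in>space M. Y \<omega> \<in> topspace T} (\<lambda>\<omega>. f (Y \<omega>))"
proof -
  interpret prob_space M by fact
  show ?thesis unfolding set_integrable_def
    by (rule integrable_const_bound[where B = "\<bar>K\<bar>"])
      (use K borel_measurable_random_element[OF Y f] in \<open>auto simp: indicator_def intro!: AE_I2 order_trans[OF K]\<close>)
qed

text \<open>The inf-convolutions increase to \<open>f\<close>, so by dominated convergence the expectation of one of them
  under the limit law already exceeds \<open>v\<close>. This function is Lipschitz, hence the inequality passes to the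
  converging family, and there it can only improve on replacing the minorant by \<open>f\<close>.\<close>

lemma (in Metric_space) liminf_expectation_ge:
  fixes Y :: "'i \<Rightarrow> 'b \<Rightarrow> 'a" and Z :: "'c \<Rightarrow> 'a" and f :: "'a \<Rightarrow> real"
  assumes P: "prob_space P" and Q: "prob_space Q"
    and Y: "\<forall>\<^sub>F c in F. random_element P mtopology (Y c)" and Z: "random_element Q mtopology Z"
    and lip: "\<And>L K g. lipschitz_wrt M d L g \<Longrightarrow> (\<And>x. x \<in> M \<Longrightarrow> \<bar>g x\<bar> \<le> K) \<Longrightarrow>
        ((\<lambda>c. LINT \<omega>:{\<omega>\<in>space P. Y c \<omega> \<in> M}|P. g (Y c \<omega>)) \<longlongrightarrow>
          (LINT \<omega>:{\<omega>\<in>space Q. Z \<omega> \<in> M}|Q. g (Z \<omega>))) F"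
    and f: "continuous_map mtopology euclideanreal f" and K: "\<And>x. x \<in> M \<Longrightarrow> \<bar>f x\<bar> \<le> K"
    and v: "v < (LINT \<omega>:{\<omega>\<in>space Q. Z \<omega> \<in> M}|Q. f (Z \<omega>))"
  shows "\<forall>\<^sub>F c in F. v < (LINT \<omega>:{\<omega>\<in>space P. Y c \<omega> \<in> M}|P. f (Y c \<omega>))"
proof -
  interpret Q: prob_space Q by fact
  interpret P: prob_space P by fact
  define g where "g n = inf_convolution M d (real n) f" for n
  have lower: "- K \<le> f x" if "x \<in> M" for x using K[OF that] by linarith
  have lipg: "lipschitz_wrt M d (real n) (g n)" for n
    unfolding g_def by (rule lipschitz_inf_convolution[OF lower]) auto
  have gle: "g n x \<le> f x" if "x \<in> M" for n x
    unfolding g_def by (rule inf_convolution_le[where a = "- K"]) (use lower that in auto)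
  have gge: "- K \<le> g n x" if "x \<in> M" for n x
    unfolding g_def by (rule le_inf_convolution) (use lower that in auto)
  have gK: "\<bar>g n x\<bar> \<le> K" if "x \<in> M" for n x
    using gle[OF that, of n] gge[OF that, of n] K[OF that] by linarith
  note gcont = continuous_map_of_lipschitz[OF lipg]
  have "(\<lambda>n. LINT \<omega>:{\<omega>\<in>space Q. Z \<omega> \<in> M}|Q. g n (Z \<omega>)) \<longlonglongrightarrow> (LINT \<omega>:{\<omega>\<in>space Q. Z \<omega> \<in> M}|Q. f (Z \<omega>))"
    unfolding set_lebesgue_integral_def
  proof (rule integral_dominated_convergence[where w = "\<lambda>_. \<bar>K\<bar>"])
    show "(\<lambda>\<omega>. indicat_real {\<omega> \<in> space Q. Z \<omega> \<in> M} \<omega> *\<^sub>R f (Z \<omega>)) \<in> borel_measurable Q"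
      using borel_measurable_random_element[OF Z f] by simp
    show "(\<lambda>\<omega>. indicat_real {\<omega> \<in> space Q. Z \<omega> \<in> M} \<omega> *\<^sub>R g n (Z \<omega>)) \<in> borel_measurable Q" for n
      using borel_measurable_random_element[OF Z gcont] by simp
    show "AE \<omega> in Q. (\<lambda>n. indicat_real {\<omega> \<in> space Q. Z \<omega> \<in> M} \<omega> *\<^sub>R g n (Z \<omega>)) \<longlonglongrightarrow>
        indicat_real {\<omega> \<in> space Q. Z \<omega> \<in> M} \<omega> *\<^sub>R f (Z \<omega>)"
      by (rule AE_I2) (auto simp: indicator_def g_def intro!: inf_convolution_tendsto[OF f lower])
    show "AE \<omega> in Q. norm (indicat_real {\<omega> \<in> space Q. Z \<omega> \<in> M} \<omega> *\<^sub>R g n (Z \<omega>)) \<le> \<bar>K\<bar>" for n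
      by (rule AE_I2) (auto simp: indicator_def intro!: order_trans[OF gK])
  qed auto
  from order_tendstoD(1)[OF this v] obtain n where
    n: "v < (LINT \<omega>:{\<omega>\<in>space Q. Z \<omega> \<in> M}|Q. g n (Z \<omega>))"
    by (auto simp: eventually_sequentially)
  have "\<forall>\<^sub>F c in F. v < (LINT \<omega>:{\<omega>\<in>space P. Y c \<omega> \<in> M}|P. g n (Y c \<omega>))"
    by (rule order_tendstoD(1)[OF lip n]) (use lipg gK in auto)
  with Y show ?thesis
  proof eventually_elim
    case (elim c)
    note int = integrable_random_element[OF P elim(1)]
    have "(LINT \<omega>:{\<omega>\<in>space P. Y c \<omega> \<in> M}|P. g n (Y c \<omega>)) \<le> (LINT \<omega>:{\<omega>\<in>space P. Y c \<omega> \<in> M}|P. f (Y c \<omega>))"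
      by (rule set_integral_mono)
        (use int[OF gcont gK] int[OF f K] gle in auto)
    with elim(2) show ?case by simp
  qed
qed

text \<open>The lower bound for \<open>f\<close> and the lower bound for \<open>- f\<close> together give the limit.\<close>

lemma (in Metric_space) converges_in_distribution_lipschitzI:
  fixes Y :: "'i \<Rightarrow> 'b \<Rightarrow> 'a" and Z :: "'c \<Rightarrow> 'a"
  assumes P: "prob_space P" and Q: "prob_space Q"
    and Y: "\<forall>\<^sub>F c in F. random_element P mtopology (Y c)" and Z: "random_element Q mtopology Z"
    and lip: "\<And>L K g. lipschitz_wrt M d L g \<Longrightarrow> (\<And>x. x \<in> M \<Longrightarrow> \<bar>g x\<bar> \<le> K) \<Longrightarrow>
        ((\<lambda>c. LINT \<omega>:{\<omega>\<in>space P. Y c \<omega> \<in> M}|P. g (Y c \<omega>)) \<longlongrightarrow>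
          (LINT \<omega>:{\<omega>\<in>space Q. Z \<omega> \<in> M}|Q. g (Z \<omega>))) F"
  shows "converges_in_distribution F mtopology P Y Q Z"
  unfolding converges_in_distribution_def
proof (intro conjI allI impI Y Z)
  fix f assume f: "continuous_map mtopology euclideanreal f \<and> bounded (f ` topspace mtopology)"
  then have cont: "continuous_map mtopology euclideanreal f" by simp
  obtain K where K: "\<bar>f x\<bar> \<le> K" if "x \<in> M" for x
    using f unfolding bounded_iff by auto
  have cont': "continuous_map mtopology euclideanreal (\<lambda>x. - f x)"
    using cont by (rule continuous_map_minus)
  have K': "\<bar>- f x\<bar> \<le> K" if "x \<in> M" for x using K[OF that] by simp
  have neg: "(LINT \<omega>:A|R. - h \<omega>) = - (LINT \<omega>:A|R. h \<omega>)" for A and R :: "'z measure" and h :: "'z \<Rightarrow> real"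
    by (simp add: set_lebesgue_integral_def)
  show "((\<lambda>c. LINT \<omega>:{\<omega> \<in> space P. Y c \<omega> \<in> topspace mtopology}|P. f (Y c \<omega>)) \<longlongrightarrow>
          (LINT \<omega>:{\<omega> \<in> space Q. Z \<omega> \<in> topspace mtopology}|Q. f (Z \<omega>))) F"
    unfolding topspace_mtopology
  proof (rule order_tendstoI)
    fix v assume v: "v < (LINT \<omega>:{\<omega> \<in> space Q. Z \<omega> \<in> M}|Q. f (Z \<omega>))"
    show "\<forall>\<^sub>F c in F. v < (LINT \<omega>:{\<omega> \<in> space P. Y c \<omega> \<in> M}|P. f (Y c \<omega>))"
      by (rule liminf_expectation_ge[OF P Q Y Z lip cont K v])
  next
    fix v assume "(LINT \<omega>:{\<omega> \<in> space Q. Z \<omega> \<in> M}|Q. f (Z \<omega>)) < v"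
    then have v': "- v < (LINT \<omega>:{\<omega> \<in> space Q. Z \<omega> \<in> M}|Q. - f (Z \<omega>))" by (simp add: neg)
    have "\<forall>\<^sub>F c in F. - v < (LINT \<omega>:{\<omega> \<in> space P. Y c \<omega> \<in> M}|P. - f (Y c \<omega>))"
      by (rule liminf_expectation_ge[OF P Q Y Z lip cont' K' v'])
    then show "\<forall>\<^sub>F c in F. (LINT \<omega>:{\<omega> \<in> space P. Y c \<omega> \<in> M}|P. f (Y c \<omega>)) < v" by (simp add: neg)
  qed
qed

section \<open>Piecewise linear interpolation in weighted spaces\<close>

text \<open>The tents \<open>hat (x - j)\<close> with integer \<open>j\<close> form a partition of unity, and at most two of them are nonzero
  at a given point.\<close>

definition hat :: "real \<Rightarrow> real" where
  "hat x = max 0 (1 - \<bar>x\<bar>)"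

definition grid :: "nat \<Rightarrow> int set" where
  "grid n = {- (int n * 2 ^ n) .. int n * 2 ^ n}"

text \<open>Piecewise linear through the nodes \<open>j / 2 ^ n\<close> of \<open>[-n, n]\<close>, then dropping to 0 outside. The compact
  support puts the interpolant into every weighted space, whatever the node values are.\<close>

definition interp :: "nat \<Rightarrow> (int \<Rightarrow> real) \<Rightarrow> real \<Rightarrow> real" where
  "interp n y t = (\<Sum>j\<in>grid n. hat (2 ^ n * t - of_int j) * y j)"

definition sample :: "nat \<Rightarrow> (real \<Rightarrow> real) \<Rightarrow> int \<Rightarrow> real" where
  "sample n f j = f (of_int j / 2 ^ n)"

abbreviation interpolate :: "nat \<Rightarrow> (real \<Rightarrow> real) \<Rightarrow> real \<Rightarrow> real" where
  "interpolate n f \<equiv> interp n (sample n f)"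

lemma hat_nonneg [simp]: "0 \<le> hat x" and hat_le_1: "hat x \<le> 1"
  by (auto simp: hat_def)

lemma finite_grid [simp]: "finite (grid n)"
  by (simp add: grid_def)

lemma sum_hat:
  assumes A: "finite A" and i: "\<lfloor>x\<rfloor> \<in> A" "\<lfloor>x\<rfloor> + 1 \<in> A"
  shows "(\<Sum>j\<in>A. hat (x - of_int j)) = 1"
proof -
  have "hat (x - of_int j) = 0" if "j \<in> A - {\<lfloor>x\<rfloor>, \<lfloor>x\<rfloor> + 1}" for j
  proof -
    have "j \<le> \<lfloor>x\<rfloor> - 1 \<or> j \<ge> \<lfloor>x\<rfloor> + 2" using that by auto
    then have "of_int j \<le> x - 1 \<or> of_int j \<ge> x + 1"
      by linarith
    then show ?thesis unfolding hat_def by auto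
  qed
  then have "(\<Sum>j\<in>A. hat (x - of_int j)) = (\<Sum>j\<in>{\<lfloor>x\<rfloor>, \<lfloor>x\<rfloor> + 1}. hat (x - of_int j))"
    using i A by (intro sum.mono_neutral_right) auto
  also have "\<dots> = hat (x - of_int \<lfloor>x\<rfloor>) + hat (x - of_int \<lfloor>x\<rfloor> - 1)"
    by (simp add: algebra_simps)
  also have "\<dots> = 1"
  proof -
    have "0 \<le> x - of_int \<lfloor>x\<rfloor>" "x - of_int \<lfloor>x\<rfloor> < 1" by linarith+
    then show ?thesis unfolding hat_def by linarith
  qed
  finally show ?thesis .
qed

lemma sum_hat_le:
  assumes A: "finite A"
  shows "(\<Sum>j\<in>A. hat (x - of_int j)) \<le> 1"
proof -
  have "(\<Sum>j\<in>A. hat (x - of_int j)) \<le> (\<Sum>j\<in>A \<union> {\<lfloor>x\<rfloor>, \<lfloor>x\<rfloor> + 1}. hat (x - of_int j))"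
    using A by (intro sum_mono2) auto
  also have "\<dots> = 1" using A by (intro sum_hat) auto
  finally show ?thesis .
qed

lemma abs_sum_hat_le:
  assumes A: "finite A" and e: "0 \<le> e" and z: "\<And>j. j \<in> A \<Longrightarrow> \<bar>x - of_int j\<bar> < 1 \<Longrightarrow> \<bar>z j\<bar> \<le> e"
  shows "\<bar>\<Sum>j\<in>A. hat (x - of_int j) * z j\<bar> \<le> e"
proof -
  have "\<bar>\<Sum>j\<in>A. hat (x - of_int j) * z j\<bar> \<le> (\<Sum>j\<in>A. hat (x - of_int j) * e)"
  proof (rule sum_abs[THEN order_trans], rule sum_mono)
    fix j assume j: "j \<in> A"
    show "\<bar>hat (x - of_int j) * z j\<bar> \<le> hat (x - of_int j) * e"
    proof (cases "\<bar>x - of_int j\<bar> < 1")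
      case True
      then show ?thesis using z[OF j True] by (auto simp: abs_mult intro!: mult_left_mono)
    qed (auto simp: hat_def)
  qed
  also have "\<dots> = (\<Sum>j\<in>A. hat (x - of_int j)) * e" by (simp add: sum_distrib_right)
  also have "\<dots> \<le> 1 * e" using sum_hat_le[OF A] e by (intro mult_right_mono)
  finally show ?thesis by simp
qed

lemma node_near:
  fixes t :: real
  assumes "\<bar>2 ^ n * t - of_int j\<bar> < 1"
  shows "\<bar>of_int j / 2 ^ n - t\<bar> < 1 / 2 ^ n" 
proof -
  have "of_int j / 2 ^ n - t = - ((2 ^ n * t - of_int j) / 2 ^ n)"
    by (simp add: field_simps)
  then have "\<bar>of_int j / 2 ^ n - t\<bar> = \<bar>2 ^ n * t - of_int j\<bar> / 2 ^ n"
    by (simp add: abs_divide)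
  also have "\<dots> < 1 / 2 ^ n" using assms by (intro divide_strict_right_mono) auto
  finally show ?thesis .
qed

lemma interp_sample_bound:
  assumes f: "\<And>s. \<bar>s - t\<bar> < 1 / 2 ^ n \<Longrightarrow> \<bar>f s\<bar> \<le> e"
  shows "\<bar>interpolate n f t\<bar> \<le> e"
  unfolding interp_def sample_def
proof (rule abs_sum_hat_le)
  show "0 \<le> e" using f[of t] by simp
  show "\<bar>f (of_int j / 2 ^ n)\<bar> \<le> e" if "\<bar>2 ^ n * t - of_int j\<bar> < 1" for j
    using node_near[OF that] by (rule f)
qed simp

lemma interp_sample_near:
  assumes t: "\<bar>t\<bar> < real n" and f: "\<And>s. \<bar>s - t\<bar> < 1 / 2 ^ n \<Longrightarrow> \<bar>f s - f t\<bar> \<le> e"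
  shows "\<bar>interpolate n f t - f t\<bar> \<le> e"
proof -
  have lt: "- (real n * 2 ^ n) < 2 ^ n * t" "2 ^ n * t < real n * 2 ^ n"
  proof -
    have "\<bar>2 ^ n * t\<bar> < real n * 2 ^ n"
      using mult_strict_right_mono[OF t, of "2 ^ n"] by (simp add: abs_mult mult.commute)
    then show "- (real n * 2 ^ n) < 2 ^ n * t" "2 ^ n * t < real n * 2 ^ n" by linarith+
  qed
  have "- (int n * 2 ^ n) \<le> \<lfloor>2 ^ n * t\<rfloor>" using lt(1) by (subst le_floor_iff) auto
  moreover have "\<lfloor>2 ^ n * t\<rfloor> < int n * 2 ^ n" using lt(2) by (subst floor_less_iff) auto
  ultimately have "(\<Sum>j\<in>grid n. hat (2 ^ n * t - of_int j)) = 1"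
    by (intro sum_hat) (auto simp: grid_def)
  then have "interpolate n f t - f t =
      (\<Sum>j\<in>grid n. hat (2 ^ n * t - of_int j) * sample n f j) - (\<Sum>j\<in>grid n. hat (2 ^ n * t - of_int j)) * f t"
    by (simp add: interp_def)
  also have "\<dots> = (\<Sum>j\<in>grid n. hat (2 ^ n * t - of_int j) * (sample n f j - f t))"
    by (simp add: sum_distrib_right right_diff_distrib sum_subtractf)
  also have "\<bar>\<dots>\<bar> \<le> e"
  proof (rule abs_sum_hat_le)
    show "0 \<le> e" using f[of t] by simp
    show "\<bar>sample n f j - f t\<bar> \<le> e" if "\<bar>2 ^ n * t - of_int j\<bar> < 1" for j
      unfolding sample_def using node_near[OF that] by (rule f)
  qed simp
  finally show ?thesis .
qed

lemma continuous_on_interp: "continuous_on UNIV (interp n y)"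
  unfolding interp_def hat_def by (intro continuous_intros)

lemma interp_eq_0:
  assumes "\<bar>t\<bar> \<ge> real n + 1"
  shows "interp n y t = 0"
  unfolding interp_def
proof (intro sum.neutral ballI)
  fix j assume "j \<in> grid n"
  then have "- (int n * 2 ^ n) \<le> j" "j \<le> int n * 2 ^ n" by (auto simp: grid_def)
  then have "\<bar>j\<bar> \<le> int n * 2 ^ n" by linarith
  then have "real_of_int \<bar>j\<bar> \<le> real_of_int (int n * 2 ^ n)" by (simp only: of_int_le_iff)
  then have "\<bar>real_of_int j\<bar> \<le> real n * 2 ^ n" by simp
  moreover have "\<bar>2 ^ n * t\<bar> \<ge> real n * 2 ^ n + 1"
  proof -
    have "real n * 2 ^ n + 1 \<le> (real n + 1) * 2 ^ n" by (simp add: distrib_right)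
    also have "\<dots> \<le> \<bar>t\<bar> * 2 ^ n" using assms by (intro mult_right_mono) auto
    finally show ?thesis by (simp add: abs_mult mult.commute)
  qed
  ultimately have "\<bar>2 ^ n * t - of_int j\<bar> \<ge> 1" by linarith
  then show "hat (2 ^ n * t - of_int j) * y j = 0" by (simp add: hat_def)
qed

lemma Omega_spaceI:
  assumes cont: "continuous_on UNIV f"
    and tail: "\<And>e. e > 0 \<Longrightarrow> \<exists>T. \<forall>t. T \<le> \<bar>t\<bar> \<longrightarrow> \<bar>f t\<bar> \<le> e * (1 + \<bar>t\<bar> powr \<gamma>)"
  shows "f \<in> Omega_space \<gamma>"
proof -
  have w: "0 < 1 + \<bar>t\<bar> powr \<gamma>" for t :: real using powr_ge_zero[of "\<bar>t\<bar>" \<gamma>] by linarith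
  have small: "\<exists>T. \<forall>t. T \<le> \<bar>t\<bar> \<longrightarrow> \<bar>f t / (1 + \<bar>t\<bar> powr \<gamma>)\<bar> < e" if "e > 0" for e
  proof -
    obtain T where T: "\<And>t. T \<le> \<bar>t\<bar> \<Longrightarrow> \<bar>f t\<bar> \<le> e / 2 * (1 + \<bar>t\<bar> powr \<gamma>)"
      using tail[OF half_gt_zero[OF \<open>e > 0\<close>]] by blast
    have "\<bar>f t / (1 + \<bar>t\<bar> powr \<gamma>)\<bar> < e" if "T \<le> \<bar>t\<bar>" for t
    proof -
      have "\<bar>f t / (1 + \<bar>t\<bar> powr \<gamma>)\<bar> = \<bar>f t\<bar> / (1 + \<bar>t\<bar> powr \<gamma>)"
        using w[of t] by (simp add: abs_divide)
      also have "\<dots> \<le> e / 2" using T[OF that] w[of t] by (simp add: divide_le_eq)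
      finally show ?thesis using \<open>e > 0\<close> by linarith
    qed
    then show ?thesis by blast
  qed
  have "((\<lambda>t. f t / (1 + \<bar>t\<bar> powr \<gamma>)) \<longlongrightarrow> 0) at_top"
    unfolding tendsto_iff eventually_at_top_linorder dist_real_def diff_zero
    using small by (meson abs_ge_self order_trans)
  moreover have "((\<lambda>t. f t / (1 + \<bar>t\<bar> powr \<gamma>)) \<longlongrightarrow> 0) at_bot"
    unfolding tendsto_iff eventually_at_bot_linorder dist_real_def diff_zero
  proof (intro allI impI)
    fix e :: real assume "0 < e"
    then obtain T where "\<And>t. T \<le> \<bar>t\<bar> \<Longrightarrow> \<bar>f t / (1 + \<bar>t\<bar> powr \<gamma>)\<bar> < e" using small by blast
    then show "\<exists>N. \<forall>t\<le>N. \<bar>f t / (1 + \<bar>t\<bar> powr \<gamma>)\<bar> < e" by (intro exI[of _ "- T"]) force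
  qed
  ultimately show ?thesis using cont by (simp add: Omega_space_def)
qed

lemma Omega_space_tail:
  assumes f: "f \<in> Omega_space \<gamma>" and e: "e > 0"
  obtains T where "T > 0" "\<And>t. T \<le> \<bar>t\<bar> \<Longrightarrow> \<bar>f t\<bar> \<le> e * (1 + \<bar>t\<bar> powr \<gamma>)"
proof -
  have lim: "((\<lambda>t. f t / (1 + \<bar>t\<bar> powr \<gamma>)) \<longlongrightarrow> 0) at_top" "((\<lambda>t. f t / (1 + \<bar>t\<bar> powr \<gamma>)) \<longlongrightarrow> 0) at_bot"
    using f by (auto simp: Omega_space_def)
  obtain a where a: "\<And>t. t \<ge> a \<Longrightarrow> \<bar>f t / (1 + \<bar>t\<bar> powr \<gamma>)\<bar> < e"
    using tendstoD[OF lim(1) e] by (auto simp: eventually_at_top_linorder)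
  obtain b where b: "\<And>t. t \<le> b \<Longrightarrow> \<bar>f t / (1 + \<bar>t\<bar> powr \<gamma>)\<bar> < e"
    using tendstoD[OF lim(2) e] by (auto simp: eventually_at_bot_linorder)
  define T where "T = max 1 (max \<bar>a\<bar> \<bar>b\<bar>)"
  have T: "T > 0" "a \<le> T" "- T \<le> b" unfolding T_def by linarith+
  have "\<bar>f t\<bar> \<le> e * (1 + \<bar>t\<bar> powr \<gamma>)" if "T \<le> \<bar>t\<bar>" for t
  proof -
    have w: "0 < 1 + \<bar>t\<bar> powr \<gamma>" using powr_ge_zero[of "\<bar>t\<bar>" \<gamma>] by linarith
    have "t \<ge> a \<or> t \<le> b" using that T by linarith
    then have "\<bar>f t / (1 + \<bar>t\<bar> powr \<gamma>)\<bar> < e" using a b by blast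
    then have "\<bar>f t\<bar> / (1 + \<bar>t\<bar> powr \<gamma>) < e" using w by (simp add: abs_divide)
    then show ?thesis using w by (simp add: divide_less_eq)
  qed
  then show ?thesis using T(1) that by blast
qed

lemma interp_in_Omega: "interp n y \<in> Omega_space \<gamma>"
proof (rule Omega_spaceI[OF continuous_on_interp])
  fix e :: real assume "e > 0"
  then show "\<exists>T. \<forall>t. T \<le> \<bar>t\<bar> \<longrightarrow> \<bar>interp n y t\<bar> \<le> e * (1 + \<bar>t\<bar> powr \<gamma>)"
    by (intro exI[of _ "real n + 1"]) (auto simp: interp_eq_0)
qed

lemma Omega_dist_le:
  assumes "f \<in> Omega_space \<gamma>" "g \<in> Omega_space \<gamma>"
    and le: "\<And>t. \<bar>f t - g t\<bar> \<le> e * (1 + \<bar>t\<bar> powr \<gamma>)"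
  shows "Omega_dist \<gamma> f g \<le> e"
proof -
  have "\<bar>f t - g t\<bar> / (1 + \<bar>t\<bar> powr \<gamma>) \<le> e" for t
  proof -
    have "0 < 1 + \<bar>t\<bar> powr \<gamma>" using powr_ge_zero[of "\<bar>t\<bar>" \<gamma>] by linarith
    then show ?thesis using le[of t] by (simp add: divide_le_eq)
  qed
  then show ?thesis using assms(1,2)
    by (auto simp: Omega_dist_def Omega_norm_def intro!: cSUP_least)
qed

lemma Omega_dist_ge:
  assumes fg: "f \<in> Omega_space \<gamma>" "g \<in> Omega_space \<gamma>" and "0 \<le> \<gamma>"
  shows "\<bar>f t - g t\<bar> \<le> Omega_dist \<gamma> f g * (1 + \<bar>t\<bar> powr \<gamma>)"
proof -
  have "0 < 1 + \<bar>t\<bar> powr \<gamma>" using powr_ge_zero[of "\<bar>t\<bar>" \<gamma>] by linarith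
  moreover have "\<bar>f t - g t\<bar> / (1 + \<bar>t\<bar> powr \<gamma>) \<le> Omega_dist \<gamma> f g"
    using fg Omega_space_bdd_above[OF Omega_space_diff[OF fg] \<open>0 \<le> \<gamma>\<close>]
    by (auto simp: Omega_dist_def Omega_norm_def intro!: cSUP_upper)
  ultimately show ?thesis by (simp add: divide_le_eq)
qed

text \<open>A Lipschitz functional of the interpolant is therefore a Lipschitz function of finitely many path
  values, to which the convergence of Gaussian vectors applies.\<close>

lemma Omega_dist_interp: "Omega_dist \<gamma> (interp n y) (interp n z) \<le> (\<Sum>j\<in>grid n. \<bar>y j - z j\<bar>)"
proof (rule Omega_dist_le[OF interp_in_Omega interp_in_Omega])
  fix t
  have "interp n y t - interp n z t = (\<Sum>j\<in>grid n. hat (2 ^ n * t - of_int j) * (y j - z j))"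
    by (simp add: interp_def sum_subtractf right_diff_distrib)
  also have "\<bar>\<dots>\<bar> \<le> (\<Sum>j\<in>grid n. 1 * \<bar>y j - z j\<bar>)"
    by (rule sum_abs[THEN order_trans], rule sum_mono)
      (simp add: abs_mult mult_left_le_one_le hat_le_1)
  also have "\<dots> \<le> (\<Sum>j\<in>grid n. \<bar>y j - z j\<bar>) * (1 + \<bar>t\<bar> powr \<gamma>)"
    by (simp add: distrib_left sum_nonneg)
  finally show "\<bar>interp n y t - interp n z t\<bar> \<le> (\<Sum>j\<in>grid n. \<bar>y j - z j\<bar>) * (1 + \<bar>t\<bar> powr \<gamma>)" .
qed

text \<open>The error comes from the oscillation of \<open>f\<close> inside a window and from the size of \<open>f\<close> outside. At a
  point \<open>t\<close> outside, the nodes that contribute lie within distance \<open>1 \<le> \<bar>t\<bar>\<close> of \<open>t\<close>; there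
  the weight is at most \<open>2 powr \<gamma>\<close> times the weight at \<open>t\<close>, which explains the constant.\<close>

lemma Omega_dist_interp_sample_le:
  assumes f: "f \<in> Omega_space \<gamma>" and \<gamma>: "0 \<le> \<gamma>" and T: "0 \<le> T" and n: "T + 1 < real n"
    and tail: "\<And>t. T \<le> \<bar>t\<bar> \<Longrightarrow> \<bar>f t\<bar> \<le> e * (1 + \<bar>t\<bar> powr \<gamma>)"
    and osc: "\<And>s t. \<bar>s\<bar> \<le> T + 2 \<Longrightarrow> \<bar>t\<bar> \<le> T + 2 \<Longrightarrow> \<bar>s - t\<bar> \<le> 1 / 2 ^ n \<Longrightarrow> \<bar>f s - f t\<bar> \<le> e"
  shows "Omega_dist \<gamma> f (interpolate n f) \<le> e * (1 + 2 powr \<gamma>)"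
proof (rule Omega_dist_le[OF f interp_in_Omega])
  fix t :: real
  have e: "0 \<le> e" using osc[of 0 0] T by simp
  have mesh: "1 / 2 ^ n \<le> (1 :: real)" by simp
  have 1: "1 \<le> 2 powr \<gamma>" using \<gamma> by (simp add: ge_one_powr_ge_zero)
  have w: "1 \<le> 1 + \<bar>t\<bar> powr \<gamma>" by simp
  show "\<bar>f t - interpolate n f t\<bar> \<le> e * (1 + 2 powr \<gamma>) * (1 + \<bar>t\<bar> powr \<gamma>)"
  proof (cases "\<bar>t\<bar> < T + 1")
    case True
    have "\<bar>interpolate n f t - f t\<bar> \<le> e"
    proof (rule interp_sample_near)
      show "\<bar>t\<bar> < real n" using True n by simp
      show "\<bar>f s - f t\<bar> \<le> e" if "\<bar>s - t\<bar> < 1 / 2 ^ n" for s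
        using that True mesh by (intro osc) linarith+
    qed
    also have "e * 1 \<le> e * ((1 + 2 powr \<gamma>) * (1 + \<bar>t\<bar> powr \<gamma>))"
      using e 1 w by (intro mult_left_mono mult_ge1_I) auto
    then have "e \<le> e * ((1 + 2 powr \<gamma>) * (1 + \<bar>t\<bar> powr \<gamma>))" by simp
    finally show ?thesis by (simp add: abs_minus_commute mult.assoc)
  next
    case False
    have "\<bar>interpolate n f t\<bar> \<le> e * (2 powr \<gamma> * (1 + \<bar>t\<bar> powr \<gamma>))"
    proof (rule interp_sample_bound)
      fix s assume s: "\<bar>s - t\<bar> < 1 / 2 ^ n"
      have "\<bar>f s\<bar> \<le> e * (1 + \<bar>s\<bar> powr \<gamma>)"
        using s False mesh by (intro tail) linarith
      also have "\<bar>s\<bar> powr \<gamma> \<le> (2 * \<bar>t\<bar>) powr \<gamma>"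
        using s False mesh T \<gamma> by (intro powr_mono2) linarith+
      also have "1 + (2 * \<bar>t\<bar>) powr \<gamma> \<le> 2 powr \<gamma> * (1 + \<bar>t\<bar> powr \<gamma>)"
        using 1 by (simp add: powr_mult distrib_left)
      finally show "\<bar>f s\<bar> \<le> e * (2 powr \<gamma> * (1 + \<bar>t\<bar> powr \<gamma>))"
        using e by (simp add: mult_left_mono)
    qed
    moreover have "\<bar>f t\<bar> \<le> e * (1 + \<bar>t\<bar> powr \<gamma>)" using False by (intro tail) simp
    ultimately show ?thesis by (simp add: algebra_simps)
  qed
qed

lemma Omega_dist_interp_sample_tendsto:
  assumes f: "f \<in> Omega_space \<gamma>" and \<gamma>: "0 \<le> \<gamma>"
  shows "(\<lambda>n. Omega_dist \<gamma> f (interpolate n f)) \<longlonglongrightarrow> 0"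
proof (rule LIMSEQ_I)
  interpret Metric_space "Omega_space \<gamma>" "Omega_dist \<gamma>" using \<gamma> by (rule Metric_space_Omega)
  fix r :: real assume r: "r > 0"
  define C where "C = 1 + 2 powr \<gamma>"
  have C: "0 < C" by (simp add: C_def add_pos_pos)
  define e where "e = r / 2 / C"
  have e: "e > 0" "e * C = r / 2" using r C by (simp_all add: e_def)
  obtain T where T: "T > 0" "\<And>t. T \<le> \<bar>t\<bar> \<Longrightarrow> \<bar>f t\<bar> \<le> e * (1 + \<bar>t\<bar> powr \<gamma>)"
    using Omega_space_tail[OF f e(1)] by blast
  have "continuous_on UNIV f" using f by (simp add: Omega_space_def)
  then have "uniformly_continuous_on {- (T + 2)..T + 2} f"
    by (intro compact_uniformly_continuous) (auto intro: continuous_on_subset)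
  then obtain h where h: "h > 0"
    "\<And>s t. s \<in> {- (T + 2)..T + 2} \<Longrightarrow> t \<in> {- (T + 2)..T + 2} \<Longrightarrow> dist t s < h \<Longrightarrow> dist (f t) (f s) < e"
    unfolding uniformly_continuous_on_def using e(1) by metis
  obtain n1 where n1: "(1 / 2) ^ n1 < h" using real_arch_pow_inv[OF h(1), of "1/2"] by auto
  obtain n2 :: nat where n2: "T + 1 < n2" using reals_Archimedean2 by blast
  show "\<exists>no. \<forall>n\<ge>no. norm (Omega_dist \<gamma> f (interpolate n f) - 0) < r"
  proof (intro exI[of _ "max n1 n2"] allI impI)
    fix n assume n: "n \<ge> max n1 n2"
    have "(1 / 2 :: real) ^ n \<le> (1 / 2) ^ n1" using n by (intro power_decreasing) auto
    then have mesh: "1 / 2 ^ n < h" using n1 by (simp add: power_one_over)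
    have "Omega_dist \<gamma> f (interpolate n f) \<le> e * (1 + 2 powr \<gamma>)"
    proof (rule Omega_dist_interp_sample_le[OF f \<gamma> _ _ T(2)])
      fix s t :: real
      assume st: "\<bar>s\<bar> \<le> T + 2" "\<bar>t\<bar> \<le> T + 2" "\<bar>s - t\<bar> \<le> 1 / 2 ^ n"
      then have "dist (f s) (f t) < e"
        using mesh by (intro h(2)) (auto simp: dist_real_def abs_le_iff)
      then show "\<bar>f s - f t\<bar> \<le> e" by (simp add: dist_real_def)
    qed (use T n n2 in auto)
    also have "\<dots> = r / 2" using e(2) by (simp add: C_def)
    also have "\<dots> < r" using r by simp
    finally show "norm (Omega_dist \<gamma> f (interpolate n f) - 0) < r" by simp
  qed
qed

section \<open>Centered Gaussian variables\<close>

text \<open>The moment of order \<open>2 * k\<close> of the standard normal distribution.\<close>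

definition gaussian_moment :: "nat \<Rightarrow> real" where
  "gaussian_moment k = fact (2 * k) / (2 ^ k * fact k)"

lemma gaussian_moment_nonneg: "0 \<le> gaussian_moment k"
  by (simp add: gaussian_moment_def)

lemma (in prob_space) centered_gaussian_cases:
  assumes G: "gaussian_rv M G" and 0: "expectation G = 0"
  obtains "AE \<omega> in M. G \<omega> = 0"
    | s where "s > 0" "distributed M lborel G (\<lambda>x. ennreal (normal_density 0 s x))"
proof -
  consider \<mu> where "AE \<omega> in M. G \<omega> = \<mu>"
    | \<mu> s where "s > 0" "distributed M lborel G (\<lambda>x. ennreal (normal_density \<mu> s x))"
    using G unfolding gaussian_rv_def by blast
  then show ?thesis
  proof cases
    case (1 \<mu>)
    have "expectation G = expectation (\<lambda>_. \<mu>)"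
      using 1 G by (intro integral_cong_AE) (auto simp: gaussian_rv_def)
    then have "\<mu> = 0" using 0 by (simp add: prob_space)
    then show ?thesis using 1 that(1) by simp
  next
    case (2 \<mu> s)
    then have "expectation G = \<mu>" by (rule normal_distributed_expectation)
    then show ?thesis using 0 2 that(2) by simp
  qed
qed

text \<open>A bound on a variance is a bound on all even moments. Moments of high order are what chaining needs
  when the standard deviation of an increment decays slowly with its length.\<close>

lemma (in prob_space) centered_gaussian_even_moment:
  assumes G: "gaussian_rv M G" and 0: "expectation G = 0"
  shows "integrable M (\<lambda>\<omega>. G \<omega> ^ (2 * k))" (is ?int)
    and "expectation (\<lambda>\<omega>. G \<omega> ^ (2 * k)) = gaussian_moment k * expectation (\<lambda>\<omega>. (G \<omega>)\<^sup>2) ^ k" (is ?eq)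
proof -
  have [measurable]: "G \<in> borel_measurable M" using G by (simp add: gaussian_rv_def)
  from centered_gaussian_cases[OF G 0] have "?int \<and> ?eq"
  proof cases
    case 1
    have ae: "AE \<omega> in M. G \<omega> ^ j = 0 ^ j" for j using 1 by eventually_elim simp
    have int: "integrable M (\<lambda>\<omega>. G \<omega> ^ j)" for j
      using integrable_cong_AE[OF _ _ ae[of j]] by simp
    have eq: "expectation (\<lambda>\<omega>. G \<omega> ^ j) = 0 ^ j" for j
      using integral_cong_AE[OF _ _ ae[of j]] by (simp add: prob_space)
    have "expectation (\<lambda>\<omega>. G \<omega> ^ (2 * k)) = gaussian_moment k * expectation (\<lambda>\<omega>. (G \<omega>)\<^sup>2) ^ k"
      unfolding eq[of "2 * k"] eq[of 2] by (cases k) (simp_all add: gaussian_moment_def)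
    with int show ?thesis by blast
  next
    case (2 s)
    have int: "integrable M (\<lambda>\<omega>. G \<omega> ^ (2 * j))" for j
      using distributed_integrable[OF 2(2), of "\<lambda>x. x ^ (2 * j)"] integrable_normal_moment[OF 2(1), of 0 "2 * j"] 2(1)
      by (simp add: normal_density_nonneg)
    have eq: "expectation (\<lambda>\<omega>. G \<omega> ^ (2 * j)) = gaussian_moment j * (s\<^sup>2) ^ j" for j
      using distributed_integral[OF 2(2), of "\<lambda>x. x ^ (2 * j)"] integral_normal_moment_even[OF 2(1), of 0 j] 2(1)
      by (simp add: normal_density_nonneg gaussian_moment_def power_divide field_simps)
    have "expectation (\<lambda>\<omega>. (G \<omega>)\<^sup>2) = s\<^sup>2" using eq[of 1] by (simp add: gaussian_moment_def)
    then show ?thesis using int eq by simp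
  qed
  then show ?int ?eq by auto
qed

lemma (in prob_space) centered_gaussian_square_integrable:
  assumes G: "gaussian_rv M G" and 0: "expectation G = 0"
  shows "integrable M (\<lambda>\<omega>. (G \<omega>)\<^sup>2)"
  using centered_gaussian_even_moment(1)[OF G 0, of 1] by simp

text \<open>The real part of the characteristic function, shifted by a phase. These expectations depend on
  the variance only and are continuous in it.\<close>

lemma expectation_cos_std_normal:
  "(LINT x|lborel. std_normal_density x * cos (s * x + b)) = cos b * exp (- s\<^sup>2 / 2)"
proof -
  interpret real_distribution std_normal_distribution by (rule real_dist_normal_dist)
  have "cos b * exp (- s\<^sup>2 / 2) = Re (iexp b * char std_normal_distribution s)"
    by (simp add: char_std_normal_distribution Re_exp)
  also have "\<dots> = Re (CLINT x|std_normal_distribution. iexp b * iexp (s * x))"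
    unfolding char_def by (subst integral_mult_right_zero) simp
  also have "\<dots> = (LINT x|std_normal_distribution. Re (iexp b * iexp (s * x)))"
    by (intro integral_Re[symmetric] integrable_const_bound[where B = 1] AE_I2)
      (auto simp: norm_mult)
  also have "\<dots> = (LINT x|std_normal_distribution. cos (s * x + b))"
    by (intro Bochner_Integration.integral_cong) (auto simp: cos_add cos_of_real sin_of_real Re_exp Im_exp)
  also have "\<dots> = (LINT x|lborel. std_normal_density x * cos (s * x + b))"
    by (subst integral_density) auto
  finally show ?thesis by simp
qed

lemma (in prob_space) centered_gaussian_expectation_cos:
  assumes G: "gaussian_rv M G" and 0: "expectation G = 0"
  shows "expectation (\<lambda>\<omega>. cos (G \<omega> + b)) = cos b * exp (- expectation (\<lambda>\<omega>. (G \<omega>)\<^sup>2) / 2)"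
proof -
  have [measurable]: "G \<in> borel_measurable M" using G by (simp add: gaussian_rv_def)
  from centered_gaussian_cases[OF G 0] show ?thesis
  proof cases
    case 1
    have "expectation (\<lambda>\<omega>. cos (G \<omega> + b)) = expectation (\<lambda>\<omega>. cos b)"
      using 1 by (intro integral_cong_AE) auto
    moreover have "expectation (\<lambda>\<omega>. (G \<omega>)\<^sup>2) = expectation (\<lambda>\<omega>. 0)"
      using 1 by (intro integral_cong_AE) auto
    ultimately show ?thesis by (simp add: prob_space)
  next
    case (2 s)
    have std: "distributed M lborel (\<lambda>\<omega>. G \<omega> / s) std_normal_density"
      using normal_standard_normal_convert[OF 2(1), of G 0] 2(2) by simp
    have "expectation (\<lambda>\<omega>. cos (s * (G \<omega> / s) + b)) = cos b * exp (- s\<^sup>2 / 2)"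
      using distributed_integral[OF std, of "\<lambda>x. cos (s * x + b)"]
      by (simp add: expectation_cos_std_normal)
    moreover have "expectation (\<lambda>\<omega>. (G \<omega>)\<^sup>2) = s\<^sup>2"
      using normal_distributed_variance[OF 2] 0 by simp
    ultimately show ?thesis using 2(1) by simp
  qed
qed

text \<open>A Gaussian process is specified through sums over sets of distinct times. In linear combinations of
  rescaled values the times may coincide; then their coefficients are added up.\<close>

lemma sum_reindex_times:
  fixes \<tau> :: "'i \<Rightarrow> real" and a :: "'i \<Rightarrow> real"
  assumes "finite J"
  shows "(\<Sum>j\<in>J. a j * x (\<tau> j)) = (\<Sum>t\<in>\<tau> ` J. (\<Sum>j\<in>{j\<in>J. \<tau> j = t}. a j) * x t)"
proof -
  have "(\<Sum>j\<in>J. a j * x (\<tau> j)) = (\<Sum>t\<in>\<tau> ` J. \<Sum>j\<in>{j\<in>J. \<tau> j = t}. a j * x (\<tau> j))"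
    by (rule sum.image_gen[OF assms])
  also have "\<dots> = (\<Sum>t\<in>\<tau> ` J. (\<Sum>j\<in>{j\<in>J. \<tau> j = t}. a j) * x t)"
    by (intro sum.cong refl) (auto simp: sum_distrib_right)
  finally show ?thesis .
qed

lemma gaussian_process_sum:
  assumes X: "gaussian_process M X" and J: "finite J"
  shows "gaussian_rv M (\<lambda>\<omega>. \<Sum>j\<in>J. a j * X (\<tau> j) \<omega>)"
proof -
  have "gaussian_rv M (\<lambda>\<omega>. \<Sum>t\<in>\<tau> ` J. (\<Sum>j\<in>{j\<in>J. \<tau> j = t}. a j) * X t \<omega>)"
    using X J unfolding gaussian_process_def by (simp del: sum.reindex_nontrivial)
  then show ?thesis
    by (simp add: sum_reindex_times[OF J, of a "\<lambda>t. X t _" \<tau>])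
qed

section \<open>Dyadic chaining\<close>

lemma dyadic_floor_near: "\<bar>of_int \<lfloor>2 ^ n * t\<rfloor> / 2 ^ n - t\<bar> \<le> 1 / 2 ^ n" for t :: real
proof -
  have "of_int \<lfloor>2 ^ n * t\<rfloor> / 2 ^ n - t = - ((2 ^ n * t - of_int \<lfloor>2 ^ n * t\<rfloor>) / 2 ^ n)"
    by (simp add: field_simps)
  then have "\<bar>of_int \<lfloor>2 ^ n * t\<rfloor> / 2 ^ n - t\<bar> = \<bar>2 ^ n * t - of_int \<lfloor>2 ^ n * t\<rfloor>\<bar> / 2 ^ n"
    by (simp add: abs_divide)
  also have "\<dots> \<le> 1 / 2 ^ n" by (intro divide_right_mono) (linarith | simp)+
  finally show ?thesis .
qed

lemma dyadic_floor_tendsto: "(\<lambda>n. of_int \<lfloor>2 ^ n * t\<rfloor> / 2 ^ n) \<longlonglongrightarrow> (t :: real)"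
proof (rule LIM_zero_cancel, rule tendsto_rabs_zero_cancel,
    rule tendsto_sandwich[where f = "\<lambda>_. 0" and h = "\<lambda>n. 1 / 2 ^ n"])
  show "(\<lambda>n. 1 / 2 ^ n) \<longlonglongrightarrow> (0 :: real)"
    using LIMSEQ_power_zero[of "1 / 2 :: real"] by (simp add: power_one_over)
  show "\<forall>\<^sub>F n in sequentially. \<bar>of_int \<lfloor>2 ^ n * t\<rfloor> / 2 ^ n - t\<bar> \<le> 1 / 2 ^ n"
    by (intro always_eventually allI dyadic_floor_near)
qed auto

lemma dyadic_floor_Suc:
  fixes t :: real
  shows "\<lfloor>2 ^ Suc n * t\<rfloor> \<in> {2 * \<lfloor>2 ^ n * t\<rfloor>, 2 * \<lfloor>2 ^ n * t\<rfloor> + 1}"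
proof -
  have "2 ^ Suc n * t = 2 * (2 ^ n * t)" by simp
  moreover have "\<lfloor>2 * x\<rfloor> \<in> {2 * \<lfloor>x\<rfloor>, 2 * \<lfloor>x\<rfloor> + 1}" for x :: real
  proof -
    have "2 * \<lfloor>x\<rfloor> \<le> \<lfloor>2 * x\<rfloor>" "\<lfloor>2 * x\<rfloor> < 2 * \<lfloor>x\<rfloor> + 2" by linarith+
    then show ?thesis by auto
  qed
  ultimately show ?thesis by presburger
qed

text \<open>The dyadic truncations of \<open>t\<close> converge to \<open>t\<close>, and successive truncations are equal or neighbours
  on the finer grid, so \<open>g t\<close> differs from its value at the truncation of level \<open>m\<close> by the tail of a
  geometric series. At level \<open>m\<close> the truncations of \<open>s\<close> and \<open>t\<close> are again equal or neighbours.\<close>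

lemma dyadic_chaining:
  fixes g :: "real \<Rightarrow> real"
  assumes cont: "continuous_on UNIV g" and \<rho>: "0 \<le> \<rho>" "\<rho> < 1"
    and inc: "\<And>n i :: int. m \<le> n \<Longrightarrow> \<bar>i\<bar> \<le> 2 ^ n \<Longrightarrow>
      \<bar>g ((of_int i + 1) / 2 ^ n) - g (of_int i / 2 ^ n)\<bar> \<le> A * \<rho> ^ n"
    and st: "\<bar>s\<bar> \<le> 1" "\<bar>t\<bar> \<le> 1" "\<bar>s - t\<bar> \<le> 1 / 2 ^ m"
  shows "\<bar>g s - g t\<bar> \<le> 2 * A * \<rho> ^ m / (1 - \<rho>)"
proof -
  define p :: "nat \<Rightarrow> real \<Rightarrow> real" where "p n t = of_int \<lfloor>2 ^ n * t\<rfloor> / 2 ^ n" for n t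
  have index: "\<bar>\<lfloor>2 ^ n * t\<rfloor>\<bar> \<le> 2 ^ n" if "\<bar>t\<bar> \<le> 1" for n and t :: real
  proof -
    have "\<bar>2 ^ n * t\<bar> \<le> 2 ^ n" using that by (simp add: abs_mult mult_left_le)
    then have "- (2 ^ n) \<le> 2 ^ n * t" "2 ^ n * t \<le> 2 ^ n" by linarith+
    then have "- (2 ^ n) \<le> \<lfloor>2 ^ n * t\<rfloor>" "\<lfloor>2 ^ n * t\<rfloor> \<le> 2 ^ n"
      by (simp_all only: le_floor_iff floor_le_iff of_int_minus of_int_power of_int_numeral)
    then show ?thesis by linarith
  qed
  have A\<rho>: "0 \<le> A * \<rho> ^ n" if "m \<le> n" for n
    using inc[OF that, of 0] by simp
  have step: "\<bar>g (p (Suc n) t) - g (p n t)\<bar> \<le> A * \<rho> ^ Suc n" if "\<bar>t\<bar> \<le> 1" "m \<le> n" for n t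
  proof -
    define i where "i = \<lfloor>2 ^ n * t\<rfloor>"
    have pn: "p n t = of_int (2 * i) / 2 ^ Suc n" by (simp add: p_def i_def)
    consider "\<lfloor>2 ^ Suc n * t\<rfloor> = 2 * i" | "\<lfloor>2 ^ Suc n * t\<rfloor> = 2 * i + 1"
      using dyadic_floor_Suc[of n t] by (auto simp: i_def)
    then show ?thesis
    proof cases
      case 1
      then have "p (Suc n) t = p n t" unfolding pn by (simp only: p_def)
      then show ?thesis using A\<rho>[of "Suc n"] that by simp
    next
      case 2
      then have "p (Suc n) t = (of_int (2 * i) + 1) / 2 ^ Suc n" by (simp only: p_def) simp
      moreover have "\<bar>2 * i\<bar> \<le> 2 ^ Suc n" using index[OF that(1), of n] by (simp add: i_def)
      ultimately show ?thesis unfolding pn using inc[of "Suc n" "2 * i"] that(2) by simp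
    qed
  qed
  have chain: "\<bar>g t - g (p m t)\<bar> \<le> A * \<rho> ^ Suc m / (1 - \<rho>)" if t: "\<bar>t\<bar> \<le> 1" for t
  proof (rule LIMSEQ_le_const2)
    have "(\<lambda>k. p k t) \<longlonglongrightarrow> t" unfolding p_def by (rule dyadic_floor_tendsto)
    then have "(\<lambda>k. p (k + m) t) \<longlonglongrightarrow> t" by (rule LIMSEQ_ignore_initial_segment)
    moreover have "isCont g t" using cont by (simp add: continuous_on_eq_continuous_at)
    ultimately show "(\<lambda>k. \<bar>g (p (k + m) t) - g (p m t)\<bar>) \<longlonglongrightarrow> \<bar>g t - g (p m t)\<bar>"
      by (intro tendsto_intros isCont_tendsto_compose[of t g])
    have "\<bar>g (p (k + m) t) - g (p m t)\<bar> \<le> A * (\<rho> ^ Suc m - \<rho> ^ Suc (k + m)) / (1 - \<rho>)" for k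
    proof (induction k)
      case (Suc k)
      have "\<bar>g (p (Suc k + m) t) - g (p m t)\<bar> \<le>
          \<bar>g (p (Suc (k + m)) t) - g (p (k + m) t)\<bar> + \<bar>g (p (k + m) t) - g (p m t)\<bar>" by simp
      also have "\<dots> \<le> A * \<rho> ^ Suc (k + m) + A * (\<rho> ^ Suc m - \<rho> ^ Suc (k + m)) / (1 - \<rho>)"
        by (intro add_mono step t Suc.IH) simp
      also have "\<dots> = A * (\<rho> ^ Suc m - \<rho> ^ Suc (Suc k + m)) / (1 - \<rho>)"
        using \<rho> by (simp add: field_simps)
      finally show ?case .
    qed simp
    moreover have "A * (\<rho> ^ Suc m - \<rho> ^ Suc (k + m)) / (1 - \<rho>) \<le> A * \<rho> ^ Suc m / (1 - \<rho>)" for k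
      using A\<rho>[of "Suc (k + m)"] \<rho> by (intro divide_right_mono) (auto simp: right_diff_distrib)
    ultimately show "\<exists>N. \<forall>k\<ge>N. \<bar>g (p (k + m) t) - g (p m t)\<bar> \<le> A * \<rho> ^ Suc m / (1 - \<rho>)"
      using order_trans by blast
  qed
  have base: "\<bar>g (p m s) - g (p m t)\<bar> \<le> A * \<rho> ^ m" if "\<bar>s\<bar> \<le> 1" "\<bar>t\<bar> \<le> 1" "s \<le> t" "t - s \<le> 1 / 2 ^ m" for s t
  proof -
    define i where "i = \<lfloor>2 ^ m * s\<rfloor>"
    have "2 ^ m * t \<le> 2 ^ m * s + 1" using that(4) by (simp add: field_simps)
    moreover have "2 ^ m * s \<le> 2 ^ m * t" using that(3) by simp
    ultimately have "\<lfloor>2 ^ m * t\<rfloor> = i \<or> \<lfloor>2 ^ m * t\<rfloor> = i + 1" unfolding i_def by linarith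
    then show ?thesis
    proof
      assume "\<lfloor>2 ^ m * t\<rfloor> = i"
      then show ?thesis using A\<rho>[of m] by (simp add: p_def i_def)
    next
      assume "\<lfloor>2 ^ m * t\<rfloor> = i + 1"
      then have "p m t = (of_int i + 1) / 2 ^ m" "p m s = of_int i / 2 ^ m" by (simp_all add: p_def i_def)
      then show ?thesis using inc[of m i] index[OF that(1), of m] by (simp add: i_def abs_minus_commute)
    qed
  qed
  have "\<bar>g (p m s) - g (p m t)\<bar> \<le> A * \<rho> ^ m"
    using base[of s t] base[of t s] st by (cases "s \<le> t") (auto simp: abs_minus_commute)
  then have "\<bar>g s - g t\<bar> \<le> A * \<rho> ^ Suc m / (1 - \<rho>) + A * \<rho> ^ m + A * \<rho> ^ Suc m / (1 - \<rho>)"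
    using chain[OF st(1)] chain[OF st(2)] by linarith
  also have "\<dots> = (A * \<rho> ^ m + \<rho> * (A * \<rho> ^ m)) / (1 - \<rho>)"
  proof -
    have "1 - \<rho> \<noteq> 0" using \<rho> by simp
    moreover have "x / D + y + x / D = (2 * x + y * D) / D" if "D \<noteq> 0" for x y D :: real
      using that by (simp add: field_simps)
    ultimately have "A * \<rho> ^ Suc m / (1 - \<rho>) + A * \<rho> ^ m + A * \<rho> ^ Suc m / (1 - \<rho>) =
        (2 * (A * \<rho> ^ Suc m) + A * \<rho> ^ m * (1 - \<rho>)) / (1 - \<rho>)" by blast
    then show ?thesis by (simp add: algebra_simps)
  qed
  also have "\<dots> \<le> (A * \<rho> ^ m + 1 * (A * \<rho> ^ m)) / (1 - \<rho>)"
    using \<rho> A\<rho>[of m] by (intro divide_right_mono add_left_mono mult_right_mono) auto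
  finally show ?thesis by simp
qed

text \<open>The length \<open>2 ^ k / 2 ^ n\<close> is that of the cells into which the grid of level \<open>n\<close> divides the window
  \<open>[- (2 ^ k), 2 ^ k]\<close>. The rate \<open>\<theta>\<close> governs small scales and the rate \<open>b\<close> governs large windows; the bound
  is explicit in both so that all estimates below are uniform over the processes that satisfy it.\<close>

definition dyadic_moment_bound ::
    "'a measure \<Rightarrow> (real \<Rightarrow> 'a \<Rightarrow> real) \<Rightarrow> nat \<Rightarrow> real \<Rightarrow> real \<Rightarrow> real \<Rightarrow> bool" where
  "dyadic_moment_bound M Y m K b \<theta> \<longleftrightarrow>
     prob_space M \<and> continuous_paths M Y \<and> (\<forall>t. Y t \<in> borel_measurable M) \<and> (AE \<omega> in M. Y 0 \<omega> = 0) \<and>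
     (\<forall>k n s. integrable M (\<lambda>\<omega>. (Y (s + 2 ^ k / 2 ^ n) \<omega> - Y s \<omega>) ^ (2 * m)) \<and>
        (LINT \<omega>|M. (Y (s + 2 ^ k / 2 ^ n) \<omega> - Y s \<omega>) ^ (2 * m)) \<le> K * (b ^ k * \<theta> ^ n) ^ (2 * m))"

text \<open>The condition \<open>\<theta> ^ m \<le> 1 / 4\<close> says that the moments are of sufficiently high order: the grid of level
  \<open>n\<close> has about \<open>2 * 2 ^ n\<close> cells, and with thresholds \<open>sqrt \<theta> ^ n\<close> the Markov inequality gives each
  of them probability of order \<open>(\<theta> ^ m) ^ n \<le> (1 / 4) ^ n\<close>, which leaves a convergent geometric series.\<close>

context
  fixes m :: nat and K b \<theta> :: real
  assumes K: "0 \<le> K" and b: "0 < b" and \<theta>: "0 < \<theta>" "\<theta> < 1" and m: "\<theta> ^ m \<le> 1 / 4"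
begin

lemma chaining_event:
  assumes Y: "dyadic_moment_bound M Y m K b \<theta>" and A: "0 < A"
  shows "\<exists>E\<in>sets M. measure M E \<le> 6 * K * (b ^ k / A) ^ (2 * m) / 2 ^ \<mu> \<and>
    (\<forall>\<omega>\<in>space M - E. \<forall>s t. \<bar>s\<bar> \<le> 2 ^ k \<longrightarrow> \<bar>t\<bar> \<le> 2 ^ k \<longrightarrow> \<bar>s - t\<bar> \<le> 2 ^ k / 2 ^ \<mu> \<longrightarrow>
      \<bar>Y s \<omega> - Y t \<omega>\<bar> \<le> 2 * A * sqrt \<theta> ^ \<mu> / (1 - sqrt \<theta>))"
proof -
  interpret prob_space M using Y by (simp add: dyadic_moment_bound_def)
  define \<rho> where "\<rho> = sqrt \<theta>"
  have \<rho>: "0 < \<rho>" "\<rho> < 1" "\<theta> = \<rho>\<^sup>2" using \<theta> by (auto simp: \<rho>_def)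
  have [measurable]: "Y t \<in> borel_measurable M" for t using Y by (simp add: dyadic_moment_bound_def)
  have cont: "continuous_on UNIV (\<lambda>t. Y t \<omega>)" if "\<omega> \<in> space M" for \<omega>
    using Y that by (auto simp: dyadic_moment_bound_def continuous_paths_def)
  define D where "D n i = {\<omega> \<in> space M. A * \<rho> ^ n <
      \<bar>Y (2 ^ k * ((of_int i + 1) / 2 ^ n)) \<omega> - Y (2 ^ k * (of_int i / 2 ^ n)) \<omega>\<bar>}" for n and i :: int
  have D[measurable]: "D n i \<in> sets M" for n i unfolding D_def by measurable
  define K' where "K' = K * (b ^ k / A) ^ (2 * m)"
  have K': "0 \<le> K'" using K b A by (simp add: K'_def)
  have probD: "prob (D n i) \<le> K' * (1 / 4) ^ n" for n i
  proof -
    define s where "s = 2 ^ k * (of_int i / 2 ^ n :: real)"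
    define u where "u = (\<lambda>\<omega>. (Y (s + 2 ^ k / 2 ^ n) \<omega> - Y s \<omega>) ^ (2 * m))"
    have s1: "2 ^ k * ((of_int i + 1) / 2 ^ n) = s + 2 ^ k / 2 ^ n"
      by (simp add: s_def field_simps)
    have u: "integrable M u" "expectation u \<le> K * (b ^ k * \<theta> ^ n) ^ (2 * m)"
      using Y by (simp_all add: dyadic_moment_bound_def u_def)
    define c where "c = (A * \<rho> ^ n) ^ (2 * m)"
    have c: "0 < c" using A \<rho> by (simp add: c_def)
    have [measurable]: "u \<in> borel_measurable M" unfolding u_def by measurable
    have "D n i \<subseteq> {\<omega> \<in> space M. c \<le> u \<omega>}"
    proof
      fix \<omega> assume "\<omega> \<in> D n i"
      then have \<omega>: "\<omega> \<in> space M" and "A * \<rho> ^ n < \<bar>Y (s + 2 ^ k / 2 ^ n) \<omega> - Y s \<omega>\<bar>"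
        unfolding D_def s1 s_def[symmetric] by blast+
      then have "c \<le> \<bar>Y (s + 2 ^ k / 2 ^ n) \<omega> - Y s \<omega>\<bar> ^ (2 * m)"
        unfolding c_def using A \<rho> by (intro power_mono) auto
      then show "\<omega> \<in> {\<omega> \<in> space M. c \<le> u \<omega>}" using \<omega> by (simp add: u_def power_even_abs)
    qed
    then have "prob (D n i) \<le> prob {\<omega> \<in> space M. c \<le> u \<omega>}" by (intro finite_measure_mono) auto
    also have "\<dots> \<le> expectation u / c"
      using integral_Markov_inequality_measure[OF u(1), of "{}" c] c
      by (auto simp: u_def)
    also have "\<dots> \<le> K * (b ^ k * \<theta> ^ n) ^ (2 * m) / c"
      using u(2) c by (intro divide_right_mono) auto
    also have "\<dots> = K' * (\<theta> ^ n / \<rho> ^ n) ^ (2 * m)"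
      by (simp add: c_def K'_def power_divide power_mult_distrib)
    also have "\<theta> ^ n / \<rho> ^ n = \<rho> ^ n" using \<rho> by (simp add: power2_eq_square power_mult_distrib)
    also have "(\<rho> ^ n) ^ (2 * m) = (\<theta> ^ m) ^ n"
      by (simp add: \<rho>(3) flip: power_mult) (simp add: mult_ac)
    also have "K' * (\<theta> ^ m) ^ n \<le> K' * (1 / 4) ^ n"
      using m \<theta> K' by (intro mult_left_mono power_mono) auto
    finally show ?thesis .
  qed
  define G where "G n = (\<Union>i\<in>{- (2 ^ (\<mu> + n))..2 ^ (\<mu> + n)}. D (\<mu> + n) i)" for n
  have G[measurable]: "G n \<in> sets M" for n unfolding G_def by measurable
  have probG: "prob (G n) \<le> 3 * K' * (1 / 2) ^ \<mu> * (1 / 2) ^ n" for n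
  proof -
    let ?N = "\<mu> + n"
    have "prob (G n) \<le> (\<Sum>i\<in>{- (2 ^ ?N)..2 ^ ?N}. prob (D ?N i))"
      unfolding G_def by (rule finite_measure_subadditive_finite) auto
    also have "\<dots> \<le> (\<Sum>i\<in>{- (2 ^ ?N)..2 ^ ?N :: int}. K' * (1 / 4) ^ ?N)"
      by (intro sum_mono probD)
    also have "\<dots> = real (card {- (2 ^ ?N)..2 ^ ?N :: int}) * (K' * (1 / 4) ^ ?N)" by simp
    also have "real (card {- (2 ^ ?N)..2 ^ ?N :: int}) = 2 * 2 ^ ?N + 1"
      by (simp add: algebra_simps)
    also have "(2 * 2 ^ ?N + 1) * (K' * (1 / 4) ^ ?N) \<le> (3 * 2 ^ ?N) * (K' * (1 / 4) ^ ?N)"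
      using K' by (intro mult_right_mono) auto
    also have "\<dots> = 3 * K' * (2 * (1 / 4)) ^ ?N"
      by (simp only: power_mult_distrib mult_ac)
    also have "\<dots> = 3 * K' * (1 / 2) ^ \<mu> * (1 / 2) ^ n" by (simp add: power_add)
    finally show ?thesis .
  qed
  have sumG: "(\<lambda>n. 3 * K' * (1 / 2) ^ \<mu> * (1 / 2) ^ n) sums (3 * K' * (1 / 2) ^ \<mu> * 2)"
    using sums_mult[OF geometric_sums[of "1 / 2 :: real"], of "3 * K' * (1 / 2) ^ \<mu>"] by simp
  have "summable (\<lambda>n. prob (G n))"
    by (rule summable_comparison_test'[OF sums_summable[OF sumG], of 0]) (use probG in auto)
  then have "prob (\<Union>n. G n) \<le> (\<Sum>n. prob (G n))"
    by (intro finite_measure_subadditive_countably) auto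
  also have "\<dots> \<le> (\<Sum>n. 3 * K' * (1 / 2) ^ \<mu> * (1 / 2) ^ n)"
    by (intro suminf_le probG sums_summable[OF sumG]) fact
  also have "\<dots> = 3 * K' * (1 / 2) ^ \<mu> * 2" using sumG by (rule sums_unique[symmetric])
  also have "\<dots> = 6 * K * (b ^ k / A) ^ (2 * m) / 2 ^ \<mu>" by (simp add: K'_def power_one_over)
  finally have prob: "prob (\<Union>n. G n) \<le> 6 * K * (b ^ k / A) ^ (2 * m) / 2 ^ \<mu>" .
  show ?thesis
  proof (intro bexI[of _ "\<Union>n. G n"] conjI prob ballI allI impI)
    fix \<omega> and s t :: real
    assume \<omega>: "\<omega> \<in> space M - (\<Union>n. G n)"
      and st: "\<bar>s\<bar> \<le> 2 ^ k" "\<bar>t\<bar> \<le> 2 ^ k" "\<bar>s - t\<bar> \<le> 2 ^ k / 2 ^ \<mu>"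
    define g where "g x = Y (2 ^ k * x) \<omega>" for x
    have "\<bar>g (s / 2 ^ k) - g (t / 2 ^ k)\<bar> \<le> 2 * A * \<rho> ^ \<mu> / (1 - \<rho>)"
    proof (rule dyadic_chaining[where g = g])
      show "continuous_on UNIV g"
        unfolding g_def using \<omega> by (intro continuous_on_compose2[OF cont] continuous_intros) auto
      fix n and i :: int assume n: "\<mu> \<le> n" and i: "\<bar>i\<bar> \<le> 2 ^ n"
      have "\<omega> \<notin> G (n - \<mu>)" using \<omega> by blast
      moreover have "i \<in> {- (2 ^ n)..2 ^ n}" using i by (simp add: abs_le_iff)
      ultimately have "\<omega> \<notin> D n i" using n by (auto simp: G_def)
      then show "\<bar>g ((of_int i + 1) / 2 ^ n) - g (of_int i / 2 ^ n)\<bar> \<le> A * \<rho> ^ n"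
        using \<omega> unfolding D_def g_def by auto
    next
      have "s / 2 ^ k - t / 2 ^ k = (s - t) / 2 ^ k" by (simp add: diff_divide_distrib)
      then have "\<bar>s / 2 ^ k - t / 2 ^ k\<bar> = \<bar>s - t\<bar> / 2 ^ k" by (simp add: abs_divide)
      also have "\<dots> \<le> 2 ^ k / 2 ^ \<mu> / 2 ^ k" using st(3) by (intro divide_right_mono) auto
      finally show "\<bar>s / 2 ^ k - t / 2 ^ k\<bar> \<le> 1 / 2 ^ \<mu>" by simp
    qed (use \<rho> st in \<open>auto simp: abs_divide\<close>)
    then show "\<bar>Y s \<omega> - Y t \<omega>\<bar> \<le> 2 * A * sqrt \<theta> ^ \<mu> / (1 - sqrt \<theta>)"
      by (simp add: g_def \<rho>_def)
  qed measurable
qed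

text \<open>On a fixed window the exceptional probability and the modulus of continuity both tend to 0 as the
  starting level of the chain grows.\<close>

lemma modulus_event:
  assumes e: "0 < e" and \<eta>: "0 < \<eta>"
  shows "\<exists>n0. \<forall>n\<ge>n0. \<forall>(M :: 'a measure) Y. dyadic_moment_bound M Y m K b \<theta> \<longrightarrow>
    (\<exists>E\<in>sets M. measure M E \<le> \<eta> \<and> (\<forall>\<omega>\<in>space M - E. \<forall>s t.
      \<bar>s\<bar> \<le> R \<longrightarrow> \<bar>t\<bar> \<le> R \<longrightarrow> \<bar>s - t\<bar> \<le> 1 / 2 ^ n \<longrightarrow> \<bar>Y s \<omega> - Y t \<omega>\<bar> \<le> e))"
proof -
  obtain k where k: "R < 2 ^ k" using real_arch_pow[of 2 R] by auto
  define C where "C = 6 * K * (b ^ k / 1) ^ (2 * m)"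
  have "(\<lambda>n. C * (1 / 2) ^ n) \<longlonglongrightarrow> C * 0" "(\<lambda>n. 2 * sqrt \<theta> ^ n / (1 - sqrt \<theta>)) \<longlonglongrightarrow> 2 * 0 / (1 - sqrt \<theta>)"
    using \<theta> by (intro tendsto_intros LIMSEQ_power_zero; simp)+
  then have "\<forall>\<^sub>F n in sequentially. C * (1 / 2) ^ n < \<eta> \<and> 2 * sqrt \<theta> ^ n / (1 - sqrt \<theta>) < e"
    using e \<eta> by (intro eventually_conj order_tendstoD(2)) auto
  then obtain n0 where n0: "\<And>n. n \<ge> n0 \<Longrightarrow> C * (1 / 2) ^ n < \<eta>"
    "\<And>n. n \<ge> n0 \<Longrightarrow> 2 * sqrt \<theta> ^ n / (1 - sqrt \<theta>) < e"
    unfolding eventually_sequentially by blast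
  show ?thesis
  proof (intro exI[of _ n0] allI impI)
    fix n M Y assume n: "n \<ge> n0" and Y: "dyadic_moment_bound (M :: 'a measure) Y m K b \<theta>"
    obtain E where E: "E \<in> sets M" "measure M E \<le> C / 2 ^ n"
      "\<And>\<omega> s t. \<omega> \<in> space M - E \<Longrightarrow> \<bar>s\<bar> \<le> 2 ^ k \<Longrightarrow> \<bar>t\<bar> \<le> 2 ^ k \<Longrightarrow> \<bar>s - t\<bar> \<le> 2 ^ k / 2 ^ n \<Longrightarrow>
        \<bar>Y s \<omega> - Y t \<omega>\<bar> \<le> 2 * 1 * sqrt \<theta> ^ n / (1 - sqrt \<theta>)"
      using chaining_event[OF Y, of 1 k n] unfolding C_def by auto
    have "1 / 2 ^ n \<le> (2 :: real) ^ k / 2 ^ n" by (intro divide_right_mono) auto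
    then have "\<bar>Y s \<omega> - Y t \<omega>\<bar> \<le> e"
      if "\<omega> \<in> space M - E" "\<bar>s\<bar> \<le> R" "\<bar>t\<bar> \<le> R" "\<bar>s - t\<bar> \<le> 1 / 2 ^ n" for \<omega> s t
      using E(3)[OF that(1), of s t] n0(2)[OF n] that k by auto
    moreover have "measure M E \<le> \<eta>" using E(2) n0(1)[OF n] by (simp add: power_one_over)
    ultimately show "\<exists>E\<in>sets M. measure M E \<le> \<eta> \<and> (\<forall>\<omega>\<in>space M - E. \<forall>s t.
        \<bar>s\<bar> \<le> R \<longrightarrow> \<bar>t\<bar> \<le> R \<longrightarrow> \<bar>s - t\<bar> \<le> 1 / 2 ^ n \<longrightarrow> \<bar>Y s \<omega> - Y t \<omega>\<bar> \<le> e)"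
      using E(1) by blast
  qed
qed

text \<open>On the window \<open>[- (2 ^ k), 2 ^ k]\<close> the path is compared with \<open>Y 0 = 0\<close>, with a threshold of order
  \<open>(2 powr \<gamma>) ^ k\<close>. The exceptional probabilities are of order \<open>((b / 2 powr \<gamma>) ^ (2 * m)) ^ k\<close>, and
  \<open>b < 2 powr \<gamma>\<close> makes them summable over the windows.\<close>

lemma tail_event:
  assumes \<gamma>: "0 \<le> \<gamma>" "b < 2 powr \<gamma>" and e: "0 < e" and \<eta>: "0 < \<eta>"
  shows "\<exists>T>0. \<forall>(M :: 'a measure) Y. dyadic_moment_bound M Y m K b \<theta> \<longrightarrow>
    (\<exists>E\<in>sets M. measure M E \<le> \<eta> \<and> (\<forall>\<omega>\<in>space M - E. \<forall>t. T \<le> \<bar>t\<bar> \<longrightarrow>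
      \<bar>Y t \<omega>\<bar> \<le> e * (1 + \<bar>t\<bar> powr \<gamma>)))"
proof -
  define w where "w = 2 powr \<gamma>"
  have w: "0 < w" "b < w" using \<gamma>(2) by (auto simp: w_def)
  \<comment> \<open>Chosen so that the oscillation bound \<open>2 * (a * w ^ Suc k) / (1 - sqrt \<theta>)\<close> on the window of radius \<open>2 ^ Suc k\<close>
     equals \<open>e * w ^ k\<close>; the spare factor \<open>w\<close> covers points with \<open>2 ^ k \<le> \<bar>t\<bar>\<close>.\<close>
  define a where "a = e * (1 - sqrt \<theta>) / (2 * w)"
  have a: "0 < a" using e \<theta> w by (simp add: a_def)
  define q where "q = (b / w) ^ (2 * m)"
  have m0: "m \<noteq> 0" using m by (intro notI) simp
  have q: "0 \<le> q" "q < 1"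
    using b w m0 by (auto simp: q_def power_less_one_iff)
  define C where "C = 6 * K / a ^ (2 * m)"
  have bound: "6 * K * (b ^ k / (a * w ^ k)) ^ (2 * m) / 2 ^ 0 = C * q ^ k" for k
    by (simp add: C_def q_def power_divide power_mult_distrib flip: power_mult) (simp add: mult_ac)
  have "(\<lambda>\<kappa>. C * q ^ \<kappa> * (1 / (1 - q))) \<longlonglongrightarrow> C * 0 * (1 / (1 - q))"
    using q by (intro tendsto_intros LIMSEQ_power_zero) auto
  then have "\<forall>\<^sub>F \<kappa> in sequentially. C * q ^ \<kappa> * (1 / (1 - q)) < \<eta>"
    using \<eta> by (intro order_tendstoD(2)) auto
  then obtain \<kappa> where \<kappa>: "C * q ^ \<kappa> * (1 / (1 - q)) < \<eta>"
    unfolding eventually_sequentially by blast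
  show ?thesis
  proof (intro exI[of _ "2 ^ \<kappa>"] conjI allI impI)
    fix M Y assume Y: "dyadic_moment_bound (M :: 'a measure) Y m K b \<theta>"
    interpret prob_space M using Y by (simp add: dyadic_moment_bound_def)
    have [measurable]: "Y t \<in> borel_measurable M" for t using Y by (simp add: dyadic_moment_bound_def)
    have "\<forall>k. \<exists>E\<in>sets M. prob E \<le> C * q ^ k \<and> (\<forall>\<omega>\<in>space M - E. \<forall>s t. \<bar>s\<bar> \<le> 2 ^ k \<longrightarrow> \<bar>t\<bar> \<le> 2 ^ k \<longrightarrow>
        \<bar>s - t\<bar> \<le> 2 ^ k / 2 ^ 0 \<longrightarrow> \<bar>Y s \<omega> - Y t \<omega>\<bar> \<le> 2 * (a * w ^ k) * sqrt \<theta> ^ 0 / (1 - sqrt \<theta>))"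
      using chaining_event[OF Y, of "a * w ^ k" k 0 for k] a w unfolding bound by simp
    then obtain E where E: "\<And>k. E k \<in> sets M" "\<And>k. prob (E k) \<le> C * q ^ k"
      "\<And>k \<omega> s t. \<omega> \<in> space M - E k \<Longrightarrow> \<bar>s\<bar> \<le> 2 ^ k \<Longrightarrow> \<bar>t\<bar> \<le> 2 ^ k \<Longrightarrow> \<bar>s - t\<bar> \<le> 2 ^ k / 2 ^ 0 \<Longrightarrow>
        \<bar>Y s \<omega> - Y t \<omega>\<bar> \<le> 2 * (a * w ^ k) * sqrt \<theta> ^ 0 / (1 - sqrt \<theta>)"
      by metis
    define Z where "Z = {\<omega> \<in> space M. Y 0 \<omega> \<noteq> 0}"
    have Z[measurable]: "Z \<in> sets M" unfolding Z_def by measurable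
    have "AE \<omega> in M. \<omega> \<notin> Z" using Y by (auto simp: dyadic_moment_bound_def Z_def)
    then have probZ: "prob Z = 0" by (simp add: prob_eq_0)
    have sumq: "(\<lambda>i. C * q ^ \<kappa> * q ^ i) sums (C * q ^ \<kappa> * (1 / (1 - q)))"
      using q by (intro sums_mult geometric_sums) auto
    have le: "prob (E (\<kappa> + i)) \<le> C * q ^ \<kappa> * q ^ i" for i using E(2)[of "\<kappa> + i"] by (simp add: power_add mult_ac)
    have sum: "summable (\<lambda>i. prob (E (\<kappa> + i)))"
      by (rule summable_comparison_test'[OF sums_summable[OF sumq], of 0]) (use le in auto)
    have "prob (\<Union>i. E (\<kappa> + i)) \<le> (\<Sum>i. prob (E (\<kappa> + i)))"
      using E(1) sum by (intro finite_measure_subadditive_countably) auto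
    also have "\<dots> \<le> (\<Sum>i. C * q ^ \<kappa> * q ^ i)"
      by (intro suminf_le le sum sums_summable[OF sumq])
    also have "\<dots> = C * q ^ \<kappa> * (1 / (1 - q))" using sumq by (rule sums_unique[symmetric])
    finally have prob: "prob (\<Union>i. E (\<kappa> + i)) \<le> \<eta>" using \<kappa> by simp
    have UE: "(\<Union>i. E (\<kappa> + i)) \<in> sets M" using E(1) by blast
    have "prob (Z \<union> (\<Union>i. E (\<kappa> + i))) \<le> prob Z + prob (\<Union>i. E (\<kappa> + i))"
      by (rule measure_Un_le[OF Z UE])
    then have "prob (Z \<union> (\<Union>i. E (\<kappa> + i))) \<le> \<eta>" using prob probZ by simp
    moreover have "\<bar>Y t \<omega>\<bar> \<le> e * (1 + \<bar>t\<bar> powr \<gamma>)"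
      if \<omega>: "\<omega> \<in> space M - (Z \<union> (\<Union>i. E (\<kappa> + i)))" and t: "2 ^ \<kappa> \<le> \<bar>t\<bar>" for \<omega> t
    proof -
      define k where "k = nat \<lfloor>log 2 \<bar>t\<bar>\<rfloor>"
      have t0: "0 < \<bar>t\<bar>" using t by (rule less_le_trans[rotated]) simp
      have "log 2 (2 ^ \<kappa>) \<le> log 2 \<bar>t\<bar>" using t t0 by (subst log_le_cancel_iff) auto
      then have \<kappa>: "real \<kappa> \<le> log 2 \<bar>t\<bar>" by (simp add: log_nat_power)
      then have k: "real k \<le> log 2 \<bar>t\<bar>" "log 2 \<bar>t\<bar> < real k + 1" "\<kappa> \<le> k"
        unfolding k_def by linarith+
      have k2: "2 ^ k \<le> \<bar>t\<bar>" "\<bar>t\<bar> < 2 ^ Suc k"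
        using k(1,2) t0 by (simp_all add: le_log_iff log_less_iff powr_realpow powr_add mult.commute)
      have "Y 0 \<omega> = 0" using \<omega> by (auto simp: Z_def)
      moreover have "\<omega> \<in> space M - E (\<kappa> + (Suc k - \<kappa>))" using \<omega> by blast
      then have "\<omega> \<in> space M - E (Suc k)" using k(3) by simp
      then have "\<bar>Y t \<omega> - Y 0 \<omega>\<bar> \<le> 2 * (a * w ^ Suc k) * sqrt \<theta> ^ 0 / (1 - sqrt \<theta>)"
        using k2 by (intro E(3)) auto
      moreover have "2 * (a * w ^ Suc k) * sqrt \<theta> ^ 0 / (1 - sqrt \<theta>) = e * w ^ k"
        using \<theta> w by (simp add: a_def)
      moreover have "w ^ k = (2 ^ k) powr \<gamma>"
        by (simp add: w_def powr_realpow[symmetric] powr_powr mult.commute)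
      moreover have "(2 ^ k) powr \<gamma> \<le> \<bar>t\<bar> powr \<gamma>" using k2(1) \<gamma>(1) by (intro powr_mono2) auto
      moreover have "e * \<bar>t\<bar> powr \<gamma> \<le> e * (1 + \<bar>t\<bar> powr \<gamma>)" using e by (intro mult_left_mono) auto
      ultimately show ?thesis using e by (auto intro: order_trans mult_left_mono)
    qed
    ultimately show "\<exists>E\<in>sets M. prob E \<le> \<eta> \<and> (\<forall>\<omega>\<in>space M - E. \<forall>t. 2 ^ \<kappa> \<le> \<bar>t\<bar> \<longrightarrow>
        \<bar>Y t \<omega>\<bar> \<le> e * (1 + \<bar>t\<bar> powr \<gamma>))"
      using UE Z by (intro bexI[of _ "Z \<union> (\<Union>i. E (\<kappa> + i))"]) auto
  qed simp
qed

lemma AE_in_Omega_space: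
  assumes \<gamma>: "0 \<le> \<gamma>" "b < 2 powr \<gamma>" and Y: "dyadic_moment_bound (M :: 'a measure) Y m K b \<theta>"
  shows "AE \<omega> in M. (\<lambda>t. Y t \<omega>) \<in> Omega_space \<gamma>"
proof -
  interpret prob_space M using Y by (simp add: dyadic_moment_bound_def)
  have "AE \<omega> in M. \<exists>T. \<forall>t. T \<le> \<bar>t\<bar> \<longrightarrow> \<bar>Y t \<omega>\<bar> \<le> 1 / Suc j * (1 + \<bar>t\<bar> powr \<gamma>)" for j
  proof -
    have "\<forall>i. \<exists>E\<in>sets M. prob E \<le> 1 / Suc i \<and> (\<forall>\<omega>\<in>space M - E. \<exists>T. \<forall>t. T \<le> \<bar>t\<bar> \<longrightarrow>
        \<bar>Y t \<omega>\<bar> \<le> 1 / Suc j * (1 + \<bar>t\<bar> powr \<gamma>))"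
      using tail_event[OF \<gamma>, of "1 / Suc j" "1 / Suc i" for i] Y by (metis of_nat_0_less_iff zero_less_Suc zero_less_divide_1_iff)
    then obtain E where E: "\<And>i. E i \<in> sets M" "\<And>i. prob (E i) \<le> 1 / Suc i"
      "\<And>i \<omega>. \<omega> \<in> space M - E i \<Longrightarrow> \<exists>T. \<forall>t. T \<le> \<bar>t\<bar> \<longrightarrow> \<bar>Y t \<omega>\<bar> \<le> 1 / Suc j * (1 + \<bar>t\<bar> powr \<gamma>)"
      by metis
    have I: "(\<Inter>i. E i) \<in> sets M" using E(1) by (intro sets.countable_INT) auto
    have "prob (\<Inter>i. E i) \<le> 1 / Suc i" for i
      using E(2)[of i] finite_measure_mono[of "\<Inter>i. E i" "E i"] E(1) by force
    then have "prob (\<Inter>i. E i) \<le> 0"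
      by (intro LIMSEQ_le_const[OF LIMSEQ_Suc[OF lim_1_over_n]]) auto
    then have "prob (\<Inter>i. E i) = 0" by (simp add: antisym)
    then have "AE \<omega> in M. \<omega> \<notin> (\<Inter>i. E i)" using I prob_eq_0 by blast
    then show ?thesis
      using AE_space
    proof eventually_elim
      case (elim \<omega>)
      then obtain i where "\<omega> \<in> space M - E i" by blast
      then show ?case by (rule E(3))
    qed
  qed
  then have "AE \<omega> in M. \<forall>j. \<exists>T. \<forall>t. T \<le> \<bar>t\<bar> \<longrightarrow> \<bar>Y t \<omega>\<bar> \<le> 1 / Suc j * (1 + \<bar>t\<bar> powr \<gamma>)"
    by (simp add: AE_all_countable)
  then show ?thesis
    using AE_space
  proof eventually_elim
    case (elim \<omega>)
    show ?case
    proof (rule Omega_spaceI)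
      show "continuous_on UNIV (\<lambda>t. Y t \<omega>)"
        using Y elim(2) by (auto simp: dyadic_moment_bound_def continuous_paths_def)
      fix e :: real assume "0 < e"
      then obtain j where j: "1 / Suc j < e" using nat_approx_posE by blast
      obtain T where T: "\<And>t. T \<le> \<bar>t\<bar> \<Longrightarrow> \<bar>Y t \<omega>\<bar> \<le> 1 / Suc j * (1 + \<bar>t\<bar> powr \<gamma>)" using elim(1) by blast
      have "1 / Suc j * (1 + \<bar>t\<bar> powr \<gamma>) \<le> e * (1 + \<bar>t\<bar> powr \<gamma>)" for t
        using j by (intro mult_right_mono) auto
      then show "\<exists>T. \<forall>t. T \<le> \<bar>t\<bar> \<longrightarrow> \<bar>Y t \<omega>\<bar> \<le> e * (1 + \<bar>t\<bar> powr \<gamma>)"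
        using T order_trans by blast
    qed
  qed
qed

text \<open>The level \<open>n0\<close> does not depend on the process. This uniformity takes the place of tightness.\<close>

lemma interpolation_event:
  assumes \<gamma>: "0 \<le> \<gamma>" "b < 2 powr \<gamma>" and e: "0 < e"
  shows "\<exists>n0. \<forall>n\<ge>n0. \<forall>(M :: 'a measure) Y. dyadic_moment_bound M Y m K b \<theta> \<longrightarrow>
    (\<exists>E\<in>sets M. measure M E \<le> e \<and> (\<forall>\<omega>\<in>space M - E. (\<lambda>t. Y t \<omega>) \<in> Omega_space \<gamma> \<longrightarrow>
      Omega_dist \<gamma> (\<lambda>t. Y t \<omega>) (interpolate n (\<lambda>t. Y t \<omega>)) \<le> e))"
proof -
  define C where "C = 1 + 2 powr \<gamma>"
  have C: "0 < C" by (simp add: C_def add_pos_pos)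
  define r where "r = e / C"
  have r: "0 < r" "r * C = e" using e C by (simp_all add: r_def)
  from tail_event[OF \<gamma> r(1) half_gt_zero[OF e]] obtain T where T: "0 < T" and tail:
    "\<forall>(M :: 'a measure) Y. dyadic_moment_bound M Y m K b \<theta> \<longrightarrow>
      (\<exists>E\<in>sets M. measure M E \<le> e / 2 \<and> (\<forall>\<omega>\<in>space M - E. \<forall>t. T \<le> \<bar>t\<bar> \<longrightarrow>
        \<bar>Y t \<omega>\<bar> \<le> r * (1 + \<bar>t\<bar> powr \<gamma>)))"
    by (elim exE conjE)
  from modulus_event[OF r(1) half_gt_zero[OF e], of "T + 2"] obtain n1 where modulus:
    "\<forall>n\<ge>n1. \<forall>(M :: 'a measure) Y. dyadic_moment_bound M Y m K b \<theta> \<longrightarrow>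
      (\<exists>E\<in>sets M. measure M E \<le> e / 2 \<and> (\<forall>\<omega>\<in>space M - E. \<forall>s t.
        \<bar>s\<bar> \<le> T + 2 \<longrightarrow> \<bar>t\<bar> \<le> T + 2 \<longrightarrow> \<bar>s - t\<bar> \<le> 1 / 2 ^ n \<longrightarrow> \<bar>Y s \<omega> - Y t \<omega>\<bar> \<le> r))"
    by (elim exE)
  obtain n2 :: nat where n2: "T + 1 < n2" using reals_Archimedean2 by blast
  show ?thesis
  proof (intro exI[of _ "max n1 n2"] allI impI)
    fix n M Y assume n: "n \<ge> max n1 n2" and Y: "dyadic_moment_bound (M :: 'a measure) Y m K b \<theta>"
    interpret prob_space M using Y by (simp add: dyadic_moment_bound_def)
    obtain E1 where E1: "E1 \<in> sets M" "prob E1 \<le> e / 2"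
      "\<And>\<omega> t. \<omega> \<in> space M - E1 \<Longrightarrow> T \<le> \<bar>t\<bar> \<Longrightarrow> \<bar>Y t \<omega>\<bar> \<le> r * (1 + \<bar>t\<bar> powr \<gamma>)"
      using tail[rule_format, OF Y] by blast
    obtain E2 where E2: "E2 \<in> sets M" "prob E2 \<le> e / 2"
      "\<And>\<omega> s t. \<omega> \<in> space M - E2 \<Longrightarrow> \<bar>s\<bar> \<le> T + 2 \<Longrightarrow> \<bar>t\<bar> \<le> T + 2 \<Longrightarrow> \<bar>s - t\<bar> \<le> 1 / 2 ^ n \<Longrightarrow>
        \<bar>Y s \<omega> - Y t \<omega>\<bar> \<le> r"
      using modulus[rule_format, OF _ Y, of n] n by auto
    have "prob (E1 \<union> E2) \<le> e"
      using measure_Un_le[OF E1(1) E2(1)] E1(2) E2(2) by simp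
    moreover have "Omega_dist \<gamma> (\<lambda>t. Y t \<omega>) (interpolate n (\<lambda>t. Y t \<omega>)) \<le> e"
      if \<omega>: "\<omega> \<in> space M - (E1 \<union> E2)" and in_Omega: "(\<lambda>t. Y t \<omega>) \<in> Omega_space \<gamma>" for \<omega>
    proof -
      have "Omega_dist \<gamma> (\<lambda>t. Y t \<omega>) (interpolate n (\<lambda>t. Y t \<omega>)) \<le> r * (1 + 2 powr \<gamma>)"
        by (rule Omega_dist_interp_sample_le[OF in_Omega \<gamma>(1), of T])
          (use T n n2 \<omega> E1(3) E2(3) in auto)
      then show ?thesis using r(2) by (simp add: C_def)
    qed
    ultimately show "\<exists>E\<in>sets M. prob E \<le> e \<and> (\<forall>\<omega>\<in>space M - E. (\<lambda>t. Y t \<omega>) \<in> Omega_space \<gamma> \<longrightarrow>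
      Omega_dist \<gamma> (\<lambda>t. Y t \<omega>) (interpolate n (\<lambda>t. Y t \<omega>)) \<le> e)"
      using E1(1) E2(1) by (intro bexI[of _ "E1 \<union> E2"]) auto
  qed
qed

end

section \<open>Convergence of Gaussian vectors\<close>

definition lipschitz_in_coordinates :: "int set \<Rightarrow> real \<Rightarrow> ((int \<Rightarrow> real) \<Rightarrow> real) \<Rightarrow> bool" where
  "lipschitz_in_coordinates J L F \<longleftrightarrow> finite J \<and> 0 \<le> L \<and> (\<forall>y z. \<bar>F y - F z\<bar> \<le> L * (\<Sum>j\<in>J. \<bar>y j - z j\<bar>))"

lemma continuous_on_lipschitz_in_coordinates:
  assumes F: "lipschitz_in_coordinates J L F"
  shows "continuous_on S F"
proof -
  have "(F \<longlongrightarrow> F y) (at y)" for y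
  proof (rule LIM_zero_cancel, rule tendsto_rabs_zero_cancel,
      rule tendsto_sandwich[where f = "\<lambda>_. 0" and h = "\<lambda>z. L * (\<Sum>j\<in>J. \<bar>z j - y j\<bar>)"])
    have "continuous_on UNIV (\<lambda>z :: int \<Rightarrow> real. z j)" for j
      by (rule continuous_on_product_coordinates)
    then have "((\<lambda>z. z j) \<longlongrightarrow> y j) (at y)" for j
      by (simp add: continuous_on_def)
    then have "((\<lambda>z. L * (\<Sum>j\<in>J. \<bar>z j - y j\<bar>)) \<longlongrightarrow> L * (\<Sum>j\<in>J. \<bar>y j - y j\<bar>)) (at y)"
      by (intro tendsto_intros)
    then show "((\<lambda>z. L * (\<Sum>j\<in>J. \<bar>z j - y j\<bar>)) \<longlongrightarrow> 0) (at y)" by simp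
  qed (use F in \<open>auto simp: lipschitz_in_coordinates_def intro!: always_eventually\<close>)
  then have "continuous_on UNIV F" by (simp add: continuous_on_def)
  then show ?thesis by (rule continuous_on_subset) simp
qed

lemma borel_measurable_lipschitz_in_coordinates:
  assumes F: "lipschitz_in_coordinates J L F" and V: "\<And>j. (\<lambda>\<omega>. V \<omega> j) \<in> borel_measurable M"
  shows "(\<lambda>\<omega>. F (V \<omega>)) \<in> borel_measurable M"
proof -
  have "F \<in> borel_measurable borel"
    by (intro borel_measurable_continuous_onI continuous_on_lipschitz_in_coordinates[OF F])
  moreover have "V \<in> borel_measurable M" using V by (rule measurable_coordinatewise_then_product)
  ultimately show ?thesis by (rule measurable_compose[rotated])
qed

text \<open>Trigonometric sums form an algebra, and their expectations under centered Gaussian vectors are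
  explicit continuous functions of the covariances.\<close>

inductive trigonometric :: "((int \<Rightarrow> real) \<Rightarrow> real) \<Rightarrow> bool" where
  cosine: "finite J \<Longrightarrow> trigonometric (\<lambda>y. k * cos ((\<Sum>j\<in>J. a j * y j) + b))"
| add: "trigonometric f \<Longrightarrow> trigonometric g \<Longrightarrow> trigonometric (\<lambda>y. f y + g y)"

lemma trigonometric_const: "trigonometric (\<lambda>y. k)"
  using cosine[of "{}" k _ 0] by simp

lemma trigonometric_sin: "trigonometric (\<lambda>y. k * sin (a * y j))"
proof -
  have "cos (x + - (pi / 2)) = sin x" for x :: real by (simp add: cos_diff)
  then show ?thesis using cosine[of "{j}" k "\<lambda>_. a" "- (pi / 2)"] by simp
qed

lemma cos_times_cos_forms:
  fixes y :: "int \<Rightarrow> real"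
  assumes "finite I" "finite J"
  shows "(k * cos ((\<Sum>j\<in>I. a j * y j) + b)) * (k' * cos ((\<Sum>j\<in>J. a' j * y j) + b')) =
     k * k' / 2 * cos ((\<Sum>j\<in>I \<union> J. ((if j \<in> I then a j else 0) + (if j \<in> J then a' j else 0)) * y j) + (b + b')) +
     k * k' / 2 * cos ((\<Sum>j\<in>I \<union> J. ((if j \<in> I then a j else 0) - (if j \<in> J then a' j else 0)) * y j) + (b - b'))"
proof -
  have "(\<Sum>j\<in>I. a j * y j) = (\<Sum>j\<in>I \<union> J. (if j \<in> I then a j else 0) * y j)"
    using assms by (intro sum.mono_neutral_cong_left) auto
  moreover have "(\<Sum>j\<in>J. a' j * y j) = (\<Sum>j\<in>I \<union> J. (if j \<in> J then a' j else 0) * y j)"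
    using assms by (intro sum.mono_neutral_cong_left) auto
  moreover have "(k * cos (u + b)) * (k' * cos (v + b')) =
      k * k' / 2 * cos ((u + v) + (b + b')) + k * k' / 2 * cos ((u - v) + (b - b'))" for u v
  proof -
    have "cos (u + b) * cos (v + b') = (cos ((u + b) - (v + b')) + cos ((u + b) + (v + b'))) / 2"
      by (rule cos_times_cos)
    moreover have "(u + b) - (v + b') = (u - v) + (b - b')" "(u + b) + (v + b') = (u + v) + (b + b')"
      by simp_all
    ultimately show ?thesis by (simp add: field_simps)
  qed
  ultimately show ?thesis by (simp add: distrib_right left_diff_distrib sum.distrib sum_subtractf)
qed

lemma trigonometric_mult:
  assumes "trigonometric f" "trigonometric g"
  shows "trigonometric (\<lambda>y. f y * g y)"
  using assms(1)
proof induction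
  case (cosine I k a b)
  note I = this
  show ?case using assms(2)
  proof induction
    case (cosine J k' a' b')
    show ?case unfolding cos_times_cos_forms[OF I cosine]
      by (intro trigonometric.intros finite_UnI I cosine)
  next
    case (add f g)
    then show ?case by (simp add: distrib_left trigonometric.add)
  qed
next
  case (add f g)
  then show ?case by (simp add: distrib_right trigonometric.add)
qed

lemma compact_box: "compact {y :: int \<Rightarrow> real. \<forall>j. y j \<in> {- r..r}}"
proof -
  have "compactin (product_topology (\<lambda>_ :: int. euclideanreal) UNIV) (PiE UNIV (\<lambda>_. {- r..r}))"
    by (subst compactin_PiE) auto
  moreover have "PiE UNIV (\<lambda>_. {- r..r}) = {y :: int \<Rightarrow> real. \<forall>j. y j \<in> {- r..r}}" by auto
  ultimately show ?thesis
    by (simp add: euclidean_product_topology)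
qed

text \<open>The point \<open>r * sin (y / r)\<close> always lies in the compact box of radius \<open>r\<close>. On the box \<open>F\<close> is uniformly
  approximated by polynomials, and a polynomial in the waves \<open>r * sin (y j / r)\<close> is a trigonometric sum.
  The approximation is thus uniform in all \<open>y\<close>.\<close>

lemma trigonometric_approximation:
  assumes F: "continuous_on UNIV F" and r: "0 < r" and e: "0 < e"
  obtains g where "trigonometric g" "\<And>y. \<bar>F (\<lambda>j. r * sin (y j / r)) - g y\<bar> < e"
proof -
  define S where "S = {y :: int \<Rightarrow> real. \<forall>j. y j \<in> {- r..r}}"
  define wave where "wave y = (\<lambda>j. r * sin (y j / r))" for y :: "int \<Rightarrow> real"
  define P where "P f \<longleftrightarrow> continuous_on UNIV f \<and> trigonometric (\<lambda>y. f (wave y))" for f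
  have "\<exists>f. P f \<and> (\<forall>x\<in>S. \<bar>F x - f x\<bar> < e)"
  proof (rule Stone_Weierstrass_HOL)
    show "compact S" unfolding S_def by (rule compact_box)
    show "P (\<lambda>x. c)" for c by (simp add: P_def trigonometric_const)
    show "continuous_on S f" if "P f" for f
      using that by (auto simp: P_def intro: continuous_on_subset)
    show "P (\<lambda>x. f x + g x)" if "P f \<and> P g" for f g
      using that by (auto simp: P_def intro: continuous_intros trigonometric.add)
    show "P (\<lambda>x. f x * g x)" if "P f \<and> P g" for f g
      using that by (auto simp: P_def intro: continuous_intros trigonometric_mult)
    show "\<exists>f. P f \<and> f x \<noteq> f y" if xy: "x \<in> S \<and> y \<in> S \<and> x \<noteq> y" for x y
    proof -
      obtain j where "x j \<noteq> y j" using xy by (auto simp: fun_eq_iff)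
      moreover have "P (\<lambda>y. y j)"
        using continuous_on_product_coordinates[of j] trigonometric_sin[of r "1 / r" j]
        by (simp add: P_def wave_def)
      ultimately show ?thesis by blast
    qed
    show "continuous_on S F" using F by (rule continuous_on_subset) simp
  qed fact
  then obtain f where f: "P f" "\<And>x. x \<in> S \<Longrightarrow> \<bar>F x - f x\<bar> < e" by blast
  have "wave y \<in> S" for y
  proof -
    have "r * sin x \<le> r" "- r \<le> r * sin x" for x
      using mult_left_mono[OF sin_le_one, of r x] mult_left_mono[OF sin_ge_minus_one, of r x] r by auto
    then show ?thesis by (auto simp: S_def wave_def)
  qed
  with f show ?thesis
    by (intro that[of "\<lambda>y. f (wave y)"]) (auto simp: P_def wave_def)
qed

text \<open>For a variable with bounded second moment the wave replaces the identity at a cost of order \<open>1 / r\<close> in the mean.\<close>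

lemma abs_minus_wave_le:
  fixes x r :: real
  assumes r: "0 < r" shows "\<bar>x - r * sin (x / r)\<bar> \<le> x\<^sup>2 / (2 * r)"
proof -
  have "\<bar>sin (x / r) - x / r\<bar> \<le> (x / r)\<^sup>2 / 2"
    using Maclaurin_sin_bound[of "x / r" 2] by (simp add: sin_coeff_def numeral_2_eq_2)
  then have "r * \<bar>sin (x / r) - x / r\<bar> \<le> r * ((x / r)\<^sup>2 / 2)"
    using r by (intro mult_left_mono) auto
  moreover have "r * \<bar>sin (x / r) - x / r\<bar> = \<bar>r * (sin (x / r) - x / r)\<bar>"
    using r by (simp add: abs_mult)
  moreover have "r * (sin (x / r) - x / r) = - (x - r * sin (x / r))" using r by (simp add: algebra_simps)
  moreover have "r * ((x / r)\<^sup>2 / 2) = x\<^sup>2 / (2 * r)" using r by (simp add: power2_eq_square)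
  ultimately show ?thesis by (metis abs_minus_cancel)
qed

definition centered_gaussian_vector :: "'a measure \<Rightarrow> ('a \<Rightarrow> int \<Rightarrow> real) \<Rightarrow> bool" where
  "centered_gaussian_vector M V \<longleftrightarrow> prob_space M \<and>
     (\<forall>J a. finite J \<longrightarrow> gaussian_rv M (\<lambda>\<omega>. \<Sum>j\<in>J. a j * V \<omega> j) \<and>
        (LINT \<omega>|M. (\<Sum>j\<in>J. a j * V \<omega> j)) = 0)"

lemma centered_gaussian_vector_coordinate:
  assumes V: "centered_gaussian_vector M V"
  shows "gaussian_rv M (\<lambda>\<omega>. V \<omega> j)" "(LINT \<omega>|M. V \<omega> j) = 0"
proof -
  have "gaussian_rv M (\<lambda>\<omega>. \<Sum>j\<in>{j}. 1 * V \<omega> j) \<and> (LINT \<omega>|M. (\<Sum>j\<in>{j}. 1 * V \<omega> j)) = 0"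
    using V unfolding centered_gaussian_vector_def by (elim conjE allE[of _ "{j}"]) (erule allE[of _ "\<lambda>_. 1"], simp)
  then show "gaussian_rv M (\<lambda>\<omega>. V \<omega> j)" "(LINT \<omega>|M. V \<omega> j) = 0" by simp_all
qed

definition form_variance :: "'a measure \<Rightarrow> ('a \<Rightarrow> int \<Rightarrow> real) \<Rightarrow> int set \<Rightarrow> (int \<Rightarrow> real) \<Rightarrow> real" where
  "form_variance M V J a = (LINT \<omega>|M. (\<Sum>j\<in>J. a j * V \<omega> j)\<^sup>2)"

lemma trigonometric_integrable:
  assumes V: "centered_gaussian_vector M V" and g: "trigonometric g"
  shows "integrable M (\<lambda>\<omega>. g (V \<omega>))"
  using g
proof induction
  case (cosine J k a b)
  interpret prob_space M using V by (simp add: centered_gaussian_vector_def)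
  have [measurable]: "(\<lambda>\<omega>. \<Sum>j\<in>J. a j * V \<omega> j) \<in> borel_measurable M"
    using V cosine by (simp add: centered_gaussian_vector_def gaussian_rv_def)
  show ?case
    by (intro integrable_mult_right integrable_const_bound[where B = 1]) auto
qed simp

lemma trigonometric_expectation_tendsto:
  assumes V: "\<forall>\<^sub>F c in F. centered_gaussian_vector M (V c)" and W: "centered_gaussian_vector N W"
    and var: "\<And>J a. finite J \<Longrightarrow> ((\<lambda>c. form_variance M (V c) J a) \<longlongrightarrow> form_variance N W J a) F"
    and g: "trigonometric g"
  shows "((\<lambda>c. (LINT \<omega>|M. g (V c \<omega>))) \<longlongrightarrow> (LINT \<omega>|N. g (W \<omega>))) F"
  using g
proof induction
  case (cosine J k a b)
  have exp: "k * (cos b * exp (- form_variance P U J a / 2)) = (LINT \<omega>|P. k * cos ((\<Sum>j\<in>J. a j * U \<omega> j) + b))"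
    if U: "centered_gaussian_vector P U" for P :: "'z measure" and U
  proof -
    interpret prob_space P using U by (simp add: centered_gaussian_vector_def)
    have "gaussian_rv P (\<lambda>\<omega>. \<Sum>j\<in>J. a j * U \<omega> j)" "expectation (\<lambda>\<omega>. \<Sum>j\<in>J. a j * U \<omega> j) = 0"
      using U cosine by (simp_all add: centered_gaussian_vector_def)
    then show ?thesis
      using centered_gaussian_expectation_cos by (simp add: form_variance_def)
  qed
  have "((\<lambda>c. k * (cos b * exp (- form_variance M (V c) J a / 2))) \<longlongrightarrow>
      k * (cos b * exp (- form_variance N W J a / 2))) F"
    by (intro tendsto_intros var cosine) simp
  moreover have "\<forall>\<^sub>F c in F. k * (cos b * exp (- form_variance M (V c) J a / 2)) =
      (LINT \<omega>|M. k * cos ((\<Sum>j\<in>J. a j * V c \<omega> j) + b))"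
    using V by eventually_elim (rule exp)
  ultimately show ?case unfolding exp[OF W] by (rule Lim_transform_eventually)
next
  case (add f g)
  have "((\<lambda>c. (LINT \<omega>|M. f (V c \<omega>)) + (LINT \<omega>|M. g (V c \<omega>))) \<longlongrightarrow>
      (LINT \<omega>|N. f (W \<omega>)) + (LINT \<omega>|N. g (W \<omega>))) F"
    by (intro tendsto_add add.IH)
  moreover have "\<forall>\<^sub>F c in F. (LINT \<omega>|M. f (V c \<omega>)) + (LINT \<omega>|M. g (V c \<omega>)) = (LINT \<omega>|M. f (V c \<omega>) + g (V c \<omega>))"
    using V by eventually_elim (simp add: trigonometric_integrable add.hyps)
  ultimately show ?case
    using W add.hyps by (simp add: trigonometric_integrable tendsto_cong)
qed

text \<open>Gaussian laws depend continuously on their covariances, because \<open>H\<close> can be replaced by a trigonometric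
  sum, at a cost that is bounded by the variances.\<close>

lemma gaussian_vector_expectation_tendsto:
  assumes V: "\<forall>\<^sub>F c in F. centered_gaussian_vector M (V c)" and W: "centered_gaussian_vector N W"
    and var: "\<And>J a. finite J \<Longrightarrow> ((\<lambda>c. form_variance M (V c) J a) \<longlongrightarrow> form_variance N W J a) F"
    and H: "lipschitz_in_coordinates J L H" and K: "\<And>y. \<bar>H y\<bar> \<le> K"
  shows "((\<lambda>c. (LINT \<omega>|M. H (V c \<omega>))) \<longlongrightarrow> (LINT \<omega>|N. H (W \<omega>))) F"
proof (rule tendstoI)
  fix e :: real assume e: "0 < e"
  have J: "finite J" and L: "0 \<le> L" using H by (simp_all add: lipschitz_in_coordinates_def)
  define v where "v = (\<Sum>j\<in>J. form_variance N W {j} (\<lambda>_. 1)) + 1"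
  have v0: "0 < v" unfolding v_def form_variance_def
    by (intro add_nonneg_pos sum_nonneg integral_nonneg_AE) auto
  \<comment> \<open>With this radius the cost \<open>L * (v / (2 * r))\<close> of passing to the waves is below \<open>e / 4\<close>.\<close>
  define r where "r = 4 * (L * v + 1) / e"
  have Lv: "0 \<le> L * v" using L v0 by simp
  then have r: "0 < r" using e by (auto simp: r_def intro!: divide_pos_pos)
  have "r * e = 4 * (L * v + 1)" using e by (simp add: r_def)
  then have "L * v < e / 4 * (2 * r)" using Lv by (simp add: algebra_simps)
  then have Lvr: "L * (v / (2 * r)) < e / 4" using r by (simp add: pos_divide_less_eq)
  obtain g where g: "trigonometric g" "\<And>y. \<bar>H (\<lambda>j. r * sin (y j / r)) - g y\<bar> < e / 8"
    using trigonometric_approximation[OF continuous_on_lipschitz_in_coordinates[OF H] r, of "e / 8"] e by auto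
  have close: "\<bar>(LINT \<omega>|P. H (U \<omega>)) - (LINT \<omega>|P. g (U \<omega>))\<bar> < 3 * e / 8"
    if U: "centered_gaussian_vector P U"
      and var_le: "(\<Sum>j\<in>J. form_variance P U {j} (\<lambda>_. 1)) \<le> v" for P :: "'z measure" and U
  proof -
    interpret prob_space P using U by (simp add: centered_gaussian_vector_def)
    note coord = centered_gaussian_vector_coordinate[OF U]
    have meas: "(\<lambda>\<omega>. U \<omega> j) \<in> borel_measurable P" for j using coord by (simp add: gaussian_rv_def)
    have int_H: "integrable P (\<lambda>\<omega>. H (U \<omega>))"
      using K by (intro integrable_const_bound[where B = K] borel_measurable_lipschitz_in_coordinates[OF H meas]) auto
    have int_g: "integrable P (\<lambda>\<omega>. g (U \<omega>))" using U g(1) by (rule trigonometric_integrable)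
    have int_sq: "integrable P (\<lambda>\<omega>. (U \<omega> j)\<^sup>2)" for j
      using coord by (rule centered_gaussian_square_integrable)
    have pointwise: "\<bar>H (U \<omega>) - g (U \<omega>)\<bar> \<le> L * (\<Sum>j\<in>J. (U \<omega> j)\<^sup>2 / (2 * r)) + e / 8" for \<omega>
    proof -
      have "\<bar>H (U \<omega>) - H (\<lambda>j. r * sin (U \<omega> j / r))\<bar> \<le> L * (\<Sum>j\<in>J. \<bar>U \<omega> j - r * sin (U \<omega> j / r)\<bar>)"
        using H unfolding lipschitz_in_coordinates_def by blast
      also have "\<dots> \<le> L * (\<Sum>j\<in>J. (U \<omega> j)\<^sup>2 / (2 * r))"
        using L by (intro mult_left_mono sum_mono abs_minus_wave_le r)
      finally show ?thesis using g(2)[of "U \<omega>"] by linarith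
    qed
    have "\<bar>(LINT \<omega>|P. H (U \<omega>)) - (LINT \<omega>|P. g (U \<omega>))\<bar> = \<bar>LINT \<omega>|P. H (U \<omega>) - g (U \<omega>)\<bar>"
      using int_H int_g by simp
    also have "\<dots> \<le> (LINT \<omega>|P. \<bar>H (U \<omega>) - g (U \<omega>)\<bar>)" by (rule integral_abs_bound)
    also have "\<dots> \<le> (LINT \<omega>|P. L * (\<Sum>j\<in>J. (U \<omega> j)\<^sup>2 / (2 * r)) + e / 8)"
      using int_H int_g int_sq by (intro integral_mono pointwise) auto
    also have "\<dots> = L * ((\<Sum>j\<in>J. LINT \<omega>|P. (U \<omega> j)\<^sup>2) / (2 * r)) + e / 8"
      using int_sq by (simp add: prob_space sum_divide_distrib)
    also have "(\<Sum>j\<in>J. LINT \<omega>|P. (U \<omega> j)\<^sup>2) \<le> v" using var_le by (simp add: form_variance_def)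
    then have "L * ((\<Sum>j\<in>J. LINT \<omega>|P. (U \<omega> j)\<^sup>2) / (2 * r)) \<le> L * (v / (2 * r))"
      using L r by (intro mult_left_mono divide_right_mono) auto
    finally show ?thesis using Lvr by simp
  qed
  have "((\<lambda>c. \<Sum>j\<in>J. form_variance M (V c) {j} (\<lambda>_. 1)) \<longlongrightarrow> (\<Sum>j\<in>J. form_variance N W {j} (\<lambda>_. 1))) F"
    by (intro tendsto_sum var) simp
  then have "\<forall>\<^sub>F c in F. (\<Sum>j\<in>J. form_variance M (V c) {j} (\<lambda>_. 1)) < v"
    by (rule order_tendstoD(2)) (simp add: v_def)
  moreover note V
  moreover have "\<forall>\<^sub>F c in F. dist (LINT \<omega>|M. g (V c \<omega>)) (LINT \<omega>|N. g (W \<omega>)) < e / 4"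
    using trigonometric_expectation_tendsto[OF V W var g(1)] e by (intro tendstoD) auto
  ultimately show "\<forall>\<^sub>F c in F. dist (LINT \<omega>|M. H (V c \<omega>)) (LINT \<omega>|N. H (W \<omega>)) < e"
  proof eventually_elim
    case (elim c)
    have "\<bar>(LINT \<omega>|M. H (V c \<omega>)) - (LINT \<omega>|M. g (V c \<omega>))\<bar> < 3 * e / 8"
      using elim by (intro close) auto
    moreover have "\<bar>(LINT \<omega>|N. H (W \<omega>)) - (LINT \<omega>|N. g (W \<omega>))\<bar> < 3 * e / 8"
      by (intro close W) (simp add: v_def)
    ultimately show ?case using elim(3) unfolding dist_real_def by linarith
  qed
qed

section \<open>Weak convergence of Gaussian processes in weighted spaces\<close>

text \<open>Membership in terms of countably many path values, which makes it a measurable event.\<close>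

lemma Omega_space_iff_dyadic:
  assumes cont: "continuous_on UNIV f" and \<gamma>: "0 < \<gamma>"
  shows "f \<in> Omega_space \<gamma> \<longleftrightarrow> (\<forall>i. \<exists>T. \<forall>n. \<forall>j::int. real T \<le> \<bar>of_int j / 2 ^ n\<bar> \<longrightarrow>
    \<bar>f (of_int j / 2 ^ n)\<bar> \<le> 1 / real (Suc i) * (1 + \<bar>of_int j / 2 ^ n\<bar> powr \<gamma>))"
    (is "_ \<longleftrightarrow> (\<forall>i. \<exists>T. ?tail i T)")
proof
  assume f: "f \<in> Omega_space \<gamma>"
  show "\<forall>i. \<exists>T. ?tail i T"
  proof
    fix i :: nat
    obtain T where T: "\<And>t. T \<le> \<bar>t\<bar> \<Longrightarrow> \<bar>f t\<bar> \<le> 1 / real (Suc i) * (1 + \<bar>t\<bar> powr \<gamma>)"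
      using Omega_space_tail[OF f, of "1 / real (Suc i)"] by auto
    obtain T' :: nat where "T < T'" using reals_Archimedean2 by blast
    then show "\<exists>T. ?tail i T" by (intro exI[of _ T'] allI impI T) linarith
  qed
next
  assume tail: "\<forall>i. \<exists>T. ?tail i T"
  show "f \<in> Omega_space \<gamma>"
  proof (rule Omega_spaceI[OF cont])
    fix e :: real assume "0 < e"
    then obtain i where i: "1 / real (Suc i) < e" using nat_approx_posE by blast
    obtain T where T: "?tail i T" using tail by blast
    have "\<bar>f t\<bar> \<le> e * (1 + \<bar>t\<bar> powr \<gamma>)" if t: "real T + 1 \<le> \<bar>t\<bar>" for t
    proof -
      define p :: "nat \<Rightarrow> real" where "p n = of_int \<lfloor>2 ^ n * t\<rfloor> / 2 ^ n" for n
      have p: "p \<longlonglongrightarrow> t" unfolding p_def by (rule dyadic_floor_tendsto)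
      have "\<bar>f t\<bar> \<le> 1 / real (Suc i) * (1 + \<bar>t\<bar> powr \<gamma>)"
      proof (rule LIMSEQ_le)
        have "isCont f t" using cont by (simp add: continuous_on_eq_continuous_at)
        then show "(\<lambda>n. \<bar>f (p n)\<bar>) \<longlonglongrightarrow> \<bar>f t\<bar>"
          using p by (intro tendsto_intros isCont_tendsto_compose[of t f])
        show "(\<lambda>n. 1 / real (Suc i) * (1 + \<bar>p n\<bar> powr \<gamma>)) \<longlonglongrightarrow> 1 / real (Suc i) * (1 + \<bar>t\<bar> powr \<gamma>)"
          using p t by (intro tendsto_intros) auto
        have "real T \<le> \<bar>p n\<bar>" for n
        proof -
          have "\<bar>p n - t\<bar> \<le> 1 / 2 ^ n" unfolding p_def by (rule dyadic_floor_near)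
          also have "\<dots> \<le> 1" by simp
          finally show ?thesis using t by linarith
        qed
        then show "\<exists>N. \<forall>n\<ge>N. \<bar>f (p n)\<bar> \<le> 1 / real (Suc i) * (1 + \<bar>p n\<bar> powr \<gamma>)"
          using T unfolding p_def by blast
      qed
      also have "\<dots> \<le> e * (1 + \<bar>t\<bar> powr \<gamma>)" using i by (intro mult_right_mono) auto
      finally show ?thesis .
    qed
    then show "\<exists>T. \<forall>t. T \<le> \<bar>t\<bar> \<longrightarrow> \<bar>f t\<bar> \<le> e * (1 + \<bar>t\<bar> powr \<gamma>)" by blast
  qed
qed

lemma sets_paths_in_Omega_space:
  assumes [measurable]: "\<And>t. Y t \<in> borel_measurable M" and cont: "continuous_paths M Y" and \<gamma>: "0 < \<gamma>"
  shows "{\<omega> \<in> space M. (\<lambda>t. Y t \<omega>) \<in> Omega_space \<gamma>} \<in> sets M"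
proof -
  have "{\<omega> \<in> space M. (\<lambda>t. Y t \<omega>) \<in> Omega_space \<gamma>} = {\<omega> \<in> space M. \<forall>i. \<exists>T. \<forall>n. \<forall>j::int.
      real T \<le> \<bar>of_int j / 2 ^ n\<bar> \<longrightarrow> \<bar>Y (of_int j / 2 ^ n) \<omega>\<bar> \<le> 1 / real (Suc i) * (1 + \<bar>of_int j / 2 ^ n\<bar> powr \<gamma>)}"
    using cont Omega_space_iff_dyadic[OF _ \<gamma>] unfolding continuous_paths_def by blast
  also have "\<dots> \<in> sets M" by measurable
  finally show ?thesis .
qed

lemma lipschitz_in_coordinates_interp:
  assumes f: "lipschitz_wrt (Omega_space \<gamma>) (Omega_dist \<gamma>) L f" and L: "0 \<le> L"
  shows "lipschitz_in_coordinates (grid n) L (\<lambda>y. f (interp n y))"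
  unfolding lipschitz_in_coordinates_def
proof (intro conjI allI L finite_grid)
  fix y z
  have "\<bar>f (interp n y) - f (interp n z)\<bar> \<le> L * Omega_dist \<gamma> (interp n y) (interp n z)"
    using f by (simp add: lipschitz_wrt_def interp_in_Omega)
  also have "\<dots> \<le> L * (\<Sum>j\<in>grid n. \<bar>y j - z j\<bar>)"
    using L by (intro mult_left_mono Omega_dist_interp)
  finally show "\<bar>f (interp n y) - f (interp n z)\<bar> \<le> L * (\<Sum>j\<in>grid n. \<bar>y j - z j\<bar>)" .
qed

lemma borel_measurable_interp_sample:
  assumes f: "lipschitz_wrt (Omega_space \<gamma>) (Omega_dist \<gamma>) L f" and L: "0 \<le> L"
    and Y: "\<And>t. Y t \<in> borel_measurable M"
  shows "(\<lambda>\<omega>. f (interpolate n (\<lambda>t. Y t \<omega>))) \<in> borel_measurable M"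
  by (rule borel_measurable_lipschitz_in_coordinates[OF lipschitz_in_coordinates_interp[OF f L]])
    (simp add: sample_def Y)

text \<open>For open \<open>U\<close> a Lipschitz function \<open>h\<close> is positive exactly on \<open>U\<close>. Its value at the path is the limit of
  its values at the interpolants, which depend on finitely many path values and are measurable.\<close>

lemma random_element_Omega:
  assumes Y[measurable]: "\<And>t. Y t \<in> borel_measurable M" and cont: "continuous_paths M Y" and \<gamma>: "0 < \<gamma>"
    and ae: "AE \<omega> in M. (\<lambda>t. Y t \<omega>) \<in> Omega_space \<gamma>"
  shows "random_element M (Omega_topology \<gamma>) (\<lambda>\<omega> t. Y t \<omega>)"
  unfolding random_element_def
proof (intro conjI allI impI)
  show "AE \<omega> in M. (\<lambda>t. Y t \<omega>) \<in> topspace (Omega_topology \<gamma>)" using ae \<gamma> by simp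
  fix U assume U: "openin (Omega_topology \<gamma>) U"
  interpret Metric_space "Omega_space \<gamma>" "Omega_dist \<gamma>" using \<gamma> by (intro Metric_space_Omega) simp
  define A where "A = {\<omega> \<in> space M. (\<lambda>t. Y t \<omega>) \<in> Omega_space \<gamma>}"
  have A[measurable]: "A \<in> sets M" unfolding A_def by (rule sets_paths_in_Omega_space[OF Y cont \<gamma>])
  define h where "h = inf_convolution (Omega_space \<gamma>) (Omega_dist \<gamma>) 1 (indicat_real U)"
  have h: "lipschitz_wrt (Omega_space \<gamma>) (Omega_dist \<gamma>) 1 h"
    unfolding h_def by (rule lipschitz_inf_convolution[where a = 0]) auto
  have U_sub: "U \<subseteq> Omega_space \<gamma>" using openin_subset[OF U] \<gamma> by simp
  have pos: "0 < h f \<longleftrightarrow> f \<in> U" if f: "f \<in> Omega_space \<gamma>" for f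
  proof
    assume "f \<in> U"
    then obtain r where r: "0 < r" "mball f r \<subseteq> U"
      using U unfolding Omega_topology_def openin_mtopology by blast
    have "min 1 (0 + 1 * r) \<le> h f"
      unfolding h_def by (rule inf_convolution_ge_min) (use r f in auto)
    then show "0 < h f" using r(1) by simp
  next
    assume "0 < h f"
    moreover have "h f \<le> indicat_real U f"
      unfolding h_def by (rule inf_convolution_le[where a = 0]) (use f in auto)
    ultimately show "f \<in> U" by (cases "f \<in> U") auto
  qed
  have [measurable]: "(\<lambda>\<omega>. h (interpolate n (\<lambda>t. Y t \<omega>))) \<in> borel_measurable M" for n
    by (rule borel_measurable_interp_sample[OF h _ Y]) simp
  have [measurable]: "(\<lambda>\<omega>. indicat_real A \<omega> * h (\<lambda>t. Y t \<omega>)) \<in> borel_measurable M"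
  proof (rule borel_measurable_LIMSEQ_real)
    fix \<omega> assume \<omega>: "\<omega> \<in> space M"
    show "(\<lambda>n. indicat_real A \<omega> * h (interpolate n (\<lambda>t. Y t \<omega>))) \<longlonglongrightarrow> indicat_real A \<omega> * h (\<lambda>t. Y t \<omega>)"
    proof (cases "\<omega> \<in> A")
      case True
      then have f: "(\<lambda>t. Y t \<omega>) \<in> Omega_space \<gamma>" by (simp add: A_def)
      have "(\<lambda>n. h (interpolate n (\<lambda>t. Y t \<omega>))) \<longlonglongrightarrow> h (\<lambda>t. Y t \<omega>)"
      proof (rule LIM_zero_cancel, rule tendsto_rabs_zero_cancel,
          rule tendsto_sandwich[where f = "\<lambda>_. 0"
            and h = "\<lambda>n. Omega_dist \<gamma> (\<lambda>t. Y t \<omega>) (interpolate n (\<lambda>t. Y t \<omega>))"])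
        show "(\<lambda>n. Omega_dist \<gamma> (\<lambda>t. Y t \<omega>) (interpolate n (\<lambda>t. Y t \<omega>))) \<longlonglongrightarrow> 0"
          using \<gamma> by (intro Omega_dist_interp_sample_tendsto f) simp
        show "\<forall>\<^sub>F n in sequentially. \<bar>h (interpolate n (\<lambda>t. Y t \<omega>)) - h (\<lambda>t. Y t \<omega>)\<bar>
            \<le> Omega_dist \<gamma> (\<lambda>t. Y t \<omega>) (interpolate n (\<lambda>t. Y t \<omega>))"
          using h f by (intro always_eventually allI, subst abs_minus_commute)
            (simp add: lipschitz_wrt_def interp_in_Omega)
      qed auto
      then show ?thesis using True by simp
    qed simp
  qed measurable
  have "{\<omega> \<in> space M. (\<lambda>t. Y t \<omega>) \<in> U} = {\<omega> \<in> space M. 0 < indicat_real A \<omega> * h (\<lambda>t. Y t \<omega>)}"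
    using pos U_sub by (auto simp: A_def indicator_def)
  also have "\<dots> \<in> sets M" by measurable
  finally show "{\<omega> \<in> space M. (\<lambda>t. Y t \<omega>) \<in> U} \<in> sets M" .
qed

lemma (in prob_space) centered_gaussian_process_square_integrable:
  assumes Y: "gaussian_process M Y" "centered M Y"
  shows "Y t \<in> borel_measurable M" "integrable M (Y t)"
    and "integrable M (\<lambda>\<omega>. Y s \<omega> * Y t \<omega>)"
    and "gaussian_rv M (\<lambda>\<omega>. Y t \<omega> - Y s \<omega>)" "expectation (\<lambda>\<omega>. Y t \<omega> - Y s \<omega>) = 0"
proof -
  have G: "gaussian_rv M (\<lambda>\<omega>. \<Sum>j\<in>J. a j * Y (\<tau> j) \<omega>)" if "finite J" for J :: "nat set" and a \<tau>
    using Y(1) that by (rule gaussian_process_sum)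
  have Yg: "gaussian_rv M (Y t)" for t
    using G[of "{0}" "\<lambda>_. 1" "\<lambda>_. t"] by simp
  have Y0: "expectation (Y t) = 0" for t using Y(2) by (simp add: centered_def)
  show meas: "Y t \<in> borel_measurable M" for t using Yg by (simp add: gaussian_rv_def)
  have sq: "integrable M (\<lambda>\<omega>. (Y t \<omega>)\<^sup>2)" for t using Yg Y0 by (rule centered_gaussian_square_integrable)
  show int: "integrable M (Y t)" for t using meas sq by (rule square_integrable_imp_integrable)
  show "gaussian_rv M (\<lambda>\<omega>. Y t \<omega> - Y s \<omega>)"
    using G[of "{0, 1}" "\<lambda>j. if j = 0 then 1 else -1" "\<lambda>j. if j = 0 then t else s"] by simp
  show "expectation (\<lambda>\<omega>. Y t \<omega> - Y s \<omega>) = 0" using int Y0 by simp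
  show "integrable M (\<lambda>\<omega>. Y s \<omega> * Y t \<omega>)"
  proof (rule Bochner_Integration.integrable_bound)
    show "integrable M (\<lambda>\<omega>. (Y s \<omega>)\<^sup>2 + (Y t \<omega>)\<^sup>2)" by (intro Bochner_Integration.integrable_add sq)
    have "\<bar>x * y\<bar> \<le> x\<^sup>2 + y\<^sup>2" for x y :: real
    proof -
      have "2 * (\<bar>x\<bar> * \<bar>y\<bar>) \<le> x\<^sup>2 + y\<^sup>2" using sum_squares_bound[of "\<bar>x\<bar>" "\<bar>y\<bar>"] by simp
      moreover have "0 \<le> \<bar>x\<bar> * \<bar>y\<bar>" by simp
      ultimately show ?thesis unfolding abs_mult by linarith
    qed
    then show "AE \<omega> in M. norm (Y s \<omega> * Y t \<omega>) \<le> norm ((Y s \<omega>)\<^sup>2 + (Y t \<omega>)\<^sup>2)" by simp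
  qed (use meas in measurable)
qed

lemma centered_gaussian_vector_sample:
  assumes Y: "gaussian_process M Y" "centered M Y"
  shows "centered_gaussian_vector M (\<lambda>\<omega>. sample n (\<lambda>t. Y t \<omega>))"
    and "form_variance M (\<lambda>\<omega>. sample n (\<lambda>t. Y t \<omega>)) J a =
      (\<Sum>i\<in>J. \<Sum>j\<in>J. a i * a j * (LINT \<omega>|M. Y (of_int i / 2 ^ n) \<omega> * Y (of_int j / 2 ^ n) \<omega>))"
proof -
  interpret prob_space M using Y by (simp add: gaussian_process_def)
  note int = centered_gaussian_process_square_integrable[OF Y]
  have "expectation (Y t) = 0" for t using Y(2) by (simp add: centered_def)
  then show "centered_gaussian_vector M (\<lambda>\<omega>. sample n (\<lambda>t. Y t \<omega>))"
    unfolding centered_gaussian_vector_def sample_def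
    using gaussian_process_sum[OF Y(1)] int(2) prob_space_axioms
    by (auto simp: Bochner_Integration.integral_sum)
  show "form_variance M (\<lambda>\<omega>. sample n (\<lambda>t. Y t \<omega>)) J a =
      (\<Sum>i\<in>J. \<Sum>j\<in>J. a i * a j * expectation (\<lambda>\<omega>. Y (of_int i / 2 ^ n) \<omega> * Y (of_int j / 2 ^ n) \<omega>))"
  proof -
    have "(\<Sum>j\<in>J. a j * Y (of_int j / 2 ^ n) \<omega>)\<^sup>2 =
        (\<Sum>i\<in>J. \<Sum>j\<in>J. a i * a j * (Y (of_int i / 2 ^ n) \<omega> * Y (of_int j / 2 ^ n) \<omega>))" for \<omega>
      by (simp add: power2_eq_square sum_product mult_ac)
    then show ?thesis
      using int(3) by (simp add: form_variance_def sample_def Bochner_Integration.integral_sum)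
  qed
qed

text \<open>For a Lipschitz functional, replacing the paths by their interpolants of a high level changes the
  expectations by little, uniformly along the family and also in the limit. For the interpolants the
  expectations are those of Lipschitz functions of Gaussian vectors, and these converge with the covariances.\<close>

theorem gaussian_weak_convergence_Omega:
  fixes M :: "'a measure" and N :: "'b measure"
  assumes params: "0 \<le> K" "0 < b" "0 < \<theta>" "\<theta> < 1" "\<theta> ^ m \<le> 1 / 4" and \<gamma>: "0 < \<gamma>" "b < 2 powr \<gamma>"
    and Y: "\<forall>\<^sub>F c in F. gaussian_process M (Y c) \<and> centered M (Y c) \<and> dyadic_moment_bound M (Y c) m K b \<theta>"
    and B: "gaussian_process N B" "centered N B" "dyadic_moment_bound N B m K b \<theta>"
    and M: "prob_space M"
    and cov: "\<And>s t. ((\<lambda>c. (LINT \<omega>|M. Y c s \<omega> * Y c t \<omega>)) \<longlongrightarrow>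
      (LINT \<omega>|N. B s \<omega> * B t \<omega>)) F"
  shows "converges_in_distribution F (Omega_topology \<gamma>) M (\<lambda>c \<omega> t. Y c t \<omega>) N (\<lambda>\<omega> t. B t \<omega>)"
proof -
  interpret Metric_space "Omega_space \<gamma>" "Omega_dist \<gamma>" using \<gamma> by (intro Metric_space_Omega) simp
  have \<gamma>0: "0 \<le> \<gamma>" using \<gamma> by simp
  have random: "random_element P (Omega_topology \<gamma>) (\<lambda>\<omega> t. U t \<omega>)"
    if U: "dyadic_moment_bound P U m K b \<theta>" for P :: "'z measure" and U
    using U \<gamma> AE_in_Omega_space[OF params \<gamma>0 \<gamma>(2) U] by (intro random_element_Omega) (auto simp: dyadic_moment_bound_def)
  have N: "prob_space N" using B(3) by (simp add: dyadic_moment_bound_def)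
  have "converges_in_distribution F mtopology M (\<lambda>c \<omega> t. Y c t \<omega>) N (\<lambda>\<omega> t. B t \<omega>)"
  proof (rule converges_in_distribution_lipschitzI[OF M N])
    show "\<forall>\<^sub>F c in F. random_element M mtopology (\<lambda>\<omega> t. Y c t \<omega>)"
      using Y by eventually_elim (simp add: random[unfolded Omega_topology_def])
    show "random_element N mtopology (\<lambda>\<omega> t. B t \<omega>)"
      using random[OF B(3)] by (simp add: Omega_topology_def)
    fix L0 K0 g
    assume g0: "lipschitz_wrt (Omega_space \<gamma>) (Omega_dist \<gamma>) L0 g" and gK0: "\<And>x. x \<in> Omega_space \<gamma> \<Longrightarrow> \<bar>g x\<bar> \<le> K0"
    define L where "L = \<bar>L0\<bar>"
    define C where "C = \<bar>K0\<bar>"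
    have L: "0 \<le> L" and C: "0 \<le> C" by (simp_all add: L_def C_def)
    have g: "lipschitz_wrt (Omega_space \<gamma>) (Omega_dist \<gamma>) L g"
      using g0 mult_right_mono[of L0 L, OF _ nonneg] unfolding lipschitz_wrt_def L_def
      by (meson abs_ge_self order_trans)
    have gC: "\<bar>g x\<bar> \<le> C" if "x \<in> Omega_space \<gamma>" for x using gK0[OF that] by (simp add: C_def)
    let ?I = "\<lambda>P U. LINT \<omega>:{\<omega> \<in> space P. (\<lambda>t. U t \<omega>) \<in> Omega_space \<gamma>}|P. g (\<lambda>t. U t \<omega>)"
    let ?J = "\<lambda>n P U. LINT \<omega>|P. g (interpolate n (\<lambda>t. U t \<omega>))"
    have close: "\<bar>(LINT \<omega>:{\<omega> \<in> space P. (\<lambda>t. U t \<omega>) \<in> Omega_space \<gamma>}|P. g (\<lambda>t. U t \<omega>)) -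
          (LINT \<omega>|P. g (interpolate n (\<lambda>t. U t \<omega>)))\<bar> \<le> L * r + 2 * C * r"
      if U: "dyadic_moment_bound P U m K b \<theta>" and r: "0 \<le> r" and E: "E \<in> sets P" "measure P E \<le> r"
        and near: "\<And>\<omega>. \<omega> \<in> space P - E \<Longrightarrow> (\<lambda>t. U t \<omega>) \<in> Omega_space \<gamma> \<Longrightarrow>
          Omega_dist \<gamma> (\<lambda>t. U t \<omega>) (interpolate n (\<lambda>t. U t \<omega>)) \<le> r"
      for P :: "'z measure" and U n r E
    proof -
      interpret prob_space P using U by (simp add: dyadic_moment_bound_def)
      define A where "A = {\<omega> \<in> space P. (\<lambda>t. U t \<omega>) \<in> Omega_space \<gamma>}"
      have int_g: "integrable P (\<lambda>\<omega>. indicator A \<omega> *\<^sub>R g (\<lambda>t. U t \<omega>))"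
        using integrable_random_element[OF prob_space_axioms random[OF U, unfolded Omega_topology_def]
            continuous_map_of_lipschitz[OF g], of C] gC
        by (simp add: set_integrable_def A_def)
      have U_meas: "U t \<in> borel_measurable P" for t using U by (simp add: dyadic_moment_bound_def)
      have int_E: "integrable P (indicat_real E)"
        using E(1) by (intro integrable_real_indicator) (simp_all add: emeasure_eq_measure)
      have int_i: "integrable P (\<lambda>\<omega>. g (interpolate n (\<lambda>t. U t \<omega>)))"
        using gC[OF interp_in_Omega]
        by (intro integrable_const_bound[where B = C] borel_measurable_interp_sample[OF g L U_meas]) auto
      have "\<bar>(LINT \<omega>|P. indicator A \<omega> *\<^sub>R g (\<lambda>t. U t \<omega>)) - (LINT \<omega>|P. g (interpolate n (\<lambda>t. U t \<omega>)))\<bar> =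
          \<bar>LINT \<omega>|P. indicator A \<omega> *\<^sub>R g (\<lambda>t. U t \<omega>) - g (interpolate n (\<lambda>t. U t \<omega>))\<bar>"
        using int_g int_i by simp
      also have "\<dots> \<le> (LINT \<omega>|P. \<bar>indicator A \<omega> *\<^sub>R g (\<lambda>t. U t \<omega>) - g (interpolate n (\<lambda>t. U t \<omega>))\<bar>)"
        by (rule integral_abs_bound)
      also have "\<dots> \<le> (LINT \<omega>|P. L * r + 2 * C * indicator E \<omega>)"
      proof (rule integral_mono_AE)
        show "integrable P (\<lambda>\<omega>. \<bar>indicator A \<omega> *\<^sub>R g (\<lambda>t. U t \<omega>) - g (interpolate n (\<lambda>t. U t \<omega>))\<bar>)"
          using int_g int_i by (intro integrable_abs Bochner_Integration.integrable_diff)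
        show "integrable P (\<lambda>\<omega>. L * r + 2 * C * indicator E \<omega>)" using int_E by simp
        show "AE \<omega> in P. \<bar>indicator A \<omega> *\<^sub>R g (\<lambda>t. U t \<omega>) - g (interpolate n (\<lambda>t. U t \<omega>))\<bar>
            \<le> L * r + 2 * C * indicator E \<omega>"
          using AE_in_Omega_space[OF params \<gamma>0 \<gamma>(2) U] AE_space
        proof eventually_elim
          case (elim \<omega>)
          then have A: "\<omega> \<in> A" by (simp add: A_def)
          show ?case
          proof (cases "\<omega> \<in> E")
            case True
            have "0 \<le> L * r" using L r by simp
            with True A gC[OF elim(1)] gC[OF interp_in_Omega, of n "sample n (\<lambda>t. U t \<omega>)"]
            show ?thesis by simp
          next
            case False
            have "\<bar>g (\<lambda>t. U t \<omega>) - g (interpolate n (\<lambda>t. U t \<omega>))\<bar> \<le>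
                L * Omega_dist \<gamma> (\<lambda>t. U t \<omega>) (interpolate n (\<lambda>t. U t \<omega>))"
              using g elim(1) by (simp add: lipschitz_wrt_def interp_in_Omega)
            also have "\<dots> \<le> L * r" using near[OF _ elim(1)] elim(2) False L by (intro mult_left_mono) auto
            finally show ?thesis using A False by simp
          qed
        qed
      qed
      also have "\<dots> = L * r + 2 * C * prob E" using int_E E(1) by (simp add: prob_space)
      also have "\<dots> \<le> L * r + 2 * C * r" using C E(2) by (intro add_left_mono mult_left_mono) auto
      finally show ?thesis by (simp add: set_lebesgue_integral_def A_def)
    qed
    show "((\<lambda>c. ?I M (Y c)) \<longlongrightarrow> ?I N B) F"
    proof (rule tendstoI)
      fix e :: real assume e: "0 < e"
      define D where "D = L + 2 * C + 1"
      have D: "0 < D" using L C by (simp add: D_def)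
      define r where "r = e / 4 / D"
      have r: "0 < r" using e D by (simp add: r_def)
      have "D * r = e / 4" using D by (simp add: r_def)
      then have re: "L * r + 2 * C * r < e / 4" using r by (simp add: D_def algebra_simps)
      obtain n1 where n1: "\<forall>n\<ge>n1. \<forall>(M :: 'a measure) Y. dyadic_moment_bound M Y m K b \<theta> \<longrightarrow>
        (\<exists>E\<in>sets M. measure M E \<le> r \<and> (\<forall>\<omega>\<in>space M - E. (\<lambda>t. Y t \<omega>) \<in> Omega_space \<gamma> \<longrightarrow>
          Omega_dist \<gamma> (\<lambda>t. Y t \<omega>) (interpolate n (\<lambda>t. Y t \<omega>)) \<le> r))"
        using interpolation_event[OF params \<gamma>0 \<gamma>(2) r] by (elim exE)
      obtain n2 where n2: "\<forall>n\<ge>n2. \<forall>(M :: 'b measure) Y. dyadic_moment_bound M Y m K b \<theta> \<longrightarrow>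
        (\<exists>E\<in>sets M. measure M E \<le> r \<and> (\<forall>\<omega>\<in>space M - E. (\<lambda>t. Y t \<omega>) \<in> Omega_space \<gamma> \<longrightarrow>
          Omega_dist \<gamma> (\<lambda>t. Y t \<omega>) (interpolate n (\<lambda>t. Y t \<omega>)) \<le> r))"
        using interpolation_event[OF params \<gamma>0 \<gamma>(2) r] by (elim exE)
      define n where "n = max n1 n2"
      have closeB: "\<bar>?I N B - ?J n N B\<bar> < e / 4"
      proof -
        obtain E where "E \<in> sets N" "measure N E \<le> r" "\<forall>\<omega>\<in>space N - E. (\<lambda>t. B t \<omega>) \<in> Omega_space \<gamma> \<longrightarrow>
          Omega_dist \<gamma> (\<lambda>t. B t \<omega>) (interpolate n (\<lambda>t. B t \<omega>)) \<le> r"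
          using n2[rule_format, OF _ B(3), of n] by (auto simp: n_def)
        then have "\<bar>?I N B - ?J n N B\<bar> \<le> L * r + 2 * C * r" using B(3) r by (intro close) auto
        then show ?thesis using re by simp
      qed
      have "((\<lambda>c. ?J n M (Y c)) \<longlongrightarrow> ?J n N B) F"
      proof (rule gaussian_vector_expectation_tendsto[where V = "\<lambda>c \<omega>. sample n (\<lambda>t. Y c t \<omega>)"
            and W = "\<lambda>\<omega>. sample n (\<lambda>t. B t \<omega>)" and H = "\<lambda>y. g (interp n y)"])
        show "\<forall>\<^sub>F c in F. centered_gaussian_vector M (\<lambda>\<omega>. sample n (\<lambda>t. Y c t \<omega>))"
          using Y by eventually_elim (simp add: centered_gaussian_vector_sample)
        show "centered_gaussian_vector N (\<lambda>\<omega>. sample n (\<lambda>t. B t \<omega>))"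
          using B by (simp add: centered_gaussian_vector_sample)
        show "lipschitz_in_coordinates (grid n) L (\<lambda>y. g (interp n y))"
          by (rule lipschitz_in_coordinates_interp[OF g L])
        show "\<bar>g (interp n y)\<bar> \<le> C" for y by (rule gC[OF interp_in_Omega])
        fix J and a :: "int \<Rightarrow> real"
        let ?t = "\<lambda>i :: int. of_int i / 2 ^ n :: real"
        have "((\<lambda>c. \<Sum>i\<in>J. \<Sum>j\<in>J. a i * a j * (LINT \<omega>|M. Y c (?t i) \<omega> * Y c (?t j) \<omega>)) \<longlongrightarrow>
            form_variance N (\<lambda>\<omega>. sample n (\<lambda>t. B t \<omega>)) J a) F"
          unfolding centered_gaussian_vector_sample(2)[OF B(1,2)] by (intro tendsto_intros cov)
        moreover have "\<forall>\<^sub>F c in F. (\<Sum>i\<in>J. \<Sum>j\<in>J. a i * a j * (LINT \<omega>|M. Y c (?t i) \<omega> * Y c (?t j) \<omega>)) =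
            form_variance M (\<lambda>\<omega>. sample n (\<lambda>t. Y c t \<omega>)) J a"
          using Y by eventually_elim (simp add: centered_gaussian_vector_sample(2))
        ultimately show "((\<lambda>c. form_variance M (\<lambda>\<omega>. sample n (\<lambda>t. Y c t \<omega>)) J a) \<longlongrightarrow>
            form_variance N (\<lambda>\<omega>. sample n (\<lambda>t. B t \<omega>)) J a) F"
          by (rule Lim_transform_eventually)
      qed
      then have "\<forall>\<^sub>F c in F. dist (?J n M (Y c)) (?J n N B) < e / 4"
        using e by (intro tendstoD) auto
      with Y show "\<forall>\<^sub>F c in F. dist (?I M (Y c)) (?I N B) < e"
      proof eventually_elim
        case (elim c)
        then have Yc: "dyadic_moment_bound M (Y c) m K b \<theta>" by simp
        obtain E where "E \<in> sets M" "measure M E \<le> r" "\<forall>\<omega>\<in>space M - E. (\<lambda>t. Y c t \<omega>) \<in> Omega_space \<gamma> \<longrightarrow>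
          Omega_dist \<gamma> (\<lambda>t. Y c t \<omega>) (interpolate n (\<lambda>t. Y c t \<omega>)) \<le> r"
          using n1[rule_format, OF _ Yc, of n] by (auto simp: n_def)
        then have "\<bar>?I M (Y c) - ?J n M (Y c)\<bar> \<le> L * r + 2 * C * r" using Yc r by (intro close) auto
        then show ?case using re closeB elim(2) unfolding dist_real_def by linarith
      qed
    qed
  qed
  then show ?thesis by (simp add: Omega_topology_def)
qed

section \<open>From weighted spaces to locally uniform convergence\<close>

lemma openin_uniform_on_compactsE:
  assumes U: "openin uniform_on_compacts_topology U" and f: "f \<in> U"
  obtains T e where "T > 0" "e > 0"
    "\<And>g. continuous_on UNIV g \<Longrightarrow> (\<And>t. t \<in> {-T..T} \<Longrightarrow> \<bar>g t - f t\<bar> < e) \<Longrightarrow> g \<in> U"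
proof -
  have "\<exists>T>0. \<exists>e>0. \<forall>g. continuous_on UNIV g \<and> (\<forall>t\<in>{-T..T}. \<bar>g t - f t\<bar> < e) \<longrightarrow> g \<in> U"
    using U f unfolding openin_uniform_on_compacts by blast
  then obtain T e where Te: "T > 0" "e > 0"
    "\<forall>g. continuous_on UNIV g \<and> (\<forall>t\<in>{-T..T}. \<bar>g t - f t\<bar> < e) \<longrightarrow> g \<in> U"
    by (elim exE conjE)
  show ?thesis
  proof (rule that[OF Te(1,2)])
    fix g assume "continuous_on UNIV g" "\<And>t. t \<in> {-T..T} \<Longrightarrow> \<bar>g t - f t\<bar> < e"
    then show "g \<in> U" using Te(3)[rule_format, of g] by blast
  qed
qed

lemma open_uniform_on_compacts_Int_Omega:
  assumes U: "openin uniform_on_compacts_topology U" and \<gamma>: "0 \<le> \<gamma>"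
  shows "openin (Omega_topology \<gamma>) (U \<inter> Omega_space \<gamma>)"
proof -
  interpret Metric_space "Omega_space \<gamma>" "Omega_dist \<gamma>" using \<gamma> by (rule Metric_space_Omega)
  have "\<exists>r>0. mball f r \<subseteq> U \<inter> Omega_space \<gamma>" if f: "f \<in> U" "f \<in> Omega_space \<gamma>" for f
  proof -
    from U f(1) show ?thesis
    proof (rule openin_uniform_on_compactsE)
      fix T e :: real assume Te: "T > 0" "e > 0"
        "\<And>g. continuous_on UNIV g \<Longrightarrow> (\<And>t. t \<in> {-T..T} \<Longrightarrow> \<bar>g t - f t\<bar> < e) \<Longrightarrow> g \<in> U"
    define w where "w = 1 + T powr \<gamma>"
    have w: "0 < w" by (simp add: w_def add_pos_nonneg)
    have "g \<in> U" if g: "g \<in> mball f (e / w)" for g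
    proof (rule Te(3))
      have g': "g \<in> Omega_space \<gamma>" "Omega_dist \<gamma> f g < e / w" using g by auto
      then show "continuous_on UNIV g" by (simp add: Omega_space_def)
      fix t assume t: "t \<in> {-T..T}"
      have "\<bar>g t - f t\<bar> \<le> Omega_dist \<gamma> f g * (1 + \<bar>t\<bar> powr \<gamma>)"
        using Omega_dist_ge[OF f(2) g'(1) \<gamma>, of t] by (simp add: abs_minus_commute)
      also have "\<dots> \<le> Omega_dist \<gamma> f g * w"
        unfolding w_def using t \<gamma> by (intro mult_left_mono add_left_mono powr_mono2) auto
      also have "\<dots> < e" using g'(2) w by (simp add: pos_less_divide_eq)
      finally show "\<bar>g t - f t\<bar> < e" .
    qed
    then show ?thesis using Te(2) w by (intro exI[of _ "e / w"]) auto
    qed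
  qed
  then show ?thesis unfolding Omega_topology_def openin_mtopology by blast
qed

text \<open>Constant outside \<open>[-n, n]\<close>: this maps arbitrary continuous paths to bounded ones, which lie in
  every weighted space of positive exponent.\<close>

definition clamp_path :: "nat \<Rightarrow> (real \<Rightarrow> 'b) \<Rightarrow> real \<Rightarrow> 'b" where
  "clamp_path n f t = f (max (- real n) (min (real n) t))"

lemma clamp_path_eq: "\<bar>t\<bar> \<le> real n \<Longrightarrow> clamp_path n f t = f t"
proof -
  assume "\<bar>t\<bar> \<le> real n"
  then have "max (- real n) (min (real n) t) = t" by linarith
  then show ?thesis by (simp add: clamp_path_def)
qed

lemma continuous_on_clamp_path:
  assumes "continuous_on UNIV f" shows "continuous_on UNIV (clamp_path n f)"
  unfolding clamp_path_def
  by (intro continuous_on_compose2[OF assms] continuous_on_max continuous_on_min continuous_on_const continuous_on_id) simp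

lemma clamp_path_in_Omega:
  assumes cont: "continuous_on UNIV f" and \<gamma>: "0 < \<gamma>"
  shows "clamp_path n f \<in> Omega_space \<gamma>"
proof (rule Omega_spaceI[OF continuous_on_clamp_path[OF cont]])
  fix e :: real assume e: "0 < e"
  have "bounded (f ` {- real n..real n})"
    by (intro compact_imp_bounded compact_continuous_image continuous_on_subset[OF cont]) auto
  then obtain K where K: "\<And>t. t \<in> {- real n..real n} \<Longrightarrow> \<bar>f t\<bar> \<le> K"
    unfolding bounded_iff by (metis imageI real_norm_def)
  have bound: "\<bar>clamp_path n f t\<bar> \<le> K" for t
    unfolding clamp_path_def by (rule K) auto
  then have K0: "0 \<le> K" by (meson abs_ge_zero order_trans)
  show "\<exists>T. \<forall>t. T \<le> \<bar>t\<bar> \<longrightarrow> \<bar>clamp_path n f t\<bar> \<le> e * (1 + \<bar>t\<bar> powr \<gamma>)"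
  proof (intro exI[of _ "(K / e) powr (1 / \<gamma>)"] allI impI)
    fix t :: real assume t: "(K / e) powr (1 / \<gamma>) \<le> \<bar>t\<bar>"
    have "K / e = ((K / e) powr (1 / \<gamma>)) powr \<gamma>" using \<gamma> K0 e by (simp add: powr_powr)
    also have "\<dots> \<le> \<bar>t\<bar> powr \<gamma>" using t \<gamma> by (intro powr_mono2) auto
    finally have "K \<le> e * \<bar>t\<bar> powr \<gamma>" using e by (simp add: divide_le_eq mult.commute)
    also have "\<dots> \<le> e * (1 + \<bar>t\<bar> powr \<gamma>)" using e by (intro mult_left_mono) auto
    finally show "\<bar>clamp_path n f t\<bar> \<le> e * (1 + \<bar>t\<bar> powr \<gamma>)" using bound[of t] by linarith
  qed
qed

text \<open>The functions that stay in \<open>U\<close> under small perturbations on \<open>[-n, n]\<close> and arbitrary ones outside. Whether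
  \<open>f\<close> belongs to this set depends on \<open>f\<close> on \<open>[-n, n]\<close> only, so \<open>f\<close> may be clamped first.\<close>

definition inner_part :: "(real \<Rightarrow> real) set \<Rightarrow> nat \<Rightarrow> (real \<Rightarrow> real) set" where
  "inner_part U n = {f. continuous_on UNIV f \<and>
     (\<exists>r>0. \<forall>g. continuous_on UNIV g \<and> (\<forall>t\<in>{- real n..real n}. \<bar>g t - f t\<bar> < r) \<longrightarrow> g \<in> U)}"

lemma inner_partE:
  assumes "f \<in> inner_part U n"
  obtains r where "r > 0"
    "\<And>g. continuous_on UNIV g \<Longrightarrow> (\<And>t. t \<in> {- real n..real n} \<Longrightarrow> \<bar>g t - f t\<bar> < r) \<Longrightarrow> g \<in> U"
proof -
  have "\<exists>r>0. \<forall>g. continuous_on UNIV g \<and> (\<forall>t\<in>{- real n..real n}. \<bar>g t - f t\<bar> < r) \<longrightarrow> g \<in> U"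
    using assms by (simp add: inner_part_def)
  then obtain r where r: "r > 0"
    "\<forall>g. continuous_on UNIV g \<and> (\<forall>t\<in>{- real n..real n}. \<bar>g t - f t\<bar> < r) \<longrightarrow> g \<in> U"
    by (elim exE conjE)
  show ?thesis
  proof (rule that[OF r(1)])
    fix g assume "continuous_on UNIV g" "\<And>t. t \<in> {- real n..real n} \<Longrightarrow> \<bar>g t - f t\<bar> < r"
    then show "g \<in> U" using r(2)[rule_format, of g] by blast
  qed
qed

lemma inner_partI:
  assumes "continuous_on UNIV f" "r > 0"
    "\<And>g. continuous_on UNIV g \<Longrightarrow> (\<And>t. t \<in> {- real n..real n} \<Longrightarrow> \<bar>g t - f t\<bar> < r) \<Longrightarrow> g \<in> U"
  shows "f \<in> inner_part U n"
  unfolding inner_part_def using assms by (intro CollectI conjI exI[of _ r] allI impI) simp_all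

lemma inner_part_open:
  assumes "0 < n"
  shows "openin uniform_on_compacts_topology (inner_part U n)"
  unfolding openin_uniform_on_compacts
proof (intro conjI ballI)
  fix f assume "f \<in> inner_part U n"
  then show "\<exists>T>0. \<exists>e>0. \<forall>g. continuous_on UNIV g \<and> (\<forall>t\<in>{-T..T}. \<bar>g t - f t\<bar> < e) \<longrightarrow> g \<in> inner_part U n"
  proof (rule inner_partE)
    fix r :: real assume r: "r > 0"
      "\<And>g. continuous_on UNIV g \<Longrightarrow> (\<And>t. t \<in> {- real n..real n} \<Longrightarrow> \<bar>g t - f t\<bar> < r) \<Longrightarrow> g \<in> U"
    have "g \<in> inner_part U n" if g: "continuous_on UNIV g" "\<forall>t\<in>{- real n..real n}. \<bar>g t - f t\<bar> < r / 2" for g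
    proof (rule inner_partI[OF g(1) half_gt_zero[OF r(1)]])
      fix h assume h: "continuous_on UNIV h" "\<And>t. t \<in> {- real n..real n} \<Longrightarrow> \<bar>h t - g t\<bar> < r / 2"
      show "h \<in> U"
      proof (rule r(2)[OF h(1)])
        fix t assume t: "t \<in> {- real n..real n}"
        show "\<bar>h t - f t\<bar> < r" using h(2)[OF t] g(2)[rule_format, OF t] by linarith
      qed
    qed
    then show ?thesis
      using half_gt_zero[OF r(1)] assms by (intro exI[of _ "real n"] conjI exI[of _ "r / 2"] allI impI) auto
  qed
qed (auto simp: inner_part_def)

lemma mem_open_iff_inner_part:
  assumes U: "openin uniform_on_compacts_topology U" and f: "continuous_on UNIV f"
  shows "f \<in> U \<longleftrightarrow> (\<exists>n. clamp_path (Suc n) f \<in> inner_part U (Suc n))"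
proof
  assume "f \<in> U"
  with U show "\<exists>n. clamp_path (Suc n) f \<in> inner_part U (Suc n)"
  proof (rule openin_uniform_on_compactsE)
    fix T e :: real assume Te: "T > 0" "e > 0"
      "\<And>g. continuous_on UNIV g \<Longrightarrow> (\<And>t. t \<in> {-T..T} \<Longrightarrow> \<bar>g t - f t\<bar> < e) \<Longrightarrow> g \<in> U"
    obtain n :: nat where n: "T < n" using reals_Archimedean2 by blast
    have "clamp_path (Suc n) f \<in> inner_part U (Suc n)"
    proof (rule inner_partI[OF continuous_on_clamp_path[OF f] Te(2)])
      fix g assume g: "continuous_on UNIV g"
        "\<And>t. t \<in> {- real (Suc n)..real (Suc n)} \<Longrightarrow> \<bar>g t - clamp_path (Suc n) f t\<bar> < e"
      show "g \<in> U"
      proof (rule Te(3)[OF g(1)])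
        fix t assume t: "t \<in> {-T..T}"
        then have "\<bar>t\<bar> \<le> real (Suc n)" "t \<in> {- real (Suc n)..real (Suc n)}" using n by auto
        then show "\<bar>g t - f t\<bar> < e" using g(2)[of t] by (simp only: clamp_path_eq)
      qed
    qed
    then show ?thesis by (rule exI)
  qed
next
  assume "\<exists>n. clamp_path (Suc n) f \<in> inner_part U (Suc n)"
  then obtain n where "clamp_path (Suc n) f \<in> inner_part U (Suc n)" by (rule exE)
  then show "f \<in> U"
  proof (rule inner_partE)
    fix r :: real assume r: "r > 0" "\<And>g. continuous_on UNIV g \<Longrightarrow>
      (\<And>t. t \<in> {- real (Suc n)..real (Suc n)} \<Longrightarrow> \<bar>g t - clamp_path (Suc n) f t\<bar> < r) \<Longrightarrow> g \<in> U"
    show "f \<in> U"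
    proof (rule r(2)[OF f])
      fix t assume "t \<in> {- real (Suc n)..real (Suc n)}"
      then have "\<bar>t\<bar> \<le> real (Suc n)" by auto
      then show "\<bar>f t - clamp_path (Suc n) f t\<bar> < r"
        using clamp_path_eq[of t "Suc n" f] r(1) by simp
    qed
  qed
qed

text \<open>An arbitrary continuous path need not lie in a weighted space, but its clamped versions do; an open
  set is reached through the events that a clamped path lies in an inner part of the set.\<close>

lemma random_element_uniform_on_compacts:
  assumes Y: "\<And>t. Y t \<in> borel_measurable M" and cont: "continuous_paths M Y"
  shows "random_element M uniform_on_compacts_topology (\<lambda>\<omega> t. Y t \<omega>)"
  unfolding random_element_def
proof (intro conjI allI impI)
  have path: "continuous_on UNIV (\<lambda>t. Y t \<omega>)" if "\<omega> \<in> space M" for \<omega>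
    using cont that by (simp add: continuous_paths_def)
  show "AE \<omega> in M. (\<lambda>t. Y t \<omega>) \<in> topspace uniform_on_compacts_topology"
    by (rule AE_I2) (simp add: path)
  fix U assume U: "openin uniform_on_compacts_topology U"
  define Z where "Z n t \<omega> = clamp_path n (\<lambda>t. Y t \<omega>) t" for n t \<omega>
  have Z_Omega: "(\<lambda>t. Z n t \<omega>) \<in> Omega_space 1" if "\<omega> \<in> space M" for n \<omega>
    unfolding Z_def by (intro clamp_path_in_Omega path[OF that]) simp
  have "random_element M (Omega_topology 1) (\<lambda>\<omega> t. Z n t \<omega>)" for n
  proof (rule random_element_Omega)
    show "Z n t \<in> borel_measurable M" for t
      unfolding Z_def clamp_path_def using Y by simp
    show "continuous_paths M (Z n)"
      unfolding continuous_paths_def Z_def by (intro ballI continuous_on_clamp_path path)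
    show "AE \<omega> in M. (\<lambda>t. Z n t \<omega>) \<in> Omega_space 1" by (intro AE_I2 Z_Omega)
  qed simp
  moreover have "openin (Omega_topology 1) (inner_part U (Suc n) \<inter> Omega_space 1)" for n
    by (intro open_uniform_on_compacts_Int_Omega inner_part_open) auto
  ultimately have "{\<omega> \<in> space M. (\<lambda>t. Z (Suc n) t \<omega>) \<in> inner_part U (Suc n) \<inter> Omega_space 1} \<in> sets M" for n
    unfolding random_element_def by blast
  then have "(\<Union>n. {\<omega> \<in> space M. (\<lambda>t. Z (Suc n) t \<omega>) \<in> inner_part U (Suc n) \<inter> Omega_space 1}) \<in> sets M"
    by (intro sets.countable_UN) auto
  moreover have "{\<omega> \<in> space M. (\<lambda>t. Y t \<omega>) \<in> U} =
      (\<Union>n. {\<omega> \<in> space M. (\<lambda>t. Z (Suc n) t \<omega>) \<in> inner_part U (Suc n) \<inter> Omega_space 1})"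
  proof -
    have "(\<lambda>t. Y t \<omega>) \<in> U \<longleftrightarrow> (\<exists>n. (\<lambda>t. Z (Suc n) t \<omega>) \<in> inner_part U (Suc n))" if "\<omega> \<in> space M" for \<omega>
      using mem_open_iff_inner_part[OF U path[OF that]] by (simp add: Z_def)
    then show ?thesis using Z_Omega by auto
  qed
  ultimately show "{\<omega> \<in> space M. (\<lambda>t. Y t \<omega>) \<in> U} \<in> sets M" by simp
qed

text \<open>The inclusion of a weighted space into the space of continuous functions is continuous, so every
  test functional for locally uniform convergence restricts to one for the weighted space; almost all
  paths lie there.\<close>

theorem converges_uniformly_on_compacts_of_Omega:
  assumes \<gamma>: "0 < \<gamma>"
    and conv: "converges_in_distribution F (Omega_topology \<gamma>) M (\<lambda>c \<omega> t. Y c t \<omega>) N (\<lambda>\<omega> t. B t \<omega>)"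
    and Y: "\<forall>\<^sub>F c in F. continuous_paths M (Y c) \<and> (\<forall>t. Y c t \<in> borel_measurable M)"
    and B: "continuous_paths N B" "\<And>t. B t \<in> borel_measurable N"
  shows "converges_in_distribution F uniform_on_compacts_topology M (\<lambda>c \<omega> t. Y c t \<omega>) N (\<lambda>\<omega> t. B t \<omega>)"
  unfolding converges_in_distribution_def
proof (intro conjI allI impI)
  let ?C = "uniform_on_compacts_topology"
  show rY: "\<forall>\<^sub>F c in F. random_element M ?C (\<lambda>\<omega> t. Y c t \<omega>)"
    using Y by eventually_elim (simp add: random_element_uniform_on_compacts)
  show rB: "random_element N ?C (\<lambda>\<omega> t. B t \<omega>)"
    using B by (simp add: random_element_uniform_on_compacts)
  fix f assume "continuous_map ?C euclideanreal f \<and> bounded (f ` topspace ?C)"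
  then have f: "continuous_map ?C euclideanreal f" "bounded (f ` topspace ?C)" by auto
  have sub: "Omega_space \<gamma> \<subseteq> topspace ?C" by (auto simp: Omega_space_def)
  have f_Omega: "continuous_map (Omega_topology \<gamma>) euclideanreal f"
    unfolding continuous_map_def
  proof (intro conjI allI impI)
    fix V :: "real set" assume "openin euclideanreal V"
    then have "openin ?C {x \<in> topspace ?C. f x \<in> V}"
      using f(1) by (rule openin_continuous_map_preimage[rotated])
    then have "openin (Omega_topology \<gamma>) ({x \<in> topspace ?C. f x \<in> V} \<inter> Omega_space \<gamma>)"
      using \<gamma> by (intro open_uniform_on_compacts_Int_Omega) auto
    moreover have "{x \<in> topspace ?C. f x \<in> V} \<inter> Omega_space \<gamma> = {x \<in> topspace (Omega_topology \<gamma>). f x \<in> V}"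
      using sub \<gamma> by auto
    ultimately show "openin (Omega_topology \<gamma>) {x \<in> topspace (Omega_topology \<gamma>). f x \<in> V}" by simp
  qed simp
  have "bounded (f ` topspace (Omega_topology \<gamma>))"
    using sub \<gamma> by (intro bounded_subset[OF f(2)]) auto
  then have lim: "((\<lambda>c. LINT \<omega>:{\<omega> \<in> space M. (\<lambda>t. Y c t \<omega>) \<in> topspace (Omega_topology \<gamma>)}|M. f (\<lambda>t. Y c t \<omega>)) \<longlongrightarrow>
      (LINT \<omega>:{\<omega> \<in> space N. (\<lambda>t. B t \<omega>) \<in> topspace (Omega_topology \<gamma>)}|N. f (\<lambda>t. B t \<omega>))) F"
    using conv f_Omega unfolding converges_in_distribution_def by blast
  have eq: "(LINT \<omega>:{\<omega> \<in> space P. U \<omega> \<in> topspace (Omega_topology \<gamma>)}|P. f (U \<omega>)) =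
      (LINT \<omega>:{\<omega> \<in> space P. U \<omega> \<in> topspace ?C}|P. f (U \<omega>))"
    if "random_element P (Omega_topology \<gamma>) U" "random_element P ?C U" for P :: "'z measure" and U
    unfolding set_lebesgue_integral_def
  proof (rule integral_cong_AE)
    have "AE \<omega> in P. U \<omega> \<in> topspace (Omega_topology \<gamma>)" "AE \<omega> in P. U \<omega> \<in> topspace ?C"
      using that by (simp_all add: random_element_def)
    then show "AE \<omega> in P. indicat_real {\<omega> \<in> space P. U \<omega> \<in> topspace (Omega_topology \<gamma>)} \<omega> *\<^sub>R f (U \<omega>) =
        indicat_real {\<omega> \<in> space P. U \<omega> \<in> topspace ?C} \<omega> *\<^sub>R f (U \<omega>)"
      by eventually_elim (simp add: indicator_def)
  qed (rule borel_measurable_random_element[OF that(1) f_Omega] borel_measurable_random_element[OF that(2) f(1)])+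
  have "random_element N (Omega_topology \<gamma>) (\<lambda>\<omega> t. B t \<omega>)"
    and "\<forall>\<^sub>F c in F. random_element M (Omega_topology \<gamma>) (\<lambda>\<omega> t. Y c t \<omega>)"
    using conv by (simp_all add: converges_in_distribution_def)
  note eqB = eq[OF this(1) rB] and rY' = this(2)
  from rY rY' have "\<forall>\<^sub>F c in F. (LINT \<omega>:{\<omega> \<in> space M. (\<lambda>t. Y c t \<omega>) \<in> topspace (Omega_topology \<gamma>)}|M. f (\<lambda>t. Y c t \<omega>)) =
      (LINT \<omega>:{\<omega> \<in> space M. (\<lambda>t. Y c t \<omega>) \<in> topspace ?C}|M. f (\<lambda>t. Y c t \<omega>))"
    by eventually_elim (rule eq)
  with lim show "((\<lambda>c. LINT \<omega>:{\<omega> \<in> space M. (\<lambda>t. Y c t \<omega>) \<in> topspace ?C}|M. f (\<lambda>t. Y c t \<omega>)) \<longlongrightarrow>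
      (LINT \<omega>:{\<omega> \<in> space N. (\<lambda>t. B t \<omega>) \<in> topspace ?C}|N. f (\<lambda>t. B t \<omega>))) F"
    unfolding eqB by (rule Lim_transform_eventually)
qed

section \<open>The variance function of a Gaussian process with stationary increments\<close>

locale gaussian_stationary_increments = prob_space M for M :: "'a measure" +
  fixes X :: "real \<Rightarrow> 'a \<Rightarrow> real"
  assumes gaussian: "gaussian_process M X" and centered: "centered M X"
    and stationary: "stationary_increments M X" and zero: "AE \<omega> in M. X 0 \<omega> = 0"
    and cont: "continuous_paths M X"
begin

abbreviation "\<sigma> \<equiv> std_dev M X"

lemmas X_measurable [measurable] = centered_gaussian_process_square_integrable(1)[OF gaussian centered]

lemma std_dev_nonneg: "0 \<le> \<sigma> t"
  by (simp add: std_dev_def)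

lemma std_dev_sq: "(\<sigma> t)\<^sup>2 = expectation (\<lambda>\<omega>. (X t \<omega>)\<^sup>2)"
  using centered by (simp add: std_dev_def centered_def)

lemma increment_variance: "expectation (\<lambda>\<omega>. (X t \<omega> - X s \<omega>)\<^sup>2) = (\<sigma> (t - s))\<^sup>2"
proof -
  let ?P = "Pi\<^sub>M UNIV (\<lambda>_ :: real. borel :: real measure)"
  have meas: "(\<lambda>\<omega> u. X (s + u) \<omega> - X s \<omega>) \<in> measurable M ?P" for s
    by (rule measurable_PiM_single') auto
  have sq: "(\<lambda>f. (f (t - s))\<^sup>2) \<in> borel_measurable ?P" by measurable
  have "expectation (\<lambda>\<omega>. (X t \<omega> - X s \<omega>)\<^sup>2) =
      (LINT f|distr M ?P (\<lambda>\<omega> u. X (s + u) \<omega> - X s \<omega>). (f (t - s))\<^sup>2)"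
    by (subst integral_distr[OF meas sq]) simp
  also have "distr M ?P (\<lambda>\<omega> u. X (s + u) \<omega> - X s \<omega>) = distr M ?P (\<lambda>\<omega> u. X (0 + u) \<omega> - X 0 \<omega>)"
    using stationary by (simp add: stationary_increments_def)
  also have "(LINT f|\<dots>. (f (t - s))\<^sup>2) = expectation (\<lambda>\<omega>. (X (t - s) \<omega> - X 0 \<omega>)\<^sup>2)"
    by (subst integral_distr[OF meas sq]) simp
  also have "\<dots> = expectation (\<lambda>\<omega>. (X (t - s) \<omega>)\<^sup>2)"
    using zero by (intro integral_cong_AE) auto
  finally show ?thesis by (simp add: std_dev_sq)
qed

lemma std_dev_0: "\<sigma> 0 = 0"
  using increment_variance[of 0 0] by simp

lemma std_dev_minus: "\<sigma> (- t) = \<sigma> t"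
proof -
  have "(\<sigma> (- t))\<^sup>2 = (\<sigma> t)\<^sup>2"
    using increment_variance[of 0 t] increment_variance[of t 0] by (simp add: power2_commute)
  then show ?thesis using std_dev_nonneg by (simp add: power2_eq_iff_nonneg)
qed

lemma square_integrable: "integrable M (\<lambda>\<omega>. (X t \<omega>)\<^sup>2)"
  using centered_gaussian_process_square_integrable(3)[OF gaussian centered, of t t]
  by (simp add: power2_eq_square)

lemma expectation_product: "expectation (\<lambda>\<omega>. X s \<omega> * X t \<omega>) = ((\<sigma> s)\<^sup>2 + (\<sigma> t)\<^sup>2 - (\<sigma> (t - s))\<^sup>2) / 2"
proof -
  have int: "integrable M (\<lambda>\<omega>. X s \<omega> * X t \<omega>)"
    by (rule centered_gaussian_process_square_integrable(3)[OF gaussian centered])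
  have "(\<sigma> (t - s))\<^sup>2 = expectation (\<lambda>\<omega>. (X s \<omega>)\<^sup>2 + (X t \<omega>)\<^sup>2 - 2 * (X s \<omega> * X t \<omega>))"
    unfolding increment_variance[symmetric] by (simp add: power2_diff algebra_simps)
  also have "\<dots> = (\<sigma> s)\<^sup>2 + (\<sigma> t)\<^sup>2 - 2 * expectation (\<lambda>\<omega>. X s \<omega> * X t \<omega>)"
    using int square_integrable by (simp add: std_dev_sq)
  finally show ?thesis by simp
qed

text \<open>Continuity of paths passes by dominated convergence to \<open>expectation (\<lambda>\<omega>. cos (X t \<omega>)) = exp (- (\<sigma> t)\<^sup>2 / 2)\<close>,
  from which \<open>\<sigma> t\<close> can be read off.\<close>

lemma continuous_std_dev: "continuous_on UNIV \<sigma>"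
proof -
  have cos: "expectation (\<lambda>\<omega>. cos (X t \<omega>)) = exp (- (\<sigma> t)\<^sup>2 / 2)" for t
  proof -
    have "gaussian_rv M (\<lambda>\<omega>. \<Sum>j\<in>{0 :: nat}. 1 * X t \<omega>)"
      using gaussian_process_sum[OF gaussian, of "{0 :: nat}" "\<lambda>_. 1" "\<lambda>_. t"] by simp
    moreover have "expectation (X t) = 0" using centered by (simp add: centered_def)
    ultimately show ?thesis
      using centered_gaussian_expectation_cos[of "X t" 0] by (simp add: std_dev_sq)
  qed
  have "continuous_on UNIV (\<lambda>t. expectation (\<lambda>\<omega>. cos (X t \<omega>)))"
  proof (rule continuous_on_sequentiallyI)
    fix u :: "nat \<Rightarrow> real" and a assume u: "u \<longlonglongrightarrow> a"
    show "(\<lambda>n. expectation (\<lambda>\<omega>. cos (X (u n) \<omega>))) \<longlonglongrightarrow> expectation (\<lambda>\<omega>. cos (X a \<omega>))"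
    proof (rule integral_dominated_convergence[where w = "\<lambda>_. 1"])
      show "AE \<omega> in M. (\<lambda>n. cos (X (u n) \<omega>)) \<longlonglongrightarrow> cos (X a \<omega>)"
      proof (rule AE_I2)
        fix \<omega> assume "\<omega> \<in> space M"
        then have "isCont (\<lambda>t. X t \<omega>) a"
          using cont by (simp add: continuous_paths_def continuous_on_eq_continuous_at)
        then show "(\<lambda>n. cos (X (u n) \<omega>)) \<longlonglongrightarrow> cos (X a \<omega>)"
          using u by (intro tendsto_cos isCont_tendsto_compose[of a "\<lambda>t. X t \<omega>"])
      qed
    qed auto
  qed
  then have "continuous_on UNIV (\<lambda>t. sqrt (- 2 * ln (expectation (\<lambda>\<omega>. cos (X t \<omega>)))))"
    by (intro continuous_intros) (auto simp: cos)
  then show ?thesis using std_dev_nonneg by (simp add: cos)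
qed

text \<open>The triangle inequality for standard deviations, for two increments of length \<open>x\<close>. It bounds the growth
  of \<open>\<sigma>\<close> where regular variation says nothing: at intermediate scales, and at all large scales if nothing is assumed
  at infinity.\<close>

lemma std_dev_double: "\<sigma> (2 * x) \<le> 2 * \<sigma> x"
proof (rule power2_le_imp_le)
  have sq: "integrable M (\<lambda>\<omega>. (X (2 * x) \<omega> - X x \<omega>)\<^sup>2)"
    by (intro centered_gaussian_square_integrable centered_gaussian_process_square_integrable[OF gaussian centered])
  have le: "y\<^sup>2 \<le> 2 * (y - z)\<^sup>2 + 2 * z\<^sup>2" for y z :: real
    using zero_le_power2[of "y - 2 * z"] by (simp add: power2_eq_square algebra_simps)
  have "(\<sigma> (2 * x))\<^sup>2 \<le> expectation (\<lambda>\<omega>. 2 * (X (2 * x) \<omega> - X x \<omega>)\<^sup>2 + 2 * (X x \<omega>)\<^sup>2)"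
    unfolding std_dev_sq using sq square_integrable by (intro integral_mono le) auto
  also have "\<dots> = 2 * (\<sigma> (2 * x - x))\<^sup>2 + 2 * (\<sigma> x)\<^sup>2"
    using sq square_integrable by (simp add: increment_variance std_dev_sq)
  also have "\<dots> = (2 * \<sigma> x)\<^sup>2" by (simp add: power_mult_distrib)
  finally show "(\<sigma> (2 * x))\<^sup>2 \<le> (2 * \<sigma> x)\<^sup>2" .
qed (simp add: std_dev_nonneg)

end

lemma dyadic_moment_boundI:
  assumes Y: "gaussian_process M Y" "centered M Y" "continuous_paths M Y" "AE \<omega> in M. Y 0 \<omega> = 0"
    and C: "0 \<le> C"
    and var: "\<And>k n s. (LINT \<omega>|M. (Y (s + 2 ^ k / 2 ^ n) \<omega> - Y s \<omega>)\<^sup>2) \<le> (C * (b ^ k * \<theta> ^ n))\<^sup>2"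
  shows "dyadic_moment_bound M Y m (gaussian_moment m * C ^ (2 * m)) b \<theta>"
proof -
  interpret prob_space M using Y by (simp add: gaussian_process_def)
  note G = centered_gaussian_process_square_integrable(4,5)[OF Y(1,2)]
  have "expectation (\<lambda>\<omega>. (Y (s + 2 ^ k / 2 ^ n) \<omega> - Y s \<omega>) ^ (2 * m)) \<le>
      gaussian_moment m * C ^ (2 * m) * (b ^ k * \<theta> ^ n) ^ (2 * m)" for k n s
  proof -
    have "expectation (\<lambda>\<omega>. (Y (s + 2 ^ k / 2 ^ n) \<omega> - Y s \<omega>) ^ (2 * m)) =
        gaussian_moment m * expectation (\<lambda>\<omega>. (Y (s + 2 ^ k / 2 ^ n) \<omega> - Y s \<omega>)\<^sup>2) ^ m"
      by (rule centered_gaussian_even_moment(2)[OF G])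
    also have "\<dots> \<le> gaussian_moment m * ((C * (b ^ k * \<theta> ^ n))\<^sup>2) ^ m"
      using gaussian_moment_nonneg by (intro mult_left_mono power_mono var) auto
    also have "((C * (b ^ k * \<theta> ^ n))\<^sup>2) ^ m = C ^ (2 * m) * (b ^ k * \<theta> ^ n) ^ (2 * m)"
      by (subst power_mult[symmetric]) (rule power_mult_distrib)
    finally show ?thesis by (simp add: mult.assoc)
  qed
  then show ?thesis
    using Y(3,4) prob_space_axioms centered_gaussian_process_square_integrable(1)[OF Y(1,2)]
      centered_gaussian_even_moment(1)[OF G, of _ _ m]
    unfolding dyadic_moment_bound_def by blast
qed

section \<open>Growth of regularly varying functions along dyadic scales\<close>

lemma eventually_le_of_ratio_tendsto:
  fixes f :: "real \<Rightarrow> real"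
  assumes lim: "((\<lambda>x. f (t * x) / f x) \<longlongrightarrow> L) F" and L: "0 < L" and nonneg: "\<forall>\<^sub>F x in F. 0 \<le> f x"
  shows "L < b \<Longrightarrow> \<forall>\<^sub>F x in F. f (t * x) \<le> b * f x"
    and "a < L \<Longrightarrow> \<forall>\<^sub>F x in F. a * f x \<le> f (t * x)"
    and "\<forall>\<^sub>F x in F. 0 < f x"
proof -
  show pos: "\<forall>\<^sub>F x in F. 0 < f x"
    using order_tendstoD(1)[OF lim L] nonneg
    by eventually_elim (metis division_ring_divide_zero less_irrefl order_le_less)
  show "\<forall>\<^sub>F x in F. f (t * x) \<le> b * f x" if "L < b"
    using order_tendstoD(2)[OF lim that] pos by eventually_elim (simp add: pos_divide_less_eq)
  show "\<forall>\<^sub>F x in F. a * f x \<le> f (t * x)" if "a < L"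
    using order_tendstoD(1)[OF lim that] pos by eventually_elim (simp add: pos_less_divide_eq)
qed

text \<open>Going down from \<open>x\<close>, every halving gains a factor \<open>\<theta>\<close>. Going up, every doubling costs a factor \<open>b\<close>, except at the
  scales between \<open>x0\<close> and \<open>x1\<close>, where it may cost a factor 2; there are boundedly many of them, however
  small \<open>x\<close> is. The condition \<open>1 \<le> b * \<theta>\<close> allows both cases to be written as \<open>b ^ k * \<theta> ^ n\<close>.\<close>

lemma dyadic_growth:
  fixes \<sigma> :: "real \<Rightarrow> real"
  assumes nonneg: "\<And>x. 0 \<le> \<sigma> x" and double: "\<And>x. 0 < x \<Longrightarrow> \<sigma> (2 * x) \<le> 2 * \<sigma> x"
    and x0: "0 < x0"
    and half: "\<And>x. 0 < x \<Longrightarrow> x \<le> x0 \<Longrightarrow> \<sigma> (x / 2) \<le> \<theta> * \<sigma> x"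
    and small: "\<And>x. 0 < x \<Longrightarrow> x \<le> x0 \<Longrightarrow> \<sigma> (2 * x) \<le> b * \<sigma> x"
    and large: "\<And>x. x1 \<le> x \<Longrightarrow> \<sigma> (2 * x) \<le> b * \<sigma> x"
    and b: "1 \<le> b" and \<theta>: "0 < \<theta>" "1 \<le> b * \<theta>"
  shows "\<exists>C\<ge>1. \<forall>x k n. 0 < x \<longrightarrow> x \<le> x0 \<longrightarrow> \<sigma> (2 ^ k / 2 ^ n * x) \<le> C * (b ^ k * \<theta> ^ n) * \<sigma> x"
proof -
  \<comment> \<open>The factor accumulated up to scale \<open>y\<close>: it doubles with \<open>y\<close> between \<open>x0\<close> and \<open>x1\<close>. The cap is \<open>2 * x1\<close> and not
     \<open>x1\<close> because the last doubling that starts below \<open>x1\<close> may end above it.\<close>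
  define D where "D y = max 1 (min y (2 * x1) / x0)" for y
  define C where "C = max 1 (2 * x1 / x0)"
  have D_le: "D y \<le> C" for y unfolding D_def C_def using x0 by (intro max.mono divide_right_mono) auto
  have D1: "1 \<le> D y" for y by (simp add: D_def)
  have D_mono: "D y \<le> D z" if "y \<le> z" for y z
    unfolding D_def using x0 that by (intro max.mono divide_right_mono min.mono) auto
  have step: "\<sigma> (2 * y) * D y \<le> b * D (2 * y) * \<sigma> y" if y: "0 < y" for y
  proof (cases "x0 < y \<and> y < x1")
    case True
    then have D2: "D (2 * y) = 2 * D y"
      using x0 by (simp add: D_def max_def min_def field_simps)
    have "\<sigma> (2 * y) \<le> 2 * \<sigma> y" by (rule double[OF y])
    also have "\<dots> \<le> b * (2 * \<sigma> y)" using mult_right_mono[OF b, of "2 * \<sigma> y"] nonneg[of y] by simp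
    finally have "\<sigma> (2 * y) * D y \<le> b * (2 * \<sigma> y) * D y"
      using D1[of y] by (intro mult_right_mono) auto
    then show ?thesis unfolding D2 by (simp add: mult_ac)
  next
    case False
    then have "\<sigma> (2 * y) \<le> b * \<sigma> y" using small[of y] large[of y] y by linarith
    then have "\<sigma> (2 * y) * D y \<le> (b * \<sigma> y) * D (2 * y)"
      using D1[of y] D_mono[of y "2 * y"] y b nonneg by (intro mult_mono) auto
    then show ?thesis by (simp add: mult_ac)
  qed
  have up: "\<sigma> (2 ^ k * x) \<le> b ^ k * D (2 ^ k * x) * \<sigma> x" if x: "0 < x" for x k
  proof (induction k)
    case 0
    show ?case using mult_right_mono[OF D1[of x] nonneg[of x]] by simp
  next
    case (Suc k)
    let ?y = "2 ^ k * x"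
    have "\<sigma> (2 * ?y) * D ?y \<le> b * D (2 * ?y) * \<sigma> ?y" using x by (intro step) simp
    also have "\<dots> \<le> b * D (2 * ?y) * (b ^ k * D ?y * \<sigma> x)"
      using b D1[of "2 * ?y"] by (intro mult_left_mono Suc.IH) auto
    finally have "\<sigma> (2 * ?y) * D ?y \<le> (b ^ Suc k * D (2 * ?y) * \<sigma> x) * D ?y" by (simp add: mult_ac)
    moreover have "0 < D ?y" using D1[of ?y] by linarith
    ultimately show ?case by (simp add: mult.assoc)
  qed
  have down: "\<sigma> (x / 2 ^ j) \<le> \<theta> ^ j * \<sigma> x" if x: "0 < x" "x \<le> x0" for x j
  proof (induction j)
    case (Suc j)
    have "x / 2 ^ j \<le> x / 1" using x(1) by (intro divide_left_mono) auto
    then have "\<sigma> (x / 2 ^ j / 2) \<le> \<theta> * \<sigma> (x / 2 ^ j)" using x by (intro half) auto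
    also have "\<dots> \<le> \<theta> * (\<theta> ^ j * \<sigma> x)" using \<theta> by (intro mult_left_mono Suc.IH) auto
    finally show ?case by (simp add: mult_ac)
  qed simp
  have "\<sigma> (2 ^ k / 2 ^ n * x) \<le> C * (b ^ k * \<theta> ^ n) * \<sigma> x" if x: "0 < x" "x \<le> x0" for x k n
  proof (cases "k \<le> n")
    case True
    have C1: "1 \<le> C" by (simp add: C_def)
    have "2 ^ k / 2 ^ n * x = x / 2 ^ (n - k)" using True by (simp add: power_diff)
    then have "\<sigma> (2 ^ k / 2 ^ n * x) \<le> \<theta> ^ (n - k) * \<sigma> x" using down[OF x] by simp
    also have "\<dots> \<le> (C * ((b * \<theta>) ^ k * \<theta> ^ (n - k))) * \<sigma> x"
    proof (rule mult_right_mono[OF _ nonneg])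
      have "1 * (1 * \<theta> ^ (n - k)) \<le> C * ((b * \<theta>) ^ k * \<theta> ^ (n - k))"
        using \<theta> C1 one_le_power[OF \<theta>(2), of k] by (intro mult_mono) auto
      then show "\<theta> ^ (n - k) \<le> C * ((b * \<theta>) ^ k * \<theta> ^ (n - k))" by simp
    qed
    also have "(b * \<theta>) ^ k * \<theta> ^ (n - k) = b ^ k * \<theta> ^ n"
      using True by (simp add: power_mult_distrib mult.assoc flip: power_add)
    finally show ?thesis .
  next
    case False
    have "2 ^ k / 2 ^ n * x = 2 ^ (k - n) * x" using False by (simp add: power_diff)
    then have "\<sigma> (2 ^ k / 2 ^ n * x) \<le> b ^ (k - n) * D (2 ^ (k - n) * x) * \<sigma> x" using up[OF x(1)] by simp
    also have "\<dots> \<le> ((b ^ (k - n) * (b * \<theta>) ^ n) * C) * \<sigma> x"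
    proof (intro mult_right_mono[OF _ nonneg] mult_mono D_le)
      show "b ^ (k - n) \<le> b ^ (k - n) * (b * \<theta>) ^ n"
        using mult_left_mono[OF one_le_power[OF \<theta>(2), of n], of "b ^ (k - n)"] b by simp
    qed (use b \<theta> D1[of "2 ^ (k - n) * x"] in auto)
    also have "b ^ (k - n) * (b * \<theta>) ^ n = b ^ k * \<theta> ^ n"
      using False by (simp add: power_mult_distrib flip: power_add mult.assoc)
    finally show ?thesis by (simp add: mult_ac)
  qed
  moreover have "1 \<le> C" by (simp add: C_def)
  ultimately show ?thesis by blast
qed

section \<open>The scaling function tends to zero\<close>

text \<open>If halving \<open>x\<close> shrinks \<open>\<sigma>\<close> by less than the factor 2, then it shrinks \<open>x / \<sigma> x\<close> by a fixed factor
  below 1. Continuity bounds this ratio on one dyadic block, and the decay carries over to all smaller blocks.\<close>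

lemma identity_ratio_tendsto_0:
  fixes \<sigma> :: "real \<Rightarrow> real"
  assumes cont: "continuous_on UNIV \<sigma>" and x0: "0 < x0" and pos: "\<And>x. 0 < x \<Longrightarrow> x \<le> x0 \<Longrightarrow> 0 < \<sigma> x"
    and a: "1 / 2 < a" and half: "\<And>x. 0 < x \<Longrightarrow> x \<le> x0 \<Longrightarrow> a * \<sigma> x \<le> \<sigma> (x / 2)"
  shows "((\<lambda>x. x / \<sigma> x) \<longlongrightarrow> 0) (at_right 0)"
proof -
  define g where "g x = x / \<sigma> x" for x
  define \<kappa> where "\<kappa> = 1 / (2 * a)"
  have \<kappa>: "0 < \<kappa>" "\<kappa> < 1" using a by (auto simp: \<kappa>_def)
  have g_pos: "0 < g x" if "0 < x" "x \<le> x0" for x using pos[OF that] that by (simp add: g_def)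
  have g_half: "g (x / 2) \<le> \<kappa> * g x" if x: "0 < x" "x \<le> x0" for x
  proof -
    have "x / 2 / \<sigma> (x / 2) \<le> x / 2 / (a * \<sigma> x)"
      using pos[OF x] half[OF x] x a by (intro divide_left_mono) (auto intro!: mult_pos_pos pos)
    then show ?thesis by (simp add: g_def \<kappa>_def)
  qed
  have "\<sigma> x \<noteq> 0" if "x \<in> {x0 / 2..x0}" for x using pos[of x] that x0 by auto
  then have "continuous_on {x0 / 2..x0} g"
    unfolding g_def by (intro continuous_intros continuous_on_subset[OF cont]) auto
  then have "bounded (g ` {x0 / 2..x0})"
    by (intro compact_imp_bounded compact_continuous_image) auto
  then obtain G where G: "\<And>x. x0 / 2 \<le> x \<Longrightarrow> x \<le> x0 \<Longrightarrow> g x \<le> G"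
    unfolding bounded_iff by (metis abs_le_D1 atLeastAtMost_iff imageI real_norm_def)
  have G0: "0 < G" using g_pos[of x0] G[of x0] x0 by simp
  have decay: "g x \<le> \<kappa> ^ n * G" if "x0 / 2 ^ Suc n \<le> x" "x \<le> x0 / 2 ^ n" for n x
    using that
  proof (induction n arbitrary: x)
    case 0
    then show ?case using G by simp
  next
    case (Suc n)
    have x: "0 < x" using Suc.prems(1) x0 by (auto intro: less_le_trans[rotated])
    have le: "2 * x \<le> x0 / 2 ^ n" "x0 / 2 ^ Suc n \<le> 2 * x" using Suc.prems by (simp_all add: field_simps)
    have "x0 / 2 ^ n \<le> x0 / 1" using x0 by (intro divide_left_mono) auto
    then have "g (2 * x / 2) \<le> \<kappa> * g (2 * x)" using le x by (intro g_half) auto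
    also have "\<dots> \<le> \<kappa> * (\<kappa> ^ n * G)" using \<kappa> le by (intro mult_left_mono Suc.IH) auto
    finally show ?case by (simp add: mult_ac)
  qed
  show ?thesis
    unfolding g_def[symmetric]
  proof (rule tendstoI)
    fix e :: real assume e: "0 < e"
    have "(\<lambda>n. \<kappa> ^ n * G) \<longlonglongrightarrow> 0 * G" using \<kappa> by (intro tendsto_intros LIMSEQ_power_zero) auto
    then have "\<forall>\<^sub>F n in sequentially. \<kappa> ^ n * G < e" using e by (intro order_tendstoD(2)) auto
    then obtain N where N: "\<kappa> ^ N * G < e" by (auto simp: eventually_sequentially)
    have "dist (g x) 0 < e" if x: "0 < x" "x < x0 / 2 ^ N" for x
    proof -
      have "2 ^ N < x0 / x" using x by (simp add: field_simps)
      have ratio: "0 < x0 / x" using x x0 by simp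
      define n where "n = nat \<lfloor>log 2 (x0 / x)\<rfloor>"
      have "real N < log 2 (x0 / x)"
        using \<open>2 ^ N < x0 / x\<close> ratio by (simp add: less_log_iff powr_realpow)
      then have n: "real n \<le> log 2 (x0 / x)" "log 2 (x0 / x) < real (Suc n)" "N \<le> n"
        unfolding n_def by linarith+
      have "2 ^ n \<le> x0 / x" using n(1) ratio by (simp add: le_log_iff powr_realpow)
      moreover have "x0 / x < 2 ^ Suc n"
        using n(2) ratio by (simp only: log_less_iff powr_realpow zero_less_numeral)
      ultimately have "x0 / 2 ^ Suc n \<le> x" "x \<le> x0 / 2 ^ n" using x(1) by (simp_all add: field_simps)
      then have "g x \<le> \<kappa> ^ n * G" by (rule decay)
      also have "\<dots> \<le> \<kappa> ^ N * G" using \<kappa> G0 n(3) by (intro mult_right_mono power_decreasing) auto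
      finally have "g x < e" using N by simp
      moreover have "x0 / 2 ^ N \<le> x0 / 1" using x0 by (intro divide_left_mono) auto
      then have "0 < g x" using x by (intro g_pos) auto
      ultimately show ?thesis by simp
    qed
    then show "\<forall>\<^sub>F x in at_right 0. dist (g x) 0 < e"
      unfolding eventually_at_right_field using x0 by (intro exI[of _ "x0 / 2 ^ N"]) auto
  qed
qed

text \<open>The ratio \<open>x / \<sigma> x\<close> tends to 0, so by the intermediate value theorem it takes the value \<open>1 / c\<close> below any
  given level once \<open>c\<close> is large, but for fixed \<open>c\<close> not arbitrarily close to 0; the infimum is then small
  and positive.\<close>

lemma delta_tendsto_0:
  assumes cont: "continuous_on UNIV \<sigma>" and pos: "\<forall>\<^sub>F x in at_right 0. 0 < \<sigma> x"
    and lim: "((\<lambda>x. x / \<sigma> x) \<longlongrightarrow> 0) (at_right 0)"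
  shows "filterlim (delta \<sigma>) (at_right 0) at_top"
proof -
  obtain x0 where x0: "0 < x0" "\<And>x. 0 < x \<Longrightarrow> x < x0 \<Longrightarrow> 0 < \<sigma> x"
    using pos unfolding eventually_at_right_field by auto
  have ev: "\<forall>\<^sub>F c in at_top. 0 < delta \<sigma> c \<and> delta \<sigma> c < e" if e: "0 < e" for e
  proof -
    define y where "y = min e x0 / 2"
    have y: "0 < y" "y < e" "y < x0" using e x0 by (auto simp: y_def min_def)
    have gy: "0 < y / \<sigma> y" using y x0(2)[of y] by simp
    have "0 < delta \<sigma> c \<and> delta \<sigma> c < e" if c: "c > 1 / (y / \<sigma> y)" for c
    proof -
      have "0 < 1 / (y / \<sigma> y)" by (rule divide_pos_pos[OF zero_less_one gy])
      then have c0: "0 < c" using c by linarith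
      have "1 / c < G" if "1 / G < c" "0 < G" for G using that c0 by (simp add: field_simps)
      from this[OF c gy] have cy: "1 / c < y / \<sigma> y" .
      obtain h where h: "0 < h" "\<And>x. 0 < x \<Longrightarrow> x < h \<Longrightarrow> x / \<sigma> x < 1 / c"
        using order_tendstoD(2)[OF lim, of "1 / c"] c0 unfolding eventually_at_right_field by auto
      define z where "z = min h y / 2"
      have z: "0 < z" "z < h" "z < y" using h y by (auto simp: z_def min_def)
      have "\<sigma> x \<noteq> 0" if "x \<in> {z..y}" for x using x0(2)[of x] that z y by auto
      then have "continuous_on {z..y} (\<lambda>x. x / \<sigma> x)"
        by (intro continuous_intros continuous_on_subset[OF cont]) auto
      then obtain x where x: "z \<le> x" "x \<le> y" "x / \<sigma> x = 1 / c"
        using IVT'[of "\<lambda>x. x / \<sigma> x" z "1 / c" y] h(2)[OF z(1,2)] cy z by auto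
      let ?S = "{x. x > 0 \<and> x / \<sigma> x = 1 / c}"
      have xS: "x \<in> ?S" using x z by simp
      have hS: "h \<le> u" if "u \<in> ?S" for u using h(2)[of u] that by force
      have "h \<le> Inf ?S" using xS hS by (intro cInf_greatest) auto
      moreover have "Inf ?S \<le> x" using xS hS by (intro cInf_lower bdd_belowI[of _ h]) auto
      ultimately show ?thesis unfolding delta_def using h(1) x(2) y(2) by simp
    qed
    then show ?thesis by (intro eventually_mono[OF eventually_gt_at_top])
  qed
  have "(delta \<sigma> \<longlongrightarrow> 0) at_top"
    by (rule tendstoI) (use ev in \<open>force elim: eventually_mono\<close>)
  moreover have "\<forall>\<^sub>F c in at_top. delta \<sigma> c \<in> {0<..} \<and> delta \<sigma> c \<noteq> 0"
    using ev[of 1] by (auto elim: eventually_mono)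
  ultimately show ?thesis by (simp add: filterlim_at)
qed

section \<open>The rescaled process\<close>

context gaussian_stationary_increments
begin

definition scaled :: "real \<Rightarrow> real \<Rightarrow> 'a \<Rightarrow> real" where
  "scaled d t \<omega> = X (d * t) \<omega> / \<sigma> d"

context
  fixes d :: real
  assumes pos: "0 < \<sigma> d"
begin

lemma gaussian_process_scaled: "gaussian_process M (scaled d)"
proof -
  have "gaussian_rv M (\<lambda>\<omega>. \<Sum>t\<in>J. a t * scaled d t \<omega>)" if "finite J" for J a
    using gaussian_process_sum[OF gaussian that, of "\<lambda>t. a t / \<sigma> d" "\<lambda>t. d * t"] by (simp add: scaled_def)
  then show ?thesis using prob_space_axioms by (simp add: gaussian_process_def)
qed

lemma centered_scaled: "centered M (scaled d)"
  using centered by (simp add: centered_def scaled_def[abs_def])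

lemma continuous_paths_scaled: "continuous_paths M (scaled d)"
  unfolding continuous_paths_def scaled_def
proof
  fix \<omega> assume "\<omega> \<in> space M"
  then have "continuous_on UNIV (\<lambda>t. X t \<omega>)" using cont by (simp add: continuous_paths_def)
  then have "continuous_on UNIV (\<lambda>t. X (d * t) \<omega>)"
    by (rule continuous_on_compose2) (auto intro: continuous_intros)
  then show "continuous_on UNIV (\<lambda>t. X (d * t) \<omega> / \<sigma> d)"
    using pos by (intro continuous_intros) auto
qed

lemma scaled_0: "AE \<omega> in M. scaled d 0 \<omega> = 0"
  using zero by eventually_elim (simp add: scaled_def)

lemma scaled_increment: "expectation (\<lambda>\<omega>. (scaled d t \<omega> - scaled d s \<omega>)\<^sup>2) = (\<sigma> (d * (t - s)) / \<sigma> d)\<^sup>2"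
proof -
  have "expectation (\<lambda>\<omega>. (scaled d t \<omega> - scaled d s \<omega>)\<^sup>2) = expectation (\<lambda>\<omega>. (X (d * t) \<omega> - X (d * s) \<omega>)\<^sup>2 / (\<sigma> d)\<^sup>2)"
    by (simp add: scaled_def diff_divide_distrib[symmetric] power_divide)
  then show ?thesis by (simp add: increment_variance right_diff_distrib power_divide)
qed

lemma scaled_product: "expectation (\<lambda>\<omega>. scaled d s \<omega> * scaled d t \<omega>) =
  ((\<sigma> (d * s) / \<sigma> d)\<^sup>2 + (\<sigma> (d * t) / \<sigma> d)\<^sup>2 - (\<sigma> (d * (t - s)) / \<sigma> d)\<^sup>2) / 2"
proof -
  have "expectation (\<lambda>\<omega>. scaled d s \<omega> * scaled d t \<omega>) = expectation (\<lambda>\<omega>. (X (d * s) \<omega> * X (d * t) \<omega>) / (\<sigma> d)\<^sup>2)"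
    by (simp add: scaled_def power2_eq_square)
  then show ?thesis
    by (simp add: expectation_product right_diff_distrib power_divide diff_divide_distrib add_divide_distrib)
qed

end

text \<open>Regular variation concerns positive multiples; evenness of \<open>\<sigma>\<close> and \<open>\<sigma> 0 = 0\<close> extend it to all real
  multiples, as needed for the covariances.\<close>

lemma std_dev_ratio_tendsto:
  assumes rv: "regularly_varying_at_zero \<sigma> l"
  shows "((\<lambda>x. \<sigma> (x * u) / \<sigma> x) \<longlongrightarrow> \<bar>u\<bar> powr l) (at_right 0)"
proof -
  have rv': "((\<lambda>x. \<sigma> (t * x) / \<sigma> x) \<longlongrightarrow> t powr l) (at_right 0)" if "0 < t" for t
    using rv that by (simp add: regularly_varying_at_zero_def)
  consider "0 < u" | "u = 0" | "u < 0" by linarith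
  then show ?thesis
  proof cases
    case 3
    have "\<sigma> (x * u) = \<sigma> (- u * x)" for x using std_dev_minus[of "- u * x"] by (simp add: mult.commute)
    then show ?thesis using rv'[of "- u"] 3 by simp
  qed (use rv'[of u] in \<open>simp_all add: mult.commute std_dev_0\<close>)
qed

text \<open>The scaled covariances converge because \<open>\<sigma>\<close> is regularly varying at zero and \<open>delta \<sigma> c\<close> tends to 0. The
  two conditions on doubling give the uniform moment bound; the freedom in \<open>b\<close> lets one argument serve
  both modes of convergence. The condition \<open>2 powr l \<le> b\<close> is for the limit process.\<close>

lemma rescaled_converges_Omega:
  assumes rv: "regularly_varying_at_zero \<sigma> l" and l: "0 < l" "l < 1"
    and B: "fractional_brownian_motion l N B"
    and \<gamma>: "0 < \<gamma>" "b < 2 powr \<gamma>" and b: "1 < b" "2 powr l \<le> b"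
    and small: "\<forall>\<^sub>F x in at_right 0. \<sigma> (2 * x) \<le> b * \<sigma> x"
    and large: "\<forall>\<^sub>F x in at_top. \<sigma> (2 * x) \<le> b * \<sigma> x"
  shows "converges_in_distribution at_top (Omega_topology \<gamma>) M (rescaled \<sigma> X) N (\<lambda>\<omega> t. B t \<omega>)"
proof -
  have half_lim: "((\<lambda>x. \<sigma> (1 / 2 * x) / \<sigma> x) \<longlongrightarrow> (1 / 2) powr l) (at_right 0)"
  proof -
    have "\<forall>t>0. ((\<lambda>x. \<sigma> (t * x) / \<sigma> x) \<longlongrightarrow> t powr l) (at_right 0)"
      using rv by (simp add: regularly_varying_at_zero_def)
    from this[rule_format, of "1 / 2"] show ?thesis by simp
  qed
  have L: "1 / 2 < (1 / 2 :: real) powr l" "(1 / 2 :: real) powr l < 1"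
    using l powr_less_mono'[of "1 / 2" l 1] powr_less_mono'[of "1 / 2" 0 l] by simp_all
  have nonneg: "\<forall>\<^sub>F x in F. 0 \<le> \<sigma> x" for F by (simp add: std_dev_nonneg)
  note ratio = eventually_le_of_ratio_tendsto[OF half_lim _ nonneg]
  obtain a where a: "1 / 2 < a" "a < (1 / 2) powr l" using dense[OF L(1)] by blast
  obtain q where q: "(1 / 2) powr l < q" "q < 1" using dense[OF L(2)] by blast
  \<comment> \<open>The second entry enforces \<open>1 \<le> b * \<theta>\<close>.\<close>
  define \<theta> where "\<theta> = max q (1 / b)"
  have \<theta>: "0 < \<theta>" "\<theta> < 1" "q \<le> \<theta>" "1 \<le> b * \<theta>"
  proof -
    have "(0 :: real) < (1 / 2) powr l" by simp
    then have "0 < q" using q(1) by linarith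
    then show "0 < \<theta>" "\<theta> < 1" "q \<le> \<theta>"
      using q b by (simp_all add: \<theta>_def less_max_iff_disj)
    have "b * (1 / b) \<le> b * \<theta>" using b by (intro mult_left_mono) (simp_all add: \<theta>_def)
    then show "1 \<le> b * \<theta>" using b by simp
  qed
  obtain m where m: "\<theta> ^ m \<le> 1 / 4"
    using real_arch_pow_inv[of "1 / 4" \<theta>] \<theta>(2) by (auto intro: less_imp_le)
  have "\<forall>\<^sub>F x in at_right 0. 0 < \<sigma> x \<and> \<sigma> (2 * x) \<le> b * \<sigma> x \<and> \<sigma> (1 / 2 * x) \<le> q * \<sigma> x \<and> a * \<sigma> x \<le> \<sigma> (1 / 2 * x)"
    by (intro eventually_conj small ratio(1) ratio(2) ratio(3) a q) simp_all
  then obtain x0' where x0': "0 < x0'" and near: "\<forall>x>0. x < x0' \<longrightarrow>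
      0 < \<sigma> x \<and> \<sigma> (2 * x) \<le> b * \<sigma> x \<and> \<sigma> (1 / 2 * x) \<le> q * \<sigma> x \<and> a * \<sigma> x \<le> \<sigma> (1 / 2 * x)"
    unfolding eventually_at_right_field by (elim exE conjE)
  define x0 where "x0 = x0' / 2"
  have x0: "0 < x0" using x0' by (simp add: x0_def)
  have near0: "0 < \<sigma> x" "\<sigma> (2 * x) \<le> b * \<sigma> x" "\<sigma> (x / 2) \<le> q * \<sigma> x" "a * \<sigma> x \<le> \<sigma> (x / 2)"
    if "0 < x" "x \<le> x0" for x
    using near[rule_format, of x] that x0' by (simp_all add: x0_def)
  obtain x1 where x1: "\<And>x. x1 \<le> x \<Longrightarrow> \<sigma> (2 * x) \<le> b * \<sigma> x"
    using large unfolding eventually_at_top_linorder by blast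
  have "\<exists>C\<ge>1. \<forall>x k n. 0 < x \<longrightarrow> x \<le> x0 \<longrightarrow> \<sigma> (2 ^ k / 2 ^ n * x) \<le> C * (b ^ k * \<theta> ^ n) * \<sigma> x"
  proof (rule dyadic_growth[where b = b and \<theta> = \<theta> and ?x1.0 = x1])
    fix x assume x: "0 < x" "x \<le> x0"
    have "\<sigma> (x / 2) \<le> q * \<sigma> x" by (rule near0(3)[OF x])
    also have "\<dots> \<le> \<theta> * \<sigma> x" using \<theta>(3) by (intro mult_right_mono std_dev_nonneg)
    finally show "\<sigma> (x / 2) \<le> \<theta> * \<sigma> x" .
  qed (use b \<theta> in \<open>simp_all add: std_dev_nonneg std_dev_double near0(2) x0 x1\<close>)
  then obtain C where C: "1 \<le> C"
    "\<forall>x k n. 0 < x \<longrightarrow> x \<le> x0 \<longrightarrow> \<sigma> (2 ^ k / 2 ^ n * x) \<le> C * (b ^ k * \<theta> ^ n) * \<sigma> x" by (elim exE conjE)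
  have delta_0: "filterlim (delta \<sigma>) (at_right 0) at_top"
  proof (rule delta_tendsto_0[OF continuous_std_dev])
    show "\<forall>\<^sub>F x in at_right 0. 0 < \<sigma> x" by (rule ratio(3)) simp
    show "((\<lambda>x. x / \<sigma> x) \<longlongrightarrow> 0) (at_right 0)"
      by (rule identity_ratio_tendsto_0[OF continuous_std_dev x0 near0(1) a(1) near0(4)])
  qed
  have "\<forall>\<^sub>F x in at_right 0. 0 < x \<and> x \<le> x0"
    unfolding eventually_at_right_field using x0 by (intro exI[of _ x0]) auto
  then have delta_small: "\<forall>\<^sub>F c in at_top. 0 < delta \<sigma> c \<and> delta \<sigma> c \<le> x0"
    using delta_0 by (rule eventually_compose_filterlim)
  define K where "K = gaussian_moment m * C ^ (2 * m)"
  have B': "gaussian_process N B" "centered N B" "continuous_paths N B" "AE \<omega> in N. B 0 \<omega> = 0"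
    using B by (simp_all add: fractional_brownian_motion_def)
  interpret N: prob_space N using B'(1) by (simp add: gaussian_process_def)
  have B_prod: "N.expectation (\<lambda>\<omega>. B s \<omega> * B t \<omega>) = (\<bar>s\<bar> powr (2 * l) + \<bar>t\<bar> powr (2 * l) - \<bar>t - s\<bar> powr (2 * l)) / 2" for s t
  proof -
    have "covariance N (B t) (B s) = (\<bar>s\<bar> powr (2 * l) + \<bar>t\<bar> powr (2 * l) - \<bar>t - s\<bar> powr (2 * l)) / 2"
      using B unfolding fractional_brownian_motion_def by blast
    moreover have "N.expectation (B u) = 0" for u using B'(2) by (simp add: centered_def)
    ultimately show ?thesis by (simp add: covariance_def mult.commute)
  qed
  have B_incr: "N.expectation (\<lambda>\<omega>. (B t \<omega> - B s \<omega>)\<^sup>2) = \<bar>t - s\<bar> powr (2 * l)" for s t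
  proof -
    have "N.expectation (\<lambda>\<omega>. (B t \<omega> - B s \<omega>)\<^sup>2) =
        N.expectation (\<lambda>\<omega>. B t \<omega> * B t \<omega> + B s \<omega> * B s \<omega> - 2 * (B s \<omega> * B t \<omega>))"
      by (simp add: power2_eq_square algebra_simps)
    also have "\<dots> = N.expectation (\<lambda>\<omega>. B t \<omega> * B t \<omega>) + N.expectation (\<lambda>\<omega>. B s \<omega> * B s \<omega>) -
        2 * N.expectation (\<lambda>\<omega>. B s \<omega> * B t \<omega>)"
      by (simp add: N.centered_gaussian_process_square_integrable(3)[OF B'(1,2)])
    finally show ?thesis by (simp add: B_prod field_simps)
  qed
  have "converges_in_distribution at_top (Omega_topology \<gamma>) M (\<lambda>c \<omega> t. scaled (delta \<sigma> c) t \<omega>) N (\<lambda>\<omega> t. B t \<omega>)"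
  proof (rule gaussian_weak_convergence_Omega[where m = m and K = K and b = b and \<theta> = \<theta>])
    show "0 \<le> K" using C(1) by (simp add: K_def gaussian_moment_nonneg)
    show "dyadic_moment_bound N B m K b \<theta>"
      unfolding K_def
    proof (rule dyadic_moment_boundI[OF B'])
      fix k n s
      have "(2 ^ k / 2 ^ n :: real) powr l = (2 powr l) ^ k * ((1 / 2) powr l) ^ n"
        by (simp add: powr_divide powr_power powr_realpow[symmetric] powr_powr mult.commute power_divide)
      also have "\<dots> \<le> b ^ k * \<theta> ^ n"
        using b \<theta> q by (intro mult_mono power_mono) auto
      also have "\<dots> \<le> C * (b ^ k * \<theta> ^ n)"
        using mult_right_mono[OF C(1), of "b ^ k * \<theta> ^ n"] b \<theta> by simp
      finally have "((2 ^ k / 2 ^ n :: real) powr l)\<^sup>2 \<le> (C * (b ^ k * \<theta> ^ n))\<^sup>2"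
        by (intro power_mono) auto
      then show "N.expectation (\<lambda>\<omega>. (B (s + 2 ^ k / 2 ^ n) \<omega> - B s \<omega>)\<^sup>2) \<le> (C * (b ^ k * \<theta> ^ n))\<^sup>2"
        unfolding B_incr by (simp add: power2_eq_square powr_add[symmetric])
    qed (use C(1) in simp)
    show "\<forall>\<^sub>F c in at_top. gaussian_process M (scaled (delta \<sigma> c)) \<and> centered M (scaled (delta \<sigma> c)) \<and>
        dyadic_moment_bound M (scaled (delta \<sigma> c)) m K b \<theta>"
      using delta_small
    proof eventually_elim
      case (elim c)
      then have pos: "0 < \<sigma> (delta \<sigma> c)" using near0(1) by blast
      note scaled = gaussian_process_scaled[OF pos] centered_scaled[OF pos] continuous_paths_scaled[OF pos] scaled_0[OF pos]
      have "dyadic_moment_bound M (scaled (delta \<sigma> c)) m K b \<theta>"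
        unfolding K_def
      proof (rule dyadic_moment_boundI[OF scaled])
        fix k n s
        have "\<sigma> (delta \<sigma> c * (2 ^ k / 2 ^ n)) / \<sigma> (delta \<sigma> c) \<le> C * (b ^ k * \<theta> ^ n)"
          using C(2)[rule_format, of "delta \<sigma> c" k n] elim pos by (simp add: pos_divide_le_eq mult.commute)
        then have "(\<sigma> (delta \<sigma> c * (2 ^ k / 2 ^ n)) / \<sigma> (delta \<sigma> c))\<^sup>2 \<le> (C * (b ^ k * \<theta> ^ n))\<^sup>2"
          using std_dev_nonneg by (intro power_mono) auto
        then show "expectation (\<lambda>\<omega>. (scaled (delta \<sigma> c) (s + 2 ^ k / 2 ^ n) \<omega> - scaled (delta \<sigma> c) s \<omega>)\<^sup>2)
            \<le> (C * (b ^ k * \<theta> ^ n))\<^sup>2"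
          unfolding scaled_increment[OF pos] by simp
      qed (use C(1) in simp)
      with scaled show ?case by blast
    qed
    fix s t
    have lim: "((\<lambda>c. \<sigma> (delta \<sigma> c * u) / \<sigma> (delta \<sigma> c)) \<longlongrightarrow> \<bar>u\<bar> powr l) at_top" for u
      by (rule filterlim_compose[OF std_dev_ratio_tendsto[OF rv] delta_0])
    have sq: "(\<bar>u\<bar> powr l)\<^sup>2 = \<bar>u\<bar> powr (2 * l)" for u :: real
      by (simp add: power2_eq_square powr_add[symmetric])
    let ?r = "\<lambda>c u. \<sigma> (delta \<sigma> c * u) / \<sigma> (delta \<sigma> c)"
    have "((\<lambda>c. ((?r c s)\<^sup>2 + (?r c t)\<^sup>2 - (?r c (t - s))\<^sup>2) / 2) \<longlongrightarrow>
        ((\<bar>s\<bar> powr l)\<^sup>2 + (\<bar>t\<bar> powr l)\<^sup>2 - (\<bar>t - s\<bar> powr l)\<^sup>2) / 2) at_top"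
      by (intro tendsto_intros lim) simp
    moreover have "\<forall>\<^sub>F c in at_top. ((?r c s)\<^sup>2 + (?r c t)\<^sup>2 - (?r c (t - s))\<^sup>2) / 2 =
        expectation (\<lambda>\<omega>. scaled (delta \<sigma> c) s \<omega> * scaled (delta \<sigma> c) t \<omega>)"
      using delta_small
    proof eventually_elim
      case (elim c)
      then have "0 < \<sigma> (delta \<sigma> c)" using near0(1) by blast
      then show ?case by (simp only: scaled_product)
    qed
    ultimately show "((\<lambda>c. expectation (\<lambda>\<omega>. scaled (delta \<sigma> c) s \<omega> * scaled (delta \<sigma> c) t \<omega>)) \<longlongrightarrow>
        N.expectation (\<lambda>\<omega>. B s \<omega> * B t \<omega>)) at_top"
      unfolding B_prod sq by (rule Lim_transform_eventually)
  qed (use b \<theta> m \<gamma> B' prob_space_axioms in auto)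
  moreover have "rescaled \<sigma> X = (\<lambda>c \<omega> t. scaled (delta \<sigma> c) t \<omega>)"
    by (simp add: rescaled_def scaled_def fun_eq_iff)
  ultimately show ?thesis by simp
qed

end

theorem proposition4:
  fixes M :: "'a measure" and X :: "real \<Rightarrow> 'a \<Rightarrow> real"
    and N :: "'b measure" and B :: "real \<Rightarrow> 'b \<Rightarrow> real"
    and l :: real
  assumes "gaussian_process M X" and "centered M X" and "stationary_increments M X"
    and "AE \<omega> in M. X 0 \<omega> = 0" and "continuous_paths M X"
    and "0 < l" and "l < 1" and "regularly_varying_at_zero (std_dev M X) l"
    and "fractional_brownian_motion l N B"
  shows "converges_in_distribution at_top uniform_on_compacts_topology
           M (rescaled (std_dev M X) X) N (\<lambda>\<omega> t. B t \<omega>) \<and>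
         (\<forall>\<alpha> \<gamma>. 0 < \<alpha> \<and> \<alpha> < 1 \<and> regularly_varying_at_infinity (std_dev M X) \<alpha> \<and>
            max l \<alpha> < \<gamma> \<longrightarrow>
            converges_in_distribution at_top (Omega_topology \<gamma>)
              M (rescaled (std_dev M X) X) N (\<lambda>\<omega> t. B t \<omega>))"
proof (intro conjI allI impI)
  interpret prob_space M using assms(1) by (simp add: gaussian_process_def)
  interpret gaussian_stationary_increments M X by unfold_locales fact+
  note Omega = rescaled_converges_Omega[OF assms(8,6,7,9)]
  \<comment> \<open>For the exponent 2 the rate \<open>b = 2\<close> is admissible, and \<open>std_dev_double\<close> provides it at all scales.\<close>
  show "converges_in_distribution at_top uniform_on_compacts_topology M (rescaled \<sigma> X) N (\<lambda>\<omega> t. B t \<omega>)"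
  proof (rule converges_uniformly_on_compacts_of_Omega[where \<gamma> = 2 and Y = "\<lambda>c t \<omega>. rescaled \<sigma> X c \<omega> t"])
    have "2 powr l \<le> 2 powr 1" using assms(7) by (intro powr_mono) auto
    then show "converges_in_distribution at_top (Omega_topology 2) M (rescaled \<sigma> X) N (\<lambda>\<omega> t. B t \<omega>)"
      by (intro Omega[where b = 2]) (simp_all add: std_dev_double)
    have "continuous_on UNIV (\<lambda>t. X (d * t) \<omega>)" if "\<omega> \<in> space M" for d \<omega>
      by (rule continuous_on_compose2[of UNIV "\<lambda>t. X t \<omega>"])
        (use assms(5) that in \<open>auto simp: continuous_paths_def intro: continuous_intros\<close>)
    then have "continuous_on UNIV (\<lambda>t. X (d * t) \<omega> * inverse (\<sigma> d))" if "\<omega> \<in> space M" for d \<omega>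
      using that by (intro continuous_on_mult continuous_on_const)
    then show "\<forall>\<^sub>F c in at_top. continuous_paths M (\<lambda>t \<omega>. rescaled \<sigma> X c \<omega> t) \<and>
        (\<forall>t. (\<lambda>\<omega>. rescaled \<sigma> X c \<omega> t) \<in> borel_measurable M)"
      by (simp add: continuous_paths_def rescaled_def divide_inverse)
    show "continuous_paths N B" using assms(9) by (simp add: fractional_brownian_motion_def)
    have B: "gaussian_process N B" "centered N B" using assms(9) by (simp_all add: fractional_brownian_motion_def)
    then interpret N: prob_space N by (simp add: gaussian_process_def)
    show "B t \<in> borel_measurable N" for t by (rule N.centered_gaussian_process_square_integrable(1)[OF B])
  qed simp
  fix \<alpha> \<gamma>
  assume *: "0 < \<alpha> \<and> \<alpha> < 1 \<and> regularly_varying_at_infinity \<sigma> \<alpha> \<and> max l \<alpha> < \<gamma>"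
  then obtain \<beta> where \<beta>: "max l \<alpha> < \<beta>" "\<beta> < \<gamma>" using dense by blast
  have "((\<lambda>x. \<sigma> (2 * x) / \<sigma> x) \<longlongrightarrow> 2 powr l) (at_right 0)"
    using assms(8) by (simp add: regularly_varying_at_zero_def)
  then have small: "\<forall>\<^sub>F x in at_right 0. \<sigma> (2 * x) \<le> 2 powr \<beta> * \<sigma> x"
    by (rule eventually_le_of_ratio_tendsto) (use \<beta> in \<open>simp_all add: std_dev_nonneg\<close>)
  have "((\<lambda>x. \<sigma> (2 * x) / \<sigma> x) \<longlongrightarrow> 2 powr \<alpha>) at_top"
    using * by (simp add: regularly_varying_at_infinity_def)
  then have large: "\<forall>\<^sub>F x in at_top. \<sigma> (2 * x) \<le> 2 powr \<beta> * \<sigma> x"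
    by (rule eventually_le_of_ratio_tendsto) (use \<beta> in \<open>simp_all add: std_dev_nonneg\<close>)
  show "converges_in_distribution at_top (Omega_topology \<gamma>) M (rescaled \<sigma> X) N (\<lambda>\<omega> t. B t \<omega>)"
    using \<beta> assms(6) by (intro Omega[OF _ _ _ _ small large] powr_mono powr_less_mono) (simp_all add: gr_one_powr)
qed

end
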